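(* Let $\theta_0\in\Theta$, $f_0\in H$. Assume: (a) (Smoothing and entropy) There is a normed space $(S,\|\cdot\|_S)$ with $S\subset H$, whose norm is stronger than that of $H$, such that $K_\theta H\subset S$ for all $\theta\in\Theta$ and $$\int_0^1\sqrt{\log N\bigl(\epsilon,\{h:\|h\|_S\le 1\},\|\cdot\|_H\bigr)}\,d\epsilon<\infty .$$ (b) (Regularity) There are operators $\dot K_\theta:H\to H$ with $(K_{\theta+s}f-K_\theta f)/s\to\dot K_\theta f$ in $H$ as $s\to0$, for every $f\in H$, $\theta\in\Theta$, and constants $D_0,D_1,D_2$ such that for all $\theta\in\Theta$: (i) $\|K_\theta\|\le D_0$ and $\|\dot K_\theta\|\le D_0$; (ii) $\|K_\theta-K_{\theta_0}\|_{H\to S}\le D_1|\theta-\theta_0|$; (iii) $\|K_\theta-K_{\theta_0}-(\theta-\theta_0)\dot K_{\theta_0}\|_{H\to S}\le D_2(\theta-\theta_0)^2$. (c) The posterior distribution of $(\theta,f)$ is consistent at $(\theta_0,f_0)$, and $\dot K_{\theta_0}f_0\ne0$. (d) There exist a sequence $(\gamma_n)\subset H$ with $\gamma_n\to\gamma_{\theta_0,f_0}$ and subsets $\Theta_n\subset\Theta$, $H_n\subset H$ with $\sqrt n(\Theta_n-\theta_0)\uparrow\mathbb R$ such that, as $n\to\infty$ (the first two convergences being in $P^n_{\theta_0,f_0}$-probability), $$\Pi(\Theta_n\times H_n\mid X^n)\to1,\qquad \inf_{\theta\in\Theta_n}\Pi^{\theta=\theta_0}\bigl(H_n+(\theta-\theta_0)\gamma_n\mid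 X^n\bigr)\to1,$$ $$\sqrt n\,\sup_{f\in H_n}\bigl|\langle f-f_0,(I+K_{\theta_0}^*K_{\theta_0})(\gamma_{\theta_0,f}-\gamma_n)\rangle\bigr|\to0,$$ $$\sup_{\theta\in\Theta_n,\,f\in H_n}\left|\frac{\log\bigl(d\pi_{f+(\theta-\theta_0)\gamma_n}/d\pi_f\bigr)(f)}{1+n(\theta-\theta_0)^2}\right|\to0 .$$ Then the Bernstein-von Mises theorem holds at $(\theta_0,f_0)$, i.e. in $P^n_{\theta_0,f_0}$-probability as $n\to\infty$, $$\Big\|\Pi(\theta\in\cdot\mid X^n)-N\Big(\theta_0+\tfrac1{\sqrt n}\Delta^n_{\theta_0,f_0},\ \tfrac1n\tilde I_{\theta_0,f_0}^{-1}\Big)\Big\|_{\rm TV}\to0 .$$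
   Context: Model. $\Theta\subset\mathbb R$ is compact, $(H,\langle\cdot,\cdot\rangle,\|\cdot\|)$ is a separable Hilbert space, and $K_\theta:H\to H$, $\theta\in\Theta$, are bounded linear operators with adjoints $K_\theta^*$. $\|A\|_{H\to S}=\sup_{\|h\|\le1}\|Ah\|_S$ is the operator norm, written $\|A\|$ if $S=H$. $N(\epsilon,A,d)$ is the minimal number of $d$-balls of radius $\epsilon$ needed to cover $A$. Fix an orthonormal basis $(e_k)_{k\in\mathbb N}$ of $H$. $P^n_{\theta,f}$ is the law of $X^n=(X^{(1)},X^{(2)})$, two sequences with $$X^{(1)}_k=\langle f,e_k\rangle+n^{-1/2}Z_{1,k},\qquad X^{(2)}_k=\langle K_\theta f,e_k\rangle+n^{-1/2}Z_{2,k},$$ where the $Z_{i,k}$ are i.i.d. standard normal. For $h\in H$, $\langle X^{(i)},h\rangle:=\sum_kX^{(i)}_k\langle h,e_k\rangle$ (convergent in $L_2$ and almost surely), and, under $P^n_{\theta,f}$, $\langle h,\dot W^{(1)}\rangle:=\sqrt n(\langle X^{(1)},h\rangle-\langle f,h\rangle)$ and $\langle h,\dot W^{(2)}\rangle:=\sqrt n(\langle X^{(2)},h\rangle-\langle K_\theta f,h\rangle)$. With $P_0^n$ the law for $f=0$, $$\log\frac{dP^n_{\theta,f}}{dP^n_0}(X^n)=n\langle X^{(1)},f\rangle-\tfrac n2\|f\|^2+n\langle X^{(2)},K_\theta f\rangle-\tfrac n2\|K_\theta f\|^2 .$$ Prior and posterior. The prior is $\Pi=\pi_\theta\times\pi_f$,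 where $\pi_\theta$ has a continuous Lebesgue density on $\Theta$ bounded away from $0$ and $\infty$, and $\pi_f$ is a probability measure on $H$. $\Pi(\cdot\mid X^n)$ is the posterior of $(\theta,f)$ obtained from the likelihood $\frac{dP^n_{\theta,f}}{dP^n_0}(X^n)=\exp\bigl(n\langle X^{(1)},f\rangle-\tfrac n2\|f\|^2+n\langle X^{(2)},K_\theta f\rangle-\tfrac n2\|K_\theta f\|^2\bigr)$ by Bayes' formula; $\Pi^{\theta=\theta_0}(\cdot\mid X^n)$ is the posterior of $f$ (prior $\pi_f$) in the model where $\theta=\theta_0$ is known. For $h\in H$, $\pi_{f+h}$ denotes the law of $f+h$ when $f\sim\pi_f$. The posterior of $(\theta,f)$ is consistent at $(\theta_0,f_0)$ if $\Pi(|\theta-\theta_0|<\epsilon_n,\|f-f_0\|<\epsilon_n\mid X^n)\to1$ in $P^n_{\theta_0,f_0}$-probability for some sequence $\epsilon_n\to0$. Semiparametric quantities. The least favorable direction is $\gamma_{\theta,f}=(I+K_\theta^*K_\theta)^{-1}K_\theta^*\dot K_\theta f$, and the efficient Fisher information is $\tilde I_{\theta,f}=\|\gamma_{\theta,f}\|^2+\|\dot K_\theta f-K_\theta\gamma_{\theta,f}\|^2$. Further $$\Delta^n_{\theta,f}=\frac1{\tilde I_{\theta,f}}\bigl(\langle\dot K_\theta f,\dot W^{(2)}\rangle-\langle\gamma_{\theta,f},\dot W^{(1)}\rangle-\langle K_\theta\gamma_{\theta,f},\dot W^{(2)}\rangle\bigr),$$ a measurable transformation of $X^n$ distributed as $N(0,\tilde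 I_{\theta,f}^{-1})$ under $P^n_{\theta,f}$. The total variation distance is $\|P-Q\|_{\rm TV}=2\sup_F|P(F)-Q(F)|$. *)

theory Defs
  imports "HOL-Probability.Probability"
begin

section \<open>Hilbert space notions\<close>

definition orthonormal_basis :: "(nat \<Rightarrow> 'h::real_inner) \<Rightarrow> bool" where
  "orthonormal_basis e \<longleftrightarrow>
     (\<forall>i j. e i \<bullet> e j = (if i = j then 1 else 0)) \<and> closure (span (range e)) = UNIV"

definition norm_on :: "'h::real_vector set \<Rightarrow> ('h \<Rightarrow> real) \<Rightarrow> bool" where
  "norm_on S nS \<longleftrightarrow> subspace S \<and>
     (\<forall>h\<in>S. 0 \<le> nS h \<and> (nS h = 0 \<longleftrightarrow> h = 0)) \<and>
     (\<forall>c. \<forall>h\<in>S. nS (c *\<^sub>R h) = \<bar>c\<bar> * nS h) \<and>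
     (\<forall>g\<in>S. \<forall>h\<in>S. nS (g + h) \<le> nS g + nS h)"

text \<open>The operator norm from \<open>H\<close> to \<open>(S, nS)\<close>. The values of \<open>nS\<close> outside \<open>S\<close> are meaningless;
  an operator that does not map into \<open>S\<close> gets norm \<open>\<infinity>\<close>.\<close>

definition opnorm_into :: "'h set \<Rightarrow> ('h \<Rightarrow> real) \<Rightarrow> ('h::real_normed_vector \<Rightarrow>\<^sub>L 'h) \<Rightarrow> ereal" where
  "opnorm_into S nS A = (SUP h\<in>{h. norm h \<le> 1}. if blinfun_apply A h \<in> S then ereal (nS (blinfun_apply A h)) else \<infinity>)"

text \<open>Infinite if there is no finite cover; the centres range over the whole space.\<close>

definition covering_number :: "real \<Rightarrow> 'a::metric_space set \<Rightarrow> enat" where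
  "covering_number \<epsilon> A = (INF C\<in>{C. finite C \<and> A \<subseteq> (\<Union>c\<in>C. ball c \<epsilon>)}. enat (card C))"

definition sqrt_log :: "enat \<Rightarrow> ennreal" where
  "sqrt_log N = (case N of enat m \<Rightarrow> ennreal (sqrt (ln (real m))) | \<infinity> \<Rightarrow> \<infinity>)"


section \<open>The observations\<close>

type_synonym obs = "(nat \<Rightarrow> real) \<times> (nat \<Rightarrow> real)"

definition noise_law :: "obs measure" where
  "noise_law =
     (\<Pi>\<^sub>M k\<in>UNIV. density lborel std_normal_density) \<Otimes>\<^sub>M
     (\<Pi>\<^sub>M k\<in>UNIV. density lborel std_normal_density)"

definition obs_law ::
  "(nat \<Rightarrow> 'h::real_inner) \<Rightarrow> (real \<Rightarrow> 'h \<Rightarrow>\<^sub>L 'h) \<Rightarrow> nat \<Rightarrow> real \<Rightarrow> 'h \<Rightarrow> obs measure" where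
  "obs_law e K n \<theta> f =
     distr noise_law ((\<Pi>\<^sub>M k\<in>UNIV. borel) \<Otimes>\<^sub>M (\<Pi>\<^sub>M k\<in>UNIV. borel))
       (\<lambda>(z1, z2). (\<lambda>k. f \<bullet> e k + z1 k / sqrt (real n),
                      \<lambda>k. blinfun_apply (K \<theta>) f \<bullet> e k + z2 k / sqrt (real n)))"

text \<open>The pairing of a sequence with \<open>h\<close>. For fixed \<open>h\<close> the series converges almost surely
  under every \<open>obs_law\<close>; on the exceptional null set the value is unspecified.\<close>

definition pairing :: "(nat \<Rightarrow> 'h::real_inner) \<Rightarrow> (nat \<Rightarrow> real) \<Rightarrow> 'h \<Rightarrow> real" where
  "pairing e y h = (\<Sum>k. y k * (h \<bullet> e k))"

definition likelihood ::
  "(nat \<Rightarrow> 'h::real_inner) \<Rightarrow> (real \<Rightarrow> 'h \<Rightarrow>\<^sub>L 'h) \<Rightarrow> nat \<Rightarrow> obs \<Rightarrow> real \<Rightarrow> 'h \<Rightarrow> real" where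
  "likelihood e K n x \<theta> f =
     exp (real n * pairing e (fst x) f - real n / 2 * (norm f)\<^sup>2
        + real n * pairing e (snd x) (blinfun_apply (K \<theta>) f)
        - real n / 2 * (norm (blinfun_apply (K \<theta>) f))\<^sup>2)"


section \<open>Prior and posterior\<close>

text \<open>A prior on \<open>\<Theta>\<close> with Lebesgue density \<open>p\<close> lives on the measurable space of Borel
  subsets of \<open>\<Theta>\<close>, so that the operators at parameters outside \<open>\<Theta>\<close> play no role.\<close>

definition theta_prior :: "real set \<Rightarrow> (real \<Rightarrow> real) \<Rightarrow> real measure" where
  "theta_prior \<Theta> p = density (restrict_space lborel \<Theta>) (\<lambda>\<theta>. ennreal (p \<theta>))"

definition bayes :: "'p measure \<Rightarrow> ('p \<Rightarrow> real) \<Rightarrow> 'p measure" where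
  "bayes M L = density M (\<lambda>q. ennreal (L q) / (\<integral>\<^sup>+ q'. ennreal (L q') \<partial>M))"

definition posterior ::
  "(nat \<Rightarrow> 'h::real_inner) \<Rightarrow> (real \<Rightarrow> 'h \<Rightarrow>\<^sub>L 'h) \<Rightarrow> real measure \<Rightarrow> 'h measure \<Rightarrow>
   nat \<Rightarrow> obs \<Rightarrow> (real \<times> 'h) measure" where
  "posterior e K \<pi>\<theta> \<pi>f n x = bayes (\<pi>\<theta> \<Otimes>\<^sub>M \<pi>f) (\<lambda>(\<theta>, f). likelihood e K n x \<theta> f)"

text \<open>The posterior of \<open>f\<close> in the model in which \<open>\<theta>\<close> is known.\<close>

definition posterior_known ::
  "(nat \<Rightarrow> 'h::real_inner) \<Rightarrow> (real \<Rightarrow> 'h \<Rightarrow>\<^sub>L 'h) \<Rightarrow> real \<Rightarrow> 'h measure \<Rightarrow>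
   nat \<Rightarrow> obs \<Rightarrow> 'h measure" where
  "posterior_known e K \<theta> \<pi>f n x = bayes \<pi>f (likelihood e K n x \<theta>)"

text \<open>\<open>r\<close> is a version of the Radon--Nikodym derivative of the law of \<open>f + h\<close> with respect to
  the law \<open>\<pi>f\<close> of \<open>f\<close>. A version is a parameter, rather than the choice made by \<^const>\<open>RN_deriv\<close>,
  because it is evaluated pointwise below.\<close>

definition shift_density :: "'h::real_normed_vector measure \<Rightarrow> 'h \<Rightarrow> ('h \<Rightarrow> ennreal) \<Rightarrow> bool" where
  "shift_density \<pi>f h r \<longleftrightarrow>
     r \<in> borel_measurable \<pi>f \<and> density \<pi>f r = distr \<pi>f borel (\<lambda>f. f + h)"

text \<open>\<open>\<bar>log r\<bar>\<close> with the correct values at the endpoints (in the library \<open>ln 0 = 0\<close>).\<close>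

definition abs_log :: "ennreal \<Rightarrow> ennreal" where
  "abs_log r = (if r = 0 \<or> r = \<infinity> then \<infinity> else ennreal \<bar>ln (enn2real r)\<bar>)"


section \<open>Modes of convergence\<close>

text \<open>The outer measure is used because an infimum over an uncountable set need not be Borel
  measurable; on measurable sets it is the measure itself.\<close>

definition tendsto_in_prob :: "(nat \<Rightarrow> 'x measure) \<Rightarrow> (nat \<Rightarrow> 'x \<Rightarrow> real) \<Rightarrow> real \<Rightarrow> bool" where
  "tendsto_in_prob P Y c \<longleftrightarrow>
     (\<forall>\<epsilon>>0. (\<lambda>n. outer_measure_of (P n) {x \<in> space (P n). \<epsilon> < \<bar>Y n x - c\<bar>}) \<longlonglongrightarrow> 0)"

definition tv_dist :: "'a measure \<Rightarrow> 'a measure \<Rightarrow> real" where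
  "tv_dist P Q = 2 * (SUP F\<in>sets P. \<bar>measure P F - measure Q F\<bar>)"

definition posterior_consistent ::
  "(nat \<Rightarrow> 'h::real_inner) \<Rightarrow> (real \<Rightarrow> 'h \<Rightarrow>\<^sub>L 'h) \<Rightarrow> real measure \<Rightarrow> 'h measure \<Rightarrow>
   real \<Rightarrow> 'h \<Rightarrow> bool" where
  "posterior_consistent e K \<pi>\<theta> \<pi>f \<theta>0 f0 \<longleftrightarrow>
     (\<exists>\<epsilon>. \<epsilon> \<longlonglongrightarrow> 0 \<and>
       tendsto_in_prob (\<lambda>n. obs_law e K n \<theta>0 f0)
         (\<lambda>n x. measure (posterior e K \<pi>\<theta> \<pi>f n x)
            {(\<theta>, f). \<theta> \<in> space \<pi>\<theta> \<and> \<bar>\<theta> - \<theta>0\<bar> < \<epsilon> n \<and> norm (f - f0) < \<epsilon> n}) 1)"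


section \<open>Semiparametric quantities\<close>

definition info_op :: "('h::real_inner \<Rightarrow>\<^sub>L 'h) \<Rightarrow> 'h \<Rightarrow> 'h" where
  "info_op A h = h + adjoint (blinfun_apply A) (blinfun_apply A h)"

definition least_favorable ::
  "(real \<Rightarrow> 'h::real_inner \<Rightarrow>\<^sub>L 'h) \<Rightarrow> (real \<Rightarrow> 'h \<Rightarrow>\<^sub>L 'h) \<Rightarrow> real \<Rightarrow> 'h \<Rightarrow> 'h" where
  "least_favorable K K' \<theta> f = inv (info_op (K \<theta>)) 
       (adjoint (blinfun_apply (K \<theta>)) (blinfun_apply (K' \<theta>) f))"

definition efficient_info ::
  "(real \<Rightarrow> 'h::real_inner \<Rightarrow>\<^sub>L 'h) \<Rightarrow> (real \<Rightarrow> 'h \<Rightarrow>\<^sub>L 'h) \<Rightarrow> real \<Rightarrow> 'h \<Rightarrow> real" where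
  "efficient_info K K' \<theta> f =
     (norm (least_favorable K K' \<theta> f))\<^sup>2
     + (norm (blinfun_apply (K' \<theta>) f - blinfun_apply (K \<theta>) (least_favorable K K' \<theta> f)))\<^sup>2"

text \<open>The white noise, recovered from an observed sequence \<open>y\<close> with mean \<open>g\<close>, paired with \<open>h\<close>.\<close>

definition noise_pairing ::
  "(nat \<Rightarrow> 'h::real_inner) \<Rightarrow> nat \<Rightarrow> 'h \<Rightarrow> (nat \<Rightarrow> real) \<Rightarrow> 'h \<Rightarrow> real" where
  "noise_pairing e n g y h = sqrt (real n) * (pairing e y h - g \<bullet> h)"

definition efficient_Delta ::
  "(nat \<Rightarrow> 'h::real_inner) \<Rightarrow> (real \<Rightarrow> 'h \<Rightarrow>\<^sub>L 'h) \<Rightarrow> (real \<Rightarrow> 'h \<Rightarrow>\<^sub>L 'h) \<Rightarrow>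
   nat \<Rightarrow> real \<Rightarrow> 'h \<Rightarrow> obs \<Rightarrow> real" where
  "efficient_Delta e K K' n \<theta> f x =
     (let \<gamma> = least_favorable K K' \<theta> f;
          W1 = noise_pairing e n f (fst x);
          W2 = noise_pairing e n (blinfun_apply (K \<theta>) f) (snd x)
      in 1 / efficient_info K K' \<theta> f * 
         (W2 (blinfun_apply (K' \<theta>) f) - W1 \<gamma> - W2 (blinfun_apply (K \<theta>) \<gamma>)))"

text \<open>The normal law, parametrised by mean and variance.\<close>

definition normal_law :: "real \<Rightarrow> real \<Rightarrow> real measure" where
  "normal_law \<mu> v = density lborel (normal_density \<mu> (sqrt v))"

end

theory Submission
  imports Defs
begin

text \<open>
  The exchange \<open>(\<theta>, f) \<mapsto> (\<theta> + s / sqrt n, f - (s / sqrt n) \<gamma>\<^sub>n)\<close> moves along the least favourable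
  direction. For \<open>\<theta>\<close> within \<open>L / sqrt n\<close> of \<open>\<theta>0\<close> it changes the log likelihood, up to a small error, exactly as the shift by \<open>s\<close>
  changes the log density of the limiting normal law, and it changes the prior by a factor close to
  \<open>1\<close>. Hence the posterior of \<open>sqrt n (\<theta> - \<theta>0)\<close> and the normal law satisfy the same approximate
  relation under all shifts \<open>s\<close>; averaging it over a draw from the normal law gives
  \<open>\<Pi>(\<theta> \<in> B) \<le> N(B) + small\<close> for every \<open>B\<close>, and complements give the converse bound.

  That \<open>\<theta>\<close> stays within \<open>L / sqrt n\<close> is shown in two steps. The exchange \<open>f \<mapsto> f \<mp> \<gamma>\<^sub>n / sqrt n\<close> at fixed \<open>\<theta>\<close>
  excludes points at which the score of \<open>f\<close> in the direction \<open>\<gamma>\<^sub>n\<close> is of the order of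
  \<open>sqrt n |\<theta> - \<theta>0|\<close>. At the remaining points, contracting \<open>\<theta>\<close> towards \<open>\<theta>0\<close> at fixed \<open>f\<close>
  multiplies the likelihood by \<open>exp (k n (\<theta> - \<theta>0)\<^sup>2)\<close> for some \<open>k > 0\<close>.

  Chaining bounds the noise on the unit ball of \<open>S\<close>, hence its increments
  along \<open>K\<^sub>\<theta> - K\<^sub>\<theta>\<^sub>0\<close>. The sets \<open>sqrt n (\<Theta>\<^sub>n - \<theta>0)\<close> exhaust the line, so by Baire's theorem the closed
  set \<open>\<Theta>\<close> contains a neighbourhood of \<open>\<theta>0\<close>.
\<close>

section \<open>Operators on a Hilbert space with an orthonormal basis\<close>

text \<open>The exchange is built so that \<open>\<D> f\<close> cancels: up to the bias condition,
  the drift in \<theta> and the shift of f contain it with opposite signs, and the efficient score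
  and information remain. Since only ratios of the posterior density at two points enter, its
  normalising constant never has to be estimated. A second obstacle is that the noise is a series
  converging almost surely at each direction, with an exceptional set that depends on the direction.
  The expansions are therefore made at one observation, on the subspaces where the series converge,
  and for almost every pair of \<theta> and f. Probability enters only through finitely many
  exceptional events.\<close>

lemma orthonormal_projection_inner:
  fixes e :: "nat \<Rightarrow> 'h::real_inner"
  assumes "\<And>i j. e i \<bullet> e j = (if i = j then 1 else 0)" "finite F" "j \<in> F"
  shows "(\<Sum>k\<in>F. a k *\<^sub>R e k) \<bullet> e j = a j"
  by (simp add: inner_sum_left assms if_distrib sum.delta cong: if_cong)

lemma orthonormal_norm_sum:
  fixes e :: "nat \<Rightarrow> 'h::real_inner"
  assumes on: "\<And>i j. e i \<bullet> e j = (if i = j then 1 else 0)" and F: "finite F"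
  shows "(norm (\<Sum>k\<in>F. a k *\<^sub>R e k))\<^sup>2 = (\<Sum>k\<in>F. (a k)\<^sup>2)"
proof -
  define v where "v = (\<Sum>k\<in>F. a k *\<^sub>R e k)"
  have "v \<bullet> v = (\<Sum>k\<in>F. a k * (v \<bullet> e k))"
    by (subst (2) v_def) (simp only: inner_sum_right inner_scaleR_right)
  also have "\<dots> = (\<Sum>k\<in>F. (a k)\<^sup>2)"
    unfolding v_def
    by (intro sum.cong refl) (simp only: orthonormal_projection_inner[OF on F] power2_eq_square)
  finally show ?thesis by (simp only: v_def power2_norm_eq_inner)
qed

lemma bessel:
  fixes e :: "nat \<Rightarrow> 'h::real_inner"
  assumes on: "\<And>i j. e i \<bullet> e j = (if i = j then 1 else 0)" and F: "finite F"
  shows "(\<Sum>k\<in>F. (h \<bullet> e k)\<^sup>2) \<le> (norm h)\<^sup>2"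
proof -
  define q where "q = (\<Sum>k\<in>F. (h \<bullet> e k) *\<^sub>R e k)"
  have hq: "h \<bullet> q = (\<Sum>k\<in>F. (h \<bullet> e k)\<^sup>2)"
    by (simp add: q_def inner_sum_right power2_eq_square)
  have qq: "q \<bullet> q = (\<Sum>k\<in>F. (h \<bullet> e k)\<^sup>2)"
    using orthonormal_norm_sum[OF on F, of "\<lambda>k. h \<bullet> e k"]
    by (simp add: q_def power2_norm_eq_inner)
  have "0 \<le> (h - q) \<bullet> (h - q)" by simp
  also have "\<dots> = (norm h)\<^sup>2 - (\<Sum>k\<in>F. (h \<bullet> e k)\<^sup>2)"
    by (simp add: inner_diff_left inner_diff_right hq qq inner_commute[of q h] power2_norm_eq_inner)
  finally show ?thesis by simp
qed

lemma orthonormal_basisD: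
  assumes "orthonormal_basis e"
  shows "e i \<bullet> e j = (if i = j then 1 else 0)"
  using assms unfolding orthonormal_basis_def by blast

text \<open>The partial sum over \<open>k < n\<close> is the orthogonal projection onto the span of
  the first n basis vectors, so by Pythagoras it is at least as close to h as any approximant from
  that span. Density of the full span supplies the approximant.\<close>

lemma basis_expansion:
  fixes e :: "nat \<Rightarrow> 'h::real_inner"
  assumes e: "orthonormal_basis e"
  shows "(\<lambda>k. (h \<bullet> e k) *\<^sub>R e k) sums h"
  unfolding sums_def
proof (rule LIMSEQ_I)
  note on = orthonormal_basisD[OF e]
  fix r :: real assume r: "0 < r"
  have "h \<in> closure (span (range e))" using e by (simp add: orthonormal_basis_def)
  then obtain y where y: "y \<in> span (range e)" "dist y h < r"
    using r by (meson closure_approachable)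
  obtain F a where F: "finite F" "F \<subseteq> range e" "y = (\<Sum>v\<in>F. a v *\<^sub>R v)"
    using y(1) unfolding span_explicit by auto
  obtain I where I: "finite I" "F = e ` I"
    using F(1,2) by (meson finite_subset_image)
  obtain N where N: "I \<subseteq> {..<N}" using I(1) finite_nat_bounded by blast
  have "y \<in> span (e ` {..<N})"
    unfolding F(3) I(2) by (intro span_sum span_scale span_base) (use N in auto)
  have "norm ((\<Sum>k<n. (h \<bullet> e k) *\<^sub>R e k) - h) < r" if n: "n \<ge> N" for n
  proof -
    define q where "q = (\<Sum>k<n. (h \<bullet> e k) *\<^sub>R e k)"
    have orth: "(h - q) \<bullet> e k = 0" if "k < n" for k
      using orthonormal_projection_inner[OF on, of "{..<n}" k "\<lambda>k. h \<bullet> e k"] that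
      by (simp add: q_def inner_diff_left)
    have "q - y \<in> span (e ` {..<n})"
      unfolding q_def F(3) I(2) using N n
      by (intro span_diff span_sum span_scale span_base) auto
    moreover have "orthogonal (h - q) v" if "v \<in> e ` {..<n}" for v
      using that orth by (auto simp: orthogonal_def)
    ultimately have "orthogonal (h - q) (q - y)"
      by (meson orthogonal_to_span)
    then have "(norm (h - y))\<^sup>2 = (norm (h - q))\<^sup>2 + (norm (q - y))\<^sup>2"
      using norm_add_Pythagorean by fastforce
    then have "(norm (h - q))\<^sup>2 \<le> (norm (h - y))\<^sup>2" by simp
    then have "norm (h - q) \<le> norm (h - y)" by (simp add: norm_le_square power2_norm_eq_inner norm_le)
    then show ?thesis using y(2) by (simp add: q_def dist_norm norm_minus_commute)
  qed
  then show "\<exists>N. \<forall>n\<ge>N. norm ((\<Sum>k<n. (h \<bullet> e k) *\<^sub>R e k) - h) < r" by blast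
qed

lemma parseval_sums:
  fixes e :: "nat \<Rightarrow> 'h::real_inner"
  assumes e: "orthonormal_basis e"
  shows "(\<lambda>k. (g \<bullet> e k) * (h \<bullet> e k)) sums (g \<bullet> h)"
proof -
  have "(\<lambda>k. ((g \<bullet> e k) *\<^sub>R e k) \<bullet> h) sums (g \<bullet> h)"
    using bounded_linear.sums[OF bounded_linear_inner_left basis_expansion[OF e, of g]] .
  then show ?thesis by (simp add: inner_commute)
qed

lemma summable_orthonormal:
  fixes e :: "nat \<Rightarrow> 'h::{real_inner, complete_space}"
  assumes on: "\<And>i j. e i \<bullet> e j = (if i = j then 1 else 0)" and a: "summable (\<lambda>k. (a k)\<^sup>2)"
  shows "summable (\<lambda>k. a k *\<^sub>R e k)"
proof -
  have "Cauchy (\<lambda>n. \<Sum>k<n. a k *\<^sub>R e k)"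
  proof (rule CauchyI')
    fix r :: real assume r: "0 < r"
    have "Cauchy (\<lambda>n. \<Sum>k<n. (a k)\<^sup>2)"
      using a by (simp add: summable_iff_convergent Cauchy_convergent_iff)
    then obtain N where N: "\<And>m n. m \<ge> N \<Longrightarrow> n \<ge> N \<Longrightarrow> norm ((\<Sum>k<m. (a k)\<^sup>2) - (\<Sum>k<n. (a k)\<^sup>2)) < r\<^sup>2"
      using CauchyD[of _ "r\<^sup>2"] r by (metis zero_less_power)
    have "norm ((\<Sum>k<m. a k *\<^sub>R e k) - (\<Sum>k<n. a k *\<^sub>R e k)) < r" if "m \<ge> N" "n > m" for m n
    proof -
      have eq: "{..<n} = {..<m} \<union> {m..<n}" using that by auto
      have d: "(\<Sum>k<n. b k) - (\<Sum>k<m. b k) = (\<Sum>k=m..<n. b k)" for b :: "nat \<Rightarrow> 'c::ab_group_add"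
        unfolding eq by (subst sum.union_disjoint) auto
      have "(norm ((\<Sum>k<n. a k *\<^sub>R e k) - (\<Sum>k<m. a k *\<^sub>R e k)))\<^sup>2 = (\<Sum>k=m..<n. (a k)\<^sup>2)"
        unfolding d by (rule orthonormal_norm_sum[OF on]) simp
      also have "\<dots> < r\<^sup>2" using N[of n m] that unfolding d[symmetric] by simp
      finally have "norm ((\<Sum>k<n. a k *\<^sub>R e k) - (\<Sum>k<m. a k *\<^sub>R e k)) < r"
        using r power_less_imp_less_base by (meson less_imp_le)
      then show ?thesis by (simp add: norm_minus_commute)
    qed
    then show "\<exists>M. \<forall>m\<ge>M. \<forall>n>m. dist (\<Sum>k<m. a k *\<^sub>R e k) (\<Sum>k<n. a k *\<^sub>R e k) < r"
      by (auto simp: dist_norm)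
  qed
  then show ?thesis unfolding summable_iff_convergent by (rule Cauchy_convergent)
qed

text \<open>The library proves the defining property of \<^const>\<open>adjoint\<close> only in finite dimension.\<close>

lemma adjoint_blinfun:
  fixes e :: "nat \<Rightarrow> 'h::{real_inner, complete_space}" and A :: "'h \<Rightarrow>\<^sub>L 'h"
  assumes e: "orthonormal_basis e"
  shows "x \<bullet> adjoint (blinfun_apply A) y = blinfun_apply A x \<bullet> y"
proof -
  note on = orthonormal_basisD[OF e]
  \<comment> \<open>These coefficients are the only possible ones: an adjoint must satisfy
    \<open>e k \<bullet> f' y = A (e k) \<bullet> y\<close>.\<close>
  define f' where "f' y = (\<Sum>k. (blinfun_apply A (e k) \<bullet> y) *\<^sub>R e k)" for y
  have "x \<bullet> f' y = blinfun_apply A x \<bullet> y" for x y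
  proof -
    have "summable (\<lambda>k. (blinfun_apply A (e k) \<bullet> y)\<^sup>2)"
    proof (rule summableI_nonneg_bounded)
      fix n
      define v where "v = (\<Sum>k<n. (blinfun_apply A (e k) \<bullet> y) *\<^sub>R e k)"
      have v2: "(norm v)\<^sup>2 = (\<Sum>k<n. (blinfun_apply A (e k) \<bullet> y)\<^sup>2)"
        unfolding v_def by (rule orthonormal_norm_sum[OF on]) simp
      also have "\<dots> = blinfun_apply A v \<bullet> y"
        by (simp add: v_def blinfun.sum_right blinfun.scaleR_right inner_sum_left power2_eq_square)
      also have "\<dots> \<le> norm (blinfun_apply A v) * norm y"
        by (rule norm_cauchy_schwarz)
      also have "\<dots> \<le> norm A * norm v * norm y"
        by (intro mult_right_mono norm_blinfun) simp
      \<comment> \<open>Cancelling one factor \<open>norm v\<close> bounds the sum of the first n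
        squared coefficients uniformly in n.\<close>
      finally have "norm v * norm v \<le> norm v * (norm A * norm y)"
        by (simp add: power2_eq_square mult_ac)
      then have "norm v \<le> norm A * norm y"
        by (cases "norm v = 0") (auto simp: mult_le_cancel_left)
      then have "(norm v)\<^sup>2 \<le> (norm A * norm y)\<^sup>2" by (rule power_mono) simp
      then show "(\<Sum>k<n. (blinfun_apply A (e k) \<bullet> y)\<^sup>2) \<le> (norm A * norm y)\<^sup>2"
        using v2 by simp
    qed simp
    then have s: "(\<lambda>k. (blinfun_apply A (e k) \<bullet> y) *\<^sub>R e k) sums f' y"
      unfolding f'_def by (intro summable_sums summable_orthonormal[OF on])
    have "(\<lambda>k. (blinfun_apply A (e k) \<bullet> y) * (x \<bullet> e k)) sums (x \<bullet> f' y)"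
      using bounded_linear.sums[OF bounded_linear_inner_right s, of x] by simp
    moreover have "(\<lambda>k. blinfun_apply A ((x \<bullet> e k) *\<^sub>R e k) \<bullet> y) sums (blinfun_apply A x \<bullet> y)"
      by (intro bounded_linear.sums[OF bounded_linear_inner_left]
           bounded_linear.sums[OF blinfun.bounded_linear_right] basis_expansion e)
    ultimately show ?thesis
      by (simp add: blinfun.scaleR_right mult.commute sums_unique2)
  qed
  \<comment> \<open>\<open>adjoint\<close> is a Hilbert choice, so the existence of some adjoint
    yields its defining property.\<close>
  then have "\<exists>g. \<forall>x y. blinfun_apply A x \<bullet> y = x \<bullet> g y" by metis
  then have "\<forall>x y. blinfun_apply A x \<bullet> y = x \<bullet> adjoint (blinfun_apply A) y"
    unfolding adjoint_def by (rule someI_ex)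
  then show ?thesis by simp
qed

section \<open>The information operator and the least favourable direction\<close>

lemma inner_info_op:
  fixes e :: "nat \<Rightarrow> 'h::{real_inner, complete_space}" and A :: "'h \<Rightarrow>\<^sub>L 'h"
  assumes e: "orthonormal_basis e"
  shows "g \<bullet> info_op A h = g \<bullet> h + blinfun_apply A g \<bullet> blinfun_apply A h"
  by (simp add: info_op_def inner_add_right adjoint_blinfun[OF e])

lemma eq_if_inner_eq:
  fixes x y :: "'h::real_inner"
  assumes "\<And>g. g \<bullet> x = g \<bullet> y"
  shows "x = y"
proof -
  have "(x - y) \<bullet> (x - y) = 0" using assms[of "x - y"] by (simp add: inner_diff_right)
  then show ?thesis by simp
qed

text \<open>\<open>h \<mapsto> h - c (A h - g)\<close> is a contraction for small \<open>c\<close>, since \<open>A = I + K* K\<close> is bounded and at least \<open>I\<close>.\<close>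

lemma surj_info_op:
  fixes e :: "nat \<Rightarrow> 'h::{real_inner, complete_space}" and A :: "'h \<Rightarrow>\<^sub>L 'h"
  assumes e: "orthonormal_basis e"
  shows "surj (info_op A)"
proof (rule surjI)
  fix g
  note ip = inner_info_op[OF e]
  have diff: "info_op A x - info_op A y = info_op A (x - y)" for x y
    by (rule eq_if_inner_eq) (simp add: inner_diff_right ip blinfun.diff_right)
  define B where "B = 1 + (norm A)\<^sup>2"
  have B: "B \<ge> 1" by (simp add: B_def)
  have bound: "norm (info_op A h) \<le> B * norm h" for h
  proof -
    have "(norm (info_op A h))\<^sup>2 = info_op A h \<bullet> h + blinfun_apply A (info_op A h) \<bullet> blinfun_apply A h"
      by (simp add: power2_norm_eq_inner ip)
    also have "\<dots> \<le> norm (info_op A h) * norm h + norm (blinfun_apply A (info_op A h)) * norm (blinfun_apply A h)"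
      by (intro add_mono norm_cauchy_schwarz)
    also have "\<dots> \<le> norm (info_op A h) * norm h + (norm A * norm (info_op A h)) * (norm A * norm h)"
      by (intro add_mono mult_mono norm_blinfun) auto
    also have "\<dots> = norm (info_op A h) * (B * norm h)"
      by (simp add: B_def algebra_simps power2_eq_square)
    finally show ?thesis
      by (cases "norm (info_op A h) = 0") (use B in \<open>auto simp: power2_eq_square\<close>)
  qed
  \<comment> \<open>The information operator has lower bound 1 and norm at most B, so the squared
    contraction factor is at most \<open>1 - 2 c + c^2 B^2\<close>. This c is the minimiser, with
    minimum \<open>1 - 1 / B^2\<close>.\<close>
  define c where "c = 1 / B\<^sup>2"
  define T where "T h = h - c *\<^sub>R (info_op A h - g)" for h
  define q where "q = sqrt (1 - 1 / B\<^sup>2)"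
  have c0: "c > 0" using B by (simp add: c_def)
  have B2: "1 / B\<^sup>2 \<le> 1" "0 < 1 / B\<^sup>2" using B by (auto simp: divide_le_eq_1)
  have contr: "dist (T x) (T y) \<le> q * dist x y" for x y
  proof -
    define d where "d = x - y"
    have "T x - T y = d - c *\<^sub>R (info_op A x - info_op A y)"
      unfolding T_def d_def by (simp add: scaleR_diff_right)
    then have "T x - T y = d - c *\<^sub>R info_op A d"
      unfolding diff d_def .
    then have "(norm (T x - T y))\<^sup>2 = (norm d)\<^sup>2 - 2 * c * (d \<bullet> info_op A d) + c\<^sup>2 * (norm (info_op A d))\<^sup>2"
      unfolding power2_norm_eq_inner
      by (simp add: inner_diff_left inner_diff_right inner_commute[of "info_op A d" d])
        (simp add: power2_eq_square algebra_simps)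
    also have "\<dots> \<le> (norm d)\<^sup>2 - 2 * c * (norm d)\<^sup>2 + c\<^sup>2 * (B * norm d)\<^sup>2"
    proof -
      have "(norm d)\<^sup>2 \<le> d \<bullet> info_op A d" by (simp add: ip power2_norm_eq_inner)
      moreover have "(norm (info_op A d))\<^sup>2 \<le> (B * norm d)\<^sup>2" using bound by (intro power_mono) auto
      ultimately show ?thesis
        using c0 by (intro add_mono diff_mono mult_left_mono) auto
    qed
    also have "\<dots> = (1 - 1 / B\<^sup>2) * (norm d)\<^sup>2"
      using B by (simp add: c_def power_mult_distrib power2_eq_square field_simps)
    finally have "norm (T x - T y) \<le> sqrt ((1 - 1 / B\<^sup>2) * (norm d)\<^sup>2)"
      by (rule real_le_rsqrt)
    then show ?thesis by (simp add: real_sqrt_mult q_def dist_norm d_def)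
  qed
  have "\<exists>!x. T x = x"
  proof (rule banach_fix_type[of q])
    show "0 \<le> q" "q < 1" using B2 by (auto simp: q_def)
    show "\<forall>x y. dist (T x) (T y) \<le> q * dist x y" using contr by blast
  qed
  then obtain x where "T x = x" by blast
  then have "info_op A x = g" using c0 by (simp add: T_def)
  then show "info_op A (SOME x. info_op A x = g) = g" by (rule someI)
qed

text \<open>The normal equation for the least favourable direction in weak form. Surjectivity makes
  the value chosen by \<open>inv\<close> a genuine preimage.\<close>

lemma inner_least_favorable:
  fixes e :: "nat \<Rightarrow> 'h::{real_inner, complete_space}" and K K' :: "real \<Rightarrow> 'h \<Rightarrow>\<^sub>L 'h"
  assumes e: "orthonormal_basis e"
  shows "g \<bullet> info_op (K \<theta>) (least_favorable K K' \<theta> f) = blinfun_apply (K \<theta>) g \<bullet> blinfun_apply (K' \<theta>) f"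
  by (simp add: least_favorable_def surj_f_inv_f[OF surj_info_op[OF e]] adjoint_blinfun[OF e])

section \<open>Gaussian sequences\<close>

abbreviation gauss :: "real measure" where
  "gauss \<equiv> density lborel (\<lambda>x. ennreal (std_normal_density x))"

abbreviation gauss_seq :: "(nat \<Rightarrow> real) measure" where
  "gauss_seq \<equiv> \<Pi>\<^sub>M k\<in>UNIV. gauss"

interpretation gauss: prob_space gauss
  by (rule prob_space_normal_density) simp

interpretation gauss_seq: sequence_space gauss
  by unfold_locales

lemma measurable_gauss_seq_component [measurable]: "(\<lambda>z. z i) \<in> borel_measurable gauss_seq"
proof -
  have "(\<lambda>z. z i) \<in> measurable gauss_seq gauss" by (rule measurable_component_singleton) simp
  then show ?thesis by (simp add: measurable_def)
qed

lemma nn_integral_gauss_exp: "(\<integral>\<^sup>+z. ennreal (exp (l * z)) \<partial>gauss) = ennreal (exp (l\<^sup>2 / 2))"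
proof -
  have eq: "std_normal_density z * exp (l * z) = exp (l\<^sup>2 / 2) * normal_density l 1 z" for z
    by (simp add: normal_density_def exp_add[symmetric] power2_eq_square field_simps)
  have "(\<integral>\<^sup>+z. ennreal (exp (l * z)) \<partial>gauss) = (\<integral>\<^sup>+z. ennreal (std_normal_density z * exp (l * z)) \<partial>lborel)"
    by (subst nn_integral_density) (auto simp: ennreal_mult)
  also have "\<dots> = (\<integral>\<^sup>+z. ennreal (exp (l\<^sup>2 / 2)) * ennreal (normal_density l 1 z) \<partial>lborel)"
    by (simp only: eq) (simp add: ennreal_mult)
  also have "\<dots> = ennreal (exp (l\<^sup>2 / 2)) * emeasure (density lborel (normal_density l 1)) UNIV"
    by (simp add: nn_integral_cmult emeasure_density)
  also have "\<dots> = ennreal (exp (l\<^sup>2 / 2))"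
    using prob_space.emeasure_space_1[OF prob_space_normal_density[of 1 l]] by simp
  finally show ?thesis .
qed

text \<open>Induction on \<open>N\<close>, conditioning on the first coordinate of the sequence.\<close>

lemma gauss_seq_maximal_one_sided:
  assumes "0 \<le> l"
  shows "emeasure gauss_seq {z \<in> space gauss_seq. \<exists>k\<le>N. a < s + (\<Sum>j<k. c j * z j)}
    \<le> ennreal (exp (l * (s - a) + l\<^sup>2 / 2 * (\<Sum>j<N. (c j)\<^sup>2)))"
proof (induction N arbitrary: s c)
  case (0 s c)
  have "exp (l * (s - a)) \<ge> 1" if "a < s" using that assms by simp
  then show ?case
    by (cases "a < s") (auto simp: gauss_seq.P.emeasure_space_1 simp flip: ennreal_1 intro!: ennreal_leI)
next
  case (Suc N s c)
  show ?case
  proof (cases "a < s")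
    case True
    have "l * (s - a) + l\<^sup>2 / 2 * (\<Sum>j<Suc N. (c j)\<^sup>2) \<ge> 0"
      using True assms by (intro add_nonneg_nonneg mult_nonneg_nonneg sum_nonneg) auto
    then have "1 \<le> ennreal (exp (l * (s - a) + l\<^sup>2 / 2 * (\<Sum>j<Suc N. (c j)\<^sup>2)))"
      by (simp flip: ennreal_1 add: ennreal_leI del: sum.lessThan_Suc)
    moreover have "emeasure gauss_seq {z \<in> space gauss_seq. \<exists>k\<le>Suc N. a < s + (\<Sum>j<k. c j * z j)} \<le> 1"
      by (rule gauss_seq.P.emeasure_le_1)
    ultimately show ?thesis by (rule order_trans[rotated])
  next
    case False
    define E where "E = {z \<in> space gauss_seq. \<exists>k\<le>Suc N. a < s + (\<Sum>j<k. c j * z j)}"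
    define E' where "E' y = {z \<in> space gauss_seq. \<exists>k\<le>N. a < (s + c 0 * y) + (\<Sum>j<k. c (Suc j) * z j)}" for y
    have Em: "E \<in> sets gauss_seq" unfolding E_def by measurable
    have cs: "(\<lambda>(y, z). case_nat y z) \<in> measurable (gauss \<Otimes>\<^sub>M gauss_seq) gauss_seq"
      by measurable
    \<comment> \<open>Since \<open>a < s\<close> fails, there is no crossing at
      \<open>k = 0\<close>. A crossing by time \<open>Suc N\<close> is then a crossing by time N of
      the walk restarted at \<open>s + c 0 * y\<close>, which is why the claim is stated for an
      arbitrary start s.\<close>
    have in_E: "case_nat y z \<in> E \<longleftrightarrow> z \<in> E' y" for y z
    proof -
      have "(\<exists>k\<le>Suc N. a < s + (\<Sum>j<k. c j * (case_nat y z) j)) \<longleftrightarrow>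
            (\<exists>k\<le>N. a < s + (\<Sum>j<Suc k. c j * (case_nat y z) j))"
        (is "(\<exists>k\<le>Suc N. ?P k) \<longleftrightarrow> _")
      proof -
        have "\<not> ?P 0" using False by simp
        then have "k \<noteq> 0" if "?P k" for k using that by metis
        then show ?thesis by (metis Suc_le_mono not0_implies_Suc)
      qed
      also have "\<dots> \<longleftrightarrow> (\<exists>k\<le>N. a < (s + c 0 * y) + (\<Sum>j<k. c (Suc j) * z j))"
        by (simp add: sum.lessThan_Suc_shift add.assoc del: sum.lessThan_Suc)
      finally show ?thesis by (simp add: E_def E'_def space_PiM)
    qed
    have "emeasure gauss_seq E = emeasure (distr (gauss \<Otimes>\<^sub>M gauss_seq) gauss_seq (\<lambda>(y, z). case_nat y z)) E"
      by (simp only: gauss_seq.PiM_iter)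
    also have "\<dots> = emeasure (gauss \<Otimes>\<^sub>M gauss_seq) ((\<lambda>(y, z). case_nat y z) -` E \<inter> space (gauss \<Otimes>\<^sub>M gauss_seq))"
      by (rule emeasure_distr[OF cs Em])
    also have "\<dots> = (\<integral>\<^sup>+y. emeasure gauss_seq (Pair y -` ((\<lambda>(y, z). case_nat y z) -` E \<inter> space (gauss \<Otimes>\<^sub>M gauss_seq))) \<partial>gauss)"
      by (rule gauss_seq.P.emeasure_pair_measure_alt) (rule measurable_sets[OF cs Em])
    also have "\<dots> = (\<integral>\<^sup>+y. emeasure gauss_seq (E' y) \<partial>gauss)"
      by (intro nn_integral_cong arg_cong[of _ _ "emeasure gauss_seq"])
        (auto simp: in_E space_pair_measure space_PiM)
    also have "\<dots> \<le> (\<integral>\<^sup>+y. ennreal (exp (l * (s + c 0 * y - a) + l\<^sup>2 / 2 * (\<Sum>j<N. (c (Suc j))\<^sup>2))) \<partial>gauss)"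
      unfolding E'_def by (intro nn_integral_mono Suc.IH)
    also have "\<dots> = (\<integral>\<^sup>+y. ennreal (exp (l * (s - a) + l\<^sup>2 / 2 * (\<Sum>j<N. (c (Suc j))\<^sup>2))) * ennreal (exp (l * c 0 * y)) \<partial>gauss)"
      by (simp add: ennreal_mult[symmetric] exp_add[symmetric] algebra_simps)
    also have "\<dots> = ennreal (exp (l * (s - a) + l\<^sup>2 / 2 * (\<Sum>j<N. (c (Suc j))\<^sup>2))) * ennreal (exp ((l * c 0)\<^sup>2 / 2))"
      by (subst nn_integral_cmult) (simp_all add: nn_integral_gauss_exp)
    also have "\<dots> = ennreal (exp (l * (s - a) + l\<^sup>2 / 2 * (\<Sum>j<Suc N. (c j)\<^sup>2)))"
      by (simp add: ennreal_mult[symmetric] exp_add[symmetric] sum.lessThan_Suc_shift algebra_simps power_mult_distrib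
          del: sum.lessThan_Suc)
    finally show ?thesis by (simp add: E_def)
  qed
qed

text \<open>Chernoff's bound with \<open>l = a / \<sigma>^2\<close>, the minimiser of
  \<open>l^2 \<sigma>^2 / 2 - l a\<close>, for the sums and their negatives. It does not depend on
  N, so it passes to the increasing union over N and controls all partial sums at once, hence also
  the limit of a convergent series.\<close>

lemma gauss_seq_maximal:
  assumes \<sigma>: "0 < \<sigma>" "\<And>N. (\<Sum>j<N. (c j)\<^sup>2) \<le> \<sigma>\<^sup>2" and a: "0 \<le> a"
  shows "emeasure gauss_seq {z \<in> space gauss_seq. \<exists>k. a < \<bar>\<Sum>j<k. c j * z j\<bar>} \<le> ennreal (2 * exp (- (a\<^sup>2 / (2 * \<sigma>\<^sup>2))))"
proof -
  define l where "l = a / \<sigma>\<^sup>2"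
  have l: "0 \<le> l" using a by (simp add: l_def)
  define E where "E N = {z \<in> space gauss_seq. \<exists>k\<le>N. a < \<bar>\<Sum>j<k. c j * z j\<bar>}" for N
  have bound: "emeasure gauss_seq {z \<in> space gauss_seq. \<exists>k\<le>N. a < 0 + (\<Sum>j<k. b j * z j)} \<le> ennreal (exp (- (a\<^sup>2 / (2 * \<sigma>\<^sup>2))))"
    if "\<And>N. (\<Sum>j<N. (b j)\<^sup>2) \<le> \<sigma>\<^sup>2" for b :: "nat \<Rightarrow> real" and N
  proof -
    have "l * (0 - a) + l\<^sup>2 / 2 * (\<Sum>j<N. (b j)\<^sup>2) \<le> l * (0 - a) + l\<^sup>2 / 2 * \<sigma>\<^sup>2"
      using that[of N] by (intro add_left_mono mult_left_mono) auto
    also have "\<dots> = - (a\<^sup>2 / (2 * \<sigma>\<^sup>2))"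
      using \<sigma>(1) by (simp add: l_def power2_eq_square field_simps)
    finally show ?thesis
      by (intro order_trans[OF gauss_seq_maximal_one_sided[OF l]] ennreal_leI) simp
  qed
  have EN: "emeasure gauss_seq (E N) \<le> ennreal (2 * exp (- (a\<^sup>2 / (2 * \<sigma>\<^sup>2))))" for N
  proof -
    have "emeasure gauss_seq (E N) \<le> emeasure gauss_seq
       ({z \<in> space gauss_seq. \<exists>k\<le>N. a < 0 + (\<Sum>j<k. c j * z j)} \<union> {z \<in> space gauss_seq. \<exists>k\<le>N. a < 0 + (\<Sum>j<k. - c j * z j)})"
    proof (rule emeasure_mono)
      show "E N \<subseteq> {z \<in> space gauss_seq. \<exists>k\<le>N. a < 0 + (\<Sum>j<k. c j * z j)} \<union> {z \<in> space gauss_seq. \<exists>k\<le>N. a < 0 + (\<Sum>j<k. - c j * z j)}"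
        by (auto simp: E_def abs_real_def sum_negf split: if_splits)
    qed measurable
    also have "\<dots> \<le> emeasure gauss_seq {z \<in> space gauss_seq. \<exists>k\<le>N. a < 0 + (\<Sum>j<k. c j * z j)} +
        emeasure gauss_seq {z \<in> space gauss_seq. \<exists>k\<le>N. a < 0 + (\<Sum>j<k. - c j * z j)}"
      by (rule emeasure_subadditive) measurable
    also have "\<dots> \<le> ennreal (exp (- (a\<^sup>2 / (2 * \<sigma>\<^sup>2)))) + ennreal (exp (- (a\<^sup>2 / (2 * \<sigma>\<^sup>2))))"
      using \<sigma>(2) by (intro add_mono bound) simp_all
    finally show ?thesis by (simp add: ennreal_plus[symmetric] del: ennreal_plus)
  qed
  have "{z \<in> space gauss_seq. \<exists>k. a < \<bar>\<Sum>j<k. c j * z j\<bar>} = (\<Union>N. E N)"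
    by (auto simp: E_def)
  also have "emeasure gauss_seq \<dots> = (SUP N. emeasure gauss_seq (E N))"
  proof (rule SUP_emeasure_incseq[symmetric])
    have "E N \<in> sets gauss_seq" for N unfolding E_def by measurable
    then show "range E \<subseteq> sets gauss_seq" by blast
    show "incseq E" by (auto simp: E_def incseq_def intro: order_trans)
  qed
  also have "\<dots> \<le> ennreal (2 * exp (- (a\<^sup>2 / (2 * \<sigma>\<^sup>2))))"
    by (intro SUP_least EN)
  finally show ?thesis .
qed

text \<open>The sums started at m have total variance tending to 0, so by the maximal inequality it
  is a null event that they exceed a fixed level for every m. Off these null sets the partial sums
  are Cauchy.\<close>

lemma AE_summable_gauss_seq:
  assumes c: "summable (\<lambda>j. (c j)\<^sup>2)"
  shows "AE z in gauss_seq. summable (\<lambda>j. c j * z j)"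
proof -
  define E where "E r m = {z \<in> space gauss_seq. \<exists>k. inverse (real (Suc r)) < \<bar>\<Sum>j<k. (if j < m then 0 else c j) * z j\<bar>}" for r m
  have Em: "E r m \<in> sets gauss_seq" for r m unfolding E_def by measurable
  have null: "(\<Inter>m. E r m) \<in> null_sets gauss_seq" for r
  proof (rule null_setsI)
    show "(\<Inter>m. E r m) \<in> sets gauss_seq" using Em by (intro sets.countable_INT) auto
    define a where "a = inverse (real (Suc r))"
    have a: "a > 0" by (simp add: a_def)
    \<comment> \<open>The tail sum of squares, plus \<open>1 / Suc m\<close> to keep it positive
      when c vanishes eventually: the maximal inequality divides by the variance bound.\<close>
    define s where "s m = (\<Sum>j. (c j)\<^sup>2) - (\<Sum>j<m. (c j)\<^sup>2) + inverse (real (Suc m))" for m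
    have s_ge: "(\<Sum>j<m. (c j)\<^sup>2) \<le> (\<Sum>j. (c j)\<^sup>2)" for m
      by (intro sum_le_suminf c) auto
    have s0: "s m > 0" for m using s_ge[of m] unfolding s_def
      by (metis add_nonneg_pos diff_ge_0_iff_ge inverse_positive_iff_positive of_nat_0_less_iff zero_less_Suc)
    have "s \<longlonglongrightarrow> (\<Sum>j. (c j)\<^sup>2) - (\<Sum>j. (c j)\<^sup>2) + 0"
      unfolding s_def by (intro tendsto_intros summable_LIMSEQ c LIMSEQ_inverse_real_of_nat)
    then have s_lim: "s \<longlonglongrightarrow> 0" by simp
    have "emeasure gauss_seq (\<Inter>m. E r m) \<le> ennreal (2 * (2 * s m / a\<^sup>2))" for m
    proof -
      have "emeasure gauss_seq (\<Inter>m. E r m) \<le> emeasure gauss_seq (E r m)"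
        by (intro emeasure_mono Em) auto
      also have "\<dots> \<le> ennreal (2 * exp (- (a\<^sup>2 / (2 * (sqrt (s m))\<^sup>2))))"
        unfolding E_def a_def[symmetric]
      proof (rule gauss_seq_maximal)
        fix N
        have "(\<Sum>j<N. (if j < m then 0 else c j)\<^sup>2) \<le> (\<Sum>j<N+m. (if j < m then 0 else c j)\<^sup>2)"
          by (intro sum_mono2) auto
        also have "\<dots> = (\<Sum>j\<in>{..<N+m}-{..<m}. (c j)\<^sup>2)"
          by (intro sum.mono_neutral_cong_right) auto
        also have "\<dots> = (\<Sum>j<N+m. (c j)\<^sup>2) - (\<Sum>j<m. (c j)\<^sup>2)"
          by (intro sum_diff) auto
        also have "\<dots> \<le> s m" using s_ge[of "N+m"] unfolding s_def by (simp add: add_increasing2)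
        finally show "(\<Sum>j<N. (if j < m then 0 else c j)\<^sup>2) \<le> (sqrt (s m))\<^sup>2"
          using s0[of m] by simp
      qed (use s0 a in auto)
      also have "\<dots> \<le> ennreal (2 * (2 * s m / a\<^sup>2))"
      proof (intro ennreal_leI mult_left_mono)
        have "a\<^sup>2 / (2 * s m) \<le> exp (a\<^sup>2 / (2 * s m))"
          using exp_ge_add_one_self[of "a\<^sup>2 / (2 * s m)"] by linarith
        then have "inverse (exp (a\<^sup>2 / (2 * s m))) \<le> inverse (a\<^sup>2 / (2 * s m))"
          using a s0[of m] by (intro le_imp_inverse_le) auto
        then show "exp (- (a\<^sup>2 / (2 * (sqrt (s m))\<^sup>2))) \<le> 2 * s m / a\<^sup>2"
          using s0[of m] by (simp add: exp_minus)
      qed simp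
      finally show ?thesis .
    qed
    moreover have "(\<lambda>m. ennreal (2 * (2 * s m / a\<^sup>2))) \<longlonglongrightarrow> ennreal (2 * (2 * 0 / a\<^sup>2))"
      by (intro tendsto_ennrealI tendsto_intros s_lim) (use a in auto)
    ultimately have "emeasure gauss_seq (\<Inter>m. E r m) \<le> ennreal (2 * (2 * 0 / a\<^sup>2))"
      by (intro LIMSEQ_le_const) auto
    then show "emeasure gauss_seq (\<Inter>m. E r m) = 0" by simp
  qed
  have "(\<Union>r. \<Inter>m. E r m) \<in> null_sets gauss_seq" using null by (intro null_sets_UN) auto
  then have "AE z in gauss_seq. z \<notin> (\<Union>r. \<Inter>m. E r m)" by (rule AE_not_in)
  moreover have "AE z in gauss_seq. z \<in> space gauss_seq" by (rule AE_space)
  ultimately show ?thesis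
  proof eventually_elim
    case (elim z)
    have "Cauchy (\<lambda>n. \<Sum>j<n. c j * z j)"
    proof (rule CauchyI')
      fix e :: real assume "0 < e"
      then obtain r where r: "inverse (real (Suc r)) < e / 2" using reals_Archimedean half_gt_zero by blast
      from elim obtain m where m: "z \<notin> E r m" by blast
      have "dist (\<Sum>j<m. c j * z j) (\<Sum>j<n. c j * z j) \<le> inverse (real (Suc r))" if "n \<ge> m" for n
      proof -
        have "(\<Sum>j<n. c j * z j) - (\<Sum>j<m. c j * z j) = (\<Sum>j\<in>{..<n}-{..<m}. c j * z j)"
          using that by (intro sum_diff[symmetric]) auto
        also have "\<dots> = (\<Sum>j<n. (if j < m then 0 else c j) * z j)"
          by (intro sum.mono_neutral_cong_left) auto
        finally show ?thesis using m elim(2)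
          by (subst dist_commute) (simp add: E_def dist_real_def not_less)
      qed
      then have "dist (\<Sum>j<k. c j * z j) (\<Sum>j<n. c j * z j) < e" if "k \<ge> m" "n > k" for k n
        using that r dist_triangle3[of "\<Sum>j<k. c j * z j" "\<Sum>j<n. c j * z j" "\<Sum>j<m. c j * z j"]
        by (smt (verit) field_sum_of_halves less_imp_le order_trans)
      then show "\<exists>M. \<forall>k\<ge>M. \<forall>n>k. dist (\<Sum>j<k. c j * z j) (\<Sum>j<n. c j * z j) < e"
        by blast
    qed
    then show ?case unfolding summable_iff_convergent by (rule Cauchy_convergent)
  qed
qed

section \<open>Entropy and chaining\<close>

lemma INF_enat_attained:
  fixes A :: "'a set" and f :: "'a \<Rightarrow> enat"
  assumes "A \<noteq> {}"
  shows "\<exists>x\<in>A. (INF y\<in>A. f y) = f x"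
proof -
  have "Inf (f ` A) \<in> f ` A" using assms by (simp add: Inf_enat_def) (metis (mono_tags, lifting) LeastI imageI ex_in_conv)
  then show ?thesis by auto
qed

lemma covering_number_antimono:
  assumes "\<delta> \<le> \<epsilon>"
  shows "covering_number \<epsilon> A \<le> covering_number \<delta> A"
  unfolding covering_number_def
proof (intro INF_superset_mono subsetI)
  fix C assume "C \<in> {C. finite C \<and> A \<subseteq> (\<Union>c\<in>C. ball c \<delta>)}"
  then show "C \<in> {C. finite C \<and> A \<subseteq> (\<Union>c\<in>C. ball c \<epsilon>)}"
    using assms by (auto dest!: subsetD simp: mem_ball intro: less_le_trans)
qed simp

lemma sqrt_log_mono:
  assumes "M \<le> N" "M \<noteq> 0"
  shows "sqrt_log M \<le> sqrt_log N"
  using assms by (cases M; cases N) (auto simp: sqrt_log_def zero_enat_def intro!: ennreal_leI)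

text \<open>The covering number decreases in the radius, so on \<open>I j\<close>, an interval of
  length \<open>(1/2)^Suc j\<close>, the integrand is at least its value at the right end. The
  entropy integral therefore dominates the dyadic entropy sum, and minimal covers at the dyadic
  radii serve as nets.\<close>

lemma entropy_nets:
  fixes A :: "'a::metric_space set"
  assumes ne: "A \<noteq> {}"
    and entropy: "(\<integral>\<^sup>+\<epsilon>\<in>{0<..1}. sqrt_log (covering_number \<epsilon> A) \<partial>lborel) < \<infinity>"
  obtains C :: "nat \<Rightarrow> 'a set" where "\<And>j. finite (C j)" "\<And>j. C j \<noteq> {}" "\<And>j. A \<subseteq> (\<Union>c\<in>C j. ball c ((1/2)^j))"
    "summable (\<lambda>j. (1/2)^j * sqrt (ln (card (C j))))"
proof -
  define c where "c j = sqrt_log (covering_number ((1/2)^j) A)" for j :: nat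
  define I where "I j = {(1/2)^Suc j<..(1/2::real)^j}" for j
  have cov0: "covering_number \<epsilon> A \<noteq> 0" for \<epsilon>
  proof
    assume z: "covering_number \<epsilon> A = 0"
    have "{C. finite C \<and> A \<subseteq> (\<Union>c\<in>C. ball c \<epsilon>)} \<noteq> {}"
      using z unfolding covering_number_def by (metis Inf_enat_def image_is_empty infinity_ne_i0)
    from INF_enat_attained[OF this, of "\<lambda>C. enat (card C)"] z obtain C where "finite C" "A \<subseteq> (\<Union>c\<in>C. ball c \<epsilon>)" "enat (card C) = 0"
      unfolding covering_number_def by auto
    then show False using ne by (auto simp: zero_enat_def)
  qed
  have I_sub: "I j \<subseteq> {0<..1}" for j
  proof
    fix x assume "x \<in> I j"
    then have "x > (1/2)^Suc j" "x \<le> (1/2)^j" by (auto simp: I_def)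
    moreover have "(1/2::real)^j \<le> 1" by (simp add: power_le_one)
    moreover have "0 < (1/2::real)^Suc j" by simp
    ultimately show "x \<in> {0<..1}" unfolding greaterThanAtMost_iff by (meson less_trans order_trans)
  qed
  have I_disj: "disjoint_family I"
    unfolding disjoint_family_on_def
  proof (intro ballI impI)
    have *: "I i \<inter> I j = {}" if "i < j" for i j
    proof -
      have "(1/2::real)^j \<le> (1/2)^Suc i" using that by (intro power_decreasing) auto
      then show ?thesis by (auto simp: I_def simp del: power_Suc)
    qed
    fix i j :: nat assume "i \<noteq> j"
    then show "I i \<inter> I j = {}" using *[of i j] *[of j i] by (cases "i < j") auto
  qed
  have "(\<Sum>j. c j * ennreal ((1/2)^Suc j)) = (\<Sum>j. \<integral>\<^sup>+\<epsilon>. c j * indicator (I j) \<epsilon> \<partial>lborel)"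
    by (intro suminf_cong) (simp add: I_def nn_integral_cmult_indicator)
  also have "\<dots> = (\<integral>\<^sup>+\<epsilon>. (\<Sum>j. c j * indicator (I j) \<epsilon>) \<partial>lborel)"
    by (intro nn_integral_suminf[symmetric]) (simp add: I_def)
  also have "\<dots> \<le> (\<integral>\<^sup>+\<epsilon>\<in>{0<..1}. sqrt_log (covering_number \<epsilon> A) \<partial>lborel)"
  proof (intro nn_integral_mono)
    fix \<epsilon> :: real
    show "(\<Sum>j. c j * indicator (I j) \<epsilon>) \<le> sqrt_log (covering_number \<epsilon> A) * indicator {0<..1} \<epsilon>"
    proof (cases "\<exists>i. \<epsilon> \<in> I i")
      case True
      then obtain i where i: "\<epsilon> \<in> I i" by blast
      then have other: "\<epsilon> \<notin> I j" if "j \<noteq> i" for j using I_disj that by (auto simp: disjoint_family_on_def)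
      have "(\<Sum>j. c j * indicator (I j) \<epsilon>) = (\<Sum>j\<in>{i}. c j * indicator (I j) \<epsilon>)"
        by (rule suminf_finite) (use other in auto)
      also have "\<dots> = c i" using i by simp
      also have "\<dots> \<le> sqrt_log (covering_number \<epsilon> A)"
        unfolding c_def using i by (intro sqrt_log_mono covering_number_antimono cov0) (simp add: I_def)
      finally show ?thesis using i I_sub[of i] by (simp add: subset_iff)
    next
      case False
      then show ?thesis by simp
    qed
  qed
  finally have fin: "(\<Sum>j. c j * ennreal ((1/2)^Suc j)) < \<infinity>"
    using entropy by (rule le_less_trans)
  \<comment> \<open>One infinite term would make the sum infinite, so every covering number is
    finite and is attained by a cover.\<close>
  have cfin: "covering_number ((1/2)^j) A \<noteq> \<infinity>" for j
  proof
    assume "covering_number ((1/2)^j) A = \<infinity>"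
    then have "c j * ennreal ((1/2)^Suc j) = \<infinity>" by (simp add: c_def sqrt_log_def ennreal_top_mult del: power_Suc)
    then have "(\<Sum>j. c j * ennreal ((1/2)^Suc j)) = \<infinity>"
      by (metis ennreal_suminf_lessD fin infinity_ennreal_def less_irrefl)
    then show False using fin by simp
  qed
  have "\<exists>C. finite C \<and> A \<subseteq> (\<Union>c\<in>C. ball c ((1/2)^j)) \<and> covering_number ((1/2)^j) A = enat (card C)" for j
  proof -
    have "{C. finite C \<and> A \<subseteq> (\<Union>c\<in>C. ball c ((1/2)^j))} \<noteq> {}"
      using cfin[of j] unfolding covering_number_def by (metis Inf_enat_def image_is_empty)
    from INF_enat_attained[OF this, of "\<lambda>C. enat (card C)"] show ?thesis
      unfolding covering_number_def by auto
  qed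
  then obtain C where C: "\<And>j. finite (C j)" "\<And>j. A \<subseteq> (\<Union>c\<in>C j. ball c ((1/2)^j))"
    "\<And>j. covering_number ((1/2)^j) A = enat (card (C j))" by metis
  have Cne: "C j \<noteq> {}" for j using C(2)[of j] ne by auto
  have card1: "card (C j) \<ge> 1" for j using C(1) Cne by (simp add: Suc_leI card_gt_0_iff)
  have cj: "c j = ennreal (sqrt (ln (card (C j))))" for j by (simp add: c_def C(3) sqrt_log_def)
  have "(\<Sum>j. ennreal (sqrt (ln (card (C j))) * (1/2)^Suc j)) < \<infinity>"
    using fin card1 unfolding cj by (simp add: ennreal_mult del: power_Suc)
  then have "summable (\<lambda>j. sqrt (ln (card (C j))) * (1/2)^Suc j)"
    by (intro summable_suminf_not_top) (use card1 in \<open>auto simp: ln_ge_zero simp del: power_Suc\<close>)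
  then have "summable (\<lambda>j. 2 * (sqrt (ln (card (C j))) * (1/2)^Suc j))" by (rule summable_mult)
  then have "summable (\<lambda>j. (1/2)^j * sqrt (ln (card (C j))))" by (simp add: mult.commute)
  then show thesis using that[of C] C Cne by blast
qed

text \<open>A noise process indexed by the Hilbert space, where \<open>D x\<close> is the set of
  directions at which it is defined for the outcome x. Each direction lies in \<open>D x\<close>
  almost surely, but with a null set of its own, so linearity is required only within
  \<open>D x\<close>. The tail bound takes any positive \<open>s \<ge> norm h\<close>, which covers
  \<open>h = 0\<close>.\<close>

locale white_noise = prob_space P for P :: "'x measure" +
  fixes D :: "'x \<Rightarrow> 'h::real_inner set" and W :: "'x \<Rightarrow> 'h \<Rightarrow> real"
  assumes subspace_D: "subspace (D x)"
    and W_add: "g \<in> D x \<Longrightarrow> h \<in> D x \<Longrightarrow> W x (g + h) = W x g + W x h"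
    and W_scale: "h \<in> D x \<Longrightarrow> W x (c *\<^sub>R h) = c * W x h"
    and AE_D: "AE x in P. h \<in> D x"
    and measurable_W [measurable]: "(\<lambda>x. W x h) \<in> borel_measurable P"
    and tail: "norm h \<le> s \<Longrightarrow> 0 < s \<Longrightarrow> 0 \<le> a \<Longrightarrow>
      emeasure P {x \<in> space P. a < \<bar>W x h\<bar>} \<le> ennreal (2 * exp (- (a\<^sup>2 / (2 * s\<^sup>2))))"
begin

lemma W_diff: "g \<in> D x \<Longrightarrow> h \<in> D x \<Longrightarrow> W x (g - h) = W x g - W x h"
  using W_add[of g x "- h"] W_scale[of h x "-1"] subspace_neg[OF subspace_D, of h x] by simp

text \<open>Weakens the Gaussian tail by \<open>exp (- t) \<le> 1 / t\<close> to a bound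
  proportional to \<open>s^2\<close>, convenient for directions whose norm tends to 0 and for fixed
  directions with a large level a.\<close>

lemma chebyshev_tail:
  assumes "norm h \<le> s" "0 < s" "0 < a"
  shows "emeasure P {x \<in> space P. a < \<bar>W x h\<bar>} \<le> ennreal (4 * s\<^sup>2 / a\<^sup>2)"
proof -
  have "exp (- (a\<^sup>2 / (2 * s\<^sup>2))) \<le> 2 * s\<^sup>2 / a\<^sup>2"
  proof -
    have "a\<^sup>2 / (2 * s\<^sup>2) \<le> exp (a\<^sup>2 / (2 * s\<^sup>2))"
      using exp_ge_add_one_self[of "a\<^sup>2 / (2 * s\<^sup>2)"] by linarith
    then have "inverse (exp (a\<^sup>2 / (2 * s\<^sup>2))) \<le> inverse (a\<^sup>2 / (2 * s\<^sup>2))"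
      using assms by (intro le_imp_inverse_le) auto
    then show ?thesis by (simp add: exp_minus)
  qed
  then have "ennreal (2 * exp (- (a\<^sup>2 / (2 * s\<^sup>2)))) \<le> ennreal (4 * s\<^sup>2 / a\<^sup>2)"
    by (intro ennreal_leI) simp
  with tail[OF assms(1,2), of a] assms(3) show ?thesis by (meson less_imp_le order_trans)
qed

text \<open>The level \<open>a j\<close> is chosen so that a link of length at most
  \<open>2 * (1/2)^j\<close> exceeds it with probability at most
  \<open>2 exp (- (L j + L (Suc j) + j + b))\<close>. The first two terms pay for the number of
  links between consecutive nets, the third makes the probabilities summable over j, and b makes
  them small. The event \<Omega> is common to all h; only the passage from the nets to a given h
  costs a null set depending on h.\<close>

lemma chaining:
  fixes C :: "nat \<Rightarrow> 'h set" and b R :: real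
  assumes C: "\<And>j. finite (C j)" "\<And>j. C j \<noteq> {}" "\<And>j. B \<subseteq> (\<Union>c\<in>C j. ball c ((1/2)^j))"
    and R: "\<And>c. c \<in> C 0 \<Longrightarrow> norm c \<le> R" "0 < R" and b: "0 \<le> b"
  defines "L \<equiv> \<lambda>j. ln (real (card (C j)))"
  defines "a \<equiv> \<lambda>j. 2 * (1/2)^j * sqrt (2 * (L j + L (Suc j) + real j + b))"
  assumes suma: "summable a"
  shows "\<exists>\<Omega>\<in>sets P. emeasure P (space P - \<Omega>) \<le> ennreal (6 * exp (- b)) \<and>
    (\<forall>h\<in>B. AE x in P. x \<in> \<Omega> \<longrightarrow> \<bar>W x h\<bar> \<le> R * sqrt (2 * (L 0 + b)) + suminf a + 1)"
proof -
  have L: "L j \<ge> 0" "exp (L j) = real (card (C j))" for j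
    using C(1,2)[of j] by (auto simp: L_def Suc_leI card_gt_0_iff)
  have a0: "a j \<ge> 0" for j using L b by (simp add: a_def)
  define a' where "a' = R * sqrt (2 * (L 0 + b))"
  have a'0: "a' \<ge> 0" using L b R by (simp add: a'_def)
  define Q where "Q j = {(c, c'). c \<in> C j \<and> c' \<in> C (Suc j) \<and> norm (c - c') \<le> 2 * (1/2)^j}" for j
  have Qsub: "Q j \<subseteq> C j \<times> C (Suc j)" for j by (auto simp: Q_def)
  have Qfin: "finite (Q j)" for j using Qsub C(1) by (meson finite_SigmaI finite_subset)
  have Qcard: "card (Q j) \<le> card (C j) * card (C (Suc j))" for j
    using card_mono[OF _ Qsub[of j]] C(1) by (simp add: card_cartesian_product)
  define E0 where "E0 = (\<Union>c\<in>C 0. {x \<in> space P. a' < \<bar>W x c\<bar>})"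
  define E where "E j = (\<Union>q\<in>Q j. {x \<in> space P. a j < \<bar>W x (fst q - snd q)\<bar>})" for j
  have E0m: "E0 \<in> sets P" unfolding E0_def using C(1) by (intro sets.finite_UN) measurable
  have Em: "E j \<in> sets P" for j unfolding E_def using Qfin by (intro sets.finite_UN) measurable
  have PE0: "emeasure P E0 \<le> ennreal (2 * exp (- b))"
  proof -
    have "emeasure P E0 \<le> (\<Sum>c\<in>C 0. emeasure P {x \<in> space P. a' < \<bar>W x c\<bar>})"
      unfolding E0_def by (rule emeasure_subadditive_finite) (use C(1) in auto)
    also have "\<dots> \<le> (\<Sum>c\<in>C 0. ennreal (2 * exp (- (a'\<^sup>2 / (2 * R\<^sup>2)))))"
      by (intro sum_mono tail R a'0)
    also have "\<dots> = ennreal (real (card (C 0)) * (2 * exp (- (L 0 + b))))"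
    proof -
      have "a'\<^sup>2 / (2 * R\<^sup>2) = L 0 + b" using R(2) L[of 0] b by (simp add: a'_def power_mult_distrib)
      then show ?thesis by (simp add: ennreal_mult ennreal_of_nat_eq_real_of_nat)
    qed
    also have "\<dots> = ennreal (2 * exp (- b))"
      unfolding L(2)[symmetric] by (simp add: exp_diff exp_minus field_simps)
    finally show ?thesis .
  qed
  have PE: "emeasure P (E j) \<le> ennreal (2 * exp (- b) * (1/2)^j)" for j
  proof -
    have s: "(2 * (1/2::real)^j) > 0" by simp
    have "emeasure P (E j) \<le> (\<Sum>q\<in>Q j. emeasure P {x \<in> space P. a j < \<bar>W x (fst q - snd q)\<bar>})"
      unfolding E_def by (rule emeasure_subadditive_finite) (use Qfin in auto)
    also have "\<dots> \<le> (\<Sum>q\<in>Q j. ennreal (2 * exp (- ((a j)\<^sup>2 / (2 * (2 * (1/2)^j)\<^sup>2)))))"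
      by (intro sum_mono tail a0) (auto simp: Q_def)
    also have "\<dots> = (\<Sum>q\<in>Q j. ennreal (2 * exp (- (L j + L (Suc j) + real j + b))))"
    proof (intro sum.cong refl)
      have "(a j)\<^sup>2 = (2 * (1/2)^j)\<^sup>2 * (2 * (L j + L (Suc j) + real j + b))"
        using L b by (simp add: a_def power_mult_distrib)
      then have "(a j)\<^sup>2 / (2 * (2 * (1/2)^j)\<^sup>2) = L j + L (Suc j) + real j + b"
        using s by (simp del: power_mult_distrib)
      then show "ennreal (2 * exp (- ((a j)\<^sup>2 / (2 * (2 * (1/2)^j)\<^sup>2)))) = ennreal (2 * exp (- (L j + L (Suc j) + real j + b)))"
        by simp
    qed
    also have "\<dots> = ennreal (real (card (Q j)) * (2 * exp (- (L j + L (Suc j) + real j + b))))"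
      by (simp add: ennreal_mult ennreal_of_nat_eq_real_of_nat)
    also have "\<dots> \<le> ennreal ((exp (L j) * exp (L (Suc j))) * (2 * exp (- (L j + L (Suc j) + real j + b))))"
      unfolding L(2) using Qcard[of j]
      by (intro ennreal_leI mult_right_mono) (simp_all flip: of_nat_mult)
    also have "\<dots> = ennreal (2 * exp (- b) * exp (- real j))"
      by (simp add: exp_add exp_diff exp_minus field_simps)
    also have "\<dots> \<le> ennreal (2 * exp (- b) * (1/2)^j)"
    proof (intro ennreal_leI mult_left_mono)
      have "exp (- real j) = (exp (-1)) ^ j" by (simp add: exp_of_nat_mult[symmetric])
      also have "\<dots> \<le> (1/2)^j"
      proof (rule power_mono)
        have "2 \<le> exp (1::real)" using exp_ge_add_one_self[of 1] by simp
        then show "exp (-1) \<le> (1/2::real)" by (simp add: exp_minus field_simps)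
      qed simp
      finally show "exp (- real j) \<le> (1/2)^j" .
    qed simp
    finally show ?thesis .
  qed
  define \<Omega> where "\<Omega> = space P - (E0 \<union> (\<Union>j. E j))"
  have \<Omega>m: "\<Omega> \<in> sets P" unfolding \<Omega>_def using E0m Em by auto
  have "emeasure P (space P - \<Omega>) \<le> ennreal (6 * exp (- b))"
  proof -
    have "space P - \<Omega> = E0 \<union> (\<Union>j. E j)"
      using E0m Em sets.sets_into_space unfolding \<Omega>_def by blast
    then have "emeasure P (space P - \<Omega>) \<le> emeasure P E0 + emeasure P (\<Union>j. E j)"
      using E0m Em by (auto intro!: emeasure_subadditive)
    also have "\<dots> \<le> ennreal (2 * exp (- b)) + (\<Sum>j. emeasure P (E j))"
      using Em by (intro add_mono PE0 emeasure_subadditive_countably) auto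
    also have "\<dots> \<le> ennreal (2 * exp (- b)) + (\<Sum>j. ennreal (2 * exp (- b) * (1/2)^j))"
      by (intro add_mono suminf_le PE order_refl) auto
    also have "(\<Sum>j. ennreal (2 * exp (- b) * (1/2)^j)) = ennreal (2 * exp (- b) * 2)"
    proof (rule suminf_ennreal_eq)
      show "(\<lambda>j. 2 * exp (- b) * (1/2)^j) sums (2 * exp (- b) * 2)"
        using geometric_sums[of "1/2::real"] by (intro sums_mult) simp
    qed simp
    also have "ennreal (2 * exp (- b)) + ennreal (2 * exp (- b) * 2) = ennreal (6 * exp (- b))"
      by (simp add: ennreal_plus[symmetric] del: ennreal_plus)
    finally show ?thesis .
  qed
  moreover have "AE x in P. x \<in> \<Omega> \<longrightarrow> \<bar>W x h\<bar> \<le> a' + suminf a + 1" if h: "h \<in> B" for h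
  proof -
    have "\<exists>c\<in>C j. dist c h < (1/2)^j" for j using subsetD[OF C(3)[of j] h] by (simp add: UN_iff mem_ball)
    then obtain c where c: "\<And>j. c j \<in> C j" "\<And>j. dist (c j) h < (1/2)^j" by metis
    have cQ: "(c j, c (Suc j)) \<in> Q j" for j
    proof -
      have "dist (c j) (c (Suc j)) \<le> dist (c j) h + dist (c (Suc j)) h" by (rule dist_triangle2)
      also have "\<dots> \<le> (1/2)^j + (1/2)^Suc j" using c(2)[of j] c(2)[of "Suc j"] by (intro add_mono) auto
      also have "\<dots> \<le> 2 * (1/2)^j" by simp
      finally show ?thesis using c(1) by (simp add: Q_def dist_norm)
    qed
    \<comment> \<open>The summand 1 in the bound is slack for the passage from the nets to h: almost
      surely on F every \<open>W x (h - c j)\<close> exceeds 1 in absolute value, and the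
      probability of this tends to 0 as j grows.\<close>
    define F where "F = {x \<in> space P. x \<in> \<Omega> \<and> \<not> \<bar>W x h\<bar> \<le> a' + suminf a + 1}"
    have Fm: "F \<in> sets P" unfolding F_def using \<Omega>m by measurable
    have AEc: "AE x in P. h \<in> D x \<and> (\<forall>j. c j \<in> D x)"
      by (intro AE_conjI AE_D) (simp add: AE_all_countable AE_D)
    have small: "emeasure P F \<le> ennreal (4 * ((1/2)^j)\<^sup>2 / 1\<^sup>2)" for j
    proof -
      have "emeasure P F \<le> emeasure P {x \<in> space P. 1 < \<bar>W x (h - c j)\<bar>}"
      proof (rule emeasure_mono_AE)
        show "AE x in P. x \<in> F \<longrightarrow> x \<in> {x \<in> space P. 1 < \<bar>W x (h - c j)\<bar>}"
          using AEc
        proof eventually_elim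
          case (elim x)
          show ?case
          proof
            assume xF: "x \<in> F"
            then have x\<Omega>: "x \<in> \<Omega>" by (simp add: F_def)
            have partial: "\<bar>W x (c i)\<bar> \<le> a' + (\<Sum>k<i. a k)" for i
            proof (induction i)
              case 0
              show ?case using x\<Omega> c(1)[of 0] by (auto simp: \<Omega>_def E0_def not_less)
            next
              case (Suc i)
              have "\<bar>W x (c i - c (Suc i))\<bar> \<le> a i"
                using x\<Omega> cQ[of i] by (force simp: \<Omega>_def E_def not_less)
              moreover have "W x (c i - c (Suc i)) = W x (c i) - W x (c (Suc i))"
                using elim by (intro W_diff) auto
              ultimately show ?case using Suc by (simp add: abs_le_iff)
            qed
            have "(\<Sum>k<j. a k) \<le> suminf a" by (intro sum_le_suminf suma) (use a0 in auto)
            with partial[of j] have "\<bar>W x (c j)\<bar> \<le> a' + suminf a" by linarith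
            moreover have "W x (h - c j) = W x h - W x (c j)" using elim by (intro W_diff) auto
            moreover have "\<bar>W x h\<bar> > a' + suminf a + 1" using xF by (simp add: F_def)
            ultimately have "1 < \<bar>W x (h - c j)\<bar>" by linarith
            then show "x \<in> {x \<in> space P. 1 < \<bar>W x (h - c j)\<bar>}" using xF by (simp add: F_def)
          qed
        qed
      qed measurable
      also have "\<dots> \<le> ennreal (4 * ((1/2)^j)\<^sup>2 / 1\<^sup>2)"
        by (rule chebyshev_tail) (use c(2)[of j] in \<open>auto simp: dist_norm norm_minus_commute\<close>)
      finally show ?thesis .
    qed
    have "(\<lambda>j. ennreal (4 * ((1/2)^j)\<^sup>2 / 1\<^sup>2)) \<longlonglongrightarrow> ennreal (4 * 0\<^sup>2 / 1\<^sup>2)"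
      by (intro tendsto_ennrealI tendsto_intros LIMSEQ_power_zero) auto
    then have "emeasure P F \<le> ennreal (4 * 0\<^sup>2 / 1\<^sup>2)"
      by (rule LIMSEQ_le_const) (use small in auto)
    then have "emeasure P F = 0" by simp
    then have "AE x in P. x \<notin> F" using Fm by (intro AE_not_in) (auto simp: null_sets_def)
    then show ?thesis using AE_space by eventually_elim (auto simp: F_def)
  qed
  ultimately show ?thesis using \<Omega>m unfolding a'_def by blast
qed

end

text \<open>The bound depends only on the entropy, not on the noise, so that one \<open>m\<close> serves all sample sizes.\<close>

lemma dudley_bounded:
  fixes B :: "'h::real_inner set" and \<eta> :: real
  assumes ne: "B \<noteq> {}" and \<eta>: "0 < \<eta>"
    and entropy: "(\<integral>\<^sup>+\<epsilon>\<in>{0<..1}. sqrt_log (covering_number \<epsilon> B) \<partial>lborel) < \<infinity>"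
  shows "\<exists>m\<ge>0. \<forall>(P :: 'x measure) D W. white_noise P D W \<longrightarrow>
    (\<exists>\<Omega>\<in>sets P. emeasure P (space P - \<Omega>) \<le> ennreal \<eta> \<and> (\<forall>h\<in>B. AE x in P. x \<in> \<Omega> \<longrightarrow> \<bar>W x h\<bar> \<le> m))"
proof -
  obtain C :: "nat \<Rightarrow> 'h set" where C: "\<And>j. finite (C j)" "\<And>j. C j \<noteq> {}" "\<And>j. B \<subseteq> (\<Union>c\<in>C j. ball c ((1/2)^j))"
    and sC: "summable (\<lambda>j. (1/2)^j * sqrt (ln (card (C j))))"
    by (rule entropy_nets[OF ne entropy]) (rule that)
  \<comment> \<open>Chosen so that the failure probability \<open>6 exp (- b)\<close> of the
    chaining event is at most \<eta>.\<close>
  define b where "b = max 0 (ln (6 / \<eta>))"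
  have b: "0 \<le> b" "6 * exp (- b) \<le> \<eta>"
  proof -
    have "6 / \<eta> = exp (ln (6 / \<eta>))" using \<eta> by simp
    also have "\<dots> \<le> exp b" by (simp add: b_def)
    finally show "6 * exp (- b) \<le> \<eta>" using \<eta> by (simp add: exp_minus field_simps)
  qed (simp add: b_def)
  obtain R where R: "\<And>c. c \<in> C 0 \<Longrightarrow> norm c \<le> R" "0 < R"
    using finite_imp_bounded[OF C(1)[of 0]] by (auto simp: bounded_pos)
  define L where "L = (\<lambda>j. ln (real (card (C j))))"
  define a where "a = (\<lambda>j. 2 * (1/2)^j * sqrt (2 * (L j + L (Suc j) + real j + b)))"
  have L: "L j \<ge> 0" for j
    using C(1,2)[of j] by (auto simp: L_def Suc_leI card_gt_0_iff)
  have s1: "summable (\<lambda>j. (1/2)^j * sqrt (L j))" using sC by (simp add: L_def)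
  have "summable (\<lambda>j. 2 * ((1/2)^Suc j * sqrt (L (Suc j))))"
    using s1 by (intro summable_mult) (subst summable_Suc_iff)
  then have s2: "summable (\<lambda>j. (1/2)^j * sqrt (L (Suc j)))" by (simp add: mult.assoc)
  have s3: "summable (\<lambda>j. real (Suc j) * (1/2)^j)"
    using geometric_deriv_sums[of "1/2::real"] by (intro sums_summable) simp
  have s4: "summable (\<lambda>j. sqrt b * (1/2::real)^j)" by (intro summable_mult summable_geometric) simp
  \<comment> \<open>By subadditivity of the square root, \<open>a j\<close> is bounded by four
    summable terms: two from the entropy sum, one for \<open>sqrt j \<le> Suc j\<close> and one for
    \<open>sqrt b\<close>.\<close>
  have "summable (\<lambda>j. 4 * ((1/2)^j * sqrt (L j) + (1/2)^j * sqrt (L (Suc j)) + real (Suc j) * (1/2)^j + sqrt b * (1/2)^j))"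
    by (intro summable_mult summable_add s1 s2 s3 s4)
  then have suma: "summable a"
  proof (rule summable_comparison_test[rotated], intro exI allI impI)
    fix j
    have "sqrt (L j + L (Suc j) + real j + b) \<le> sqrt (L j) + sqrt (L (Suc j)) + sqrt (real j) + sqrt b"
      using L[of j] L[of "Suc j"] b(1)
      by (meson add_mono add_nonneg_nonneg of_nat_0_le_iff order_refl order_trans sqrt_add_le_add_sqrt)
    also have "sqrt (real j) \<le> real (Suc j)"
      by (rule real_le_lsqrt) (auto simp: power2_eq_square algebra_simps)
    finally have "sqrt (L j + L (Suc j) + real j + b) \<le> sqrt (L j) + sqrt (L (Suc j)) + real (Suc j) + sqrt b"
      by simp
    moreover have "sqrt 2 \<le> (2::real)" by (rule real_le_lsqrt) auto
    ultimately have "sqrt 2 * sqrt (L j + L (Suc j) + real j + b) \<le> 2 * (sqrt (L j) + sqrt (L (Suc j)) + real (Suc j) + sqrt b)"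
      using L[of j] L[of "Suc j"] b(1) by (intro mult_mono) auto
    then have "2 * (1/2)^j * (sqrt 2 * sqrt (L j + L (Suc j) + real j + b)) \<le> 2 * (1/2)^j * (2 * (sqrt (L j) + sqrt (L (Suc j)) + real (Suc j) + sqrt b))"
      by (rule mult_left_mono) simp
    then show "norm (a j) \<le> 4 * ((1/2)^j * sqrt (L j) + (1/2)^j * sqrt (L (Suc j)) + real (Suc j) * (1/2)^j + sqrt b * (1/2)^j)"
      using L[of j] L[of "Suc j"] b(1) unfolding a_def by (simp only: real_sqrt_mult) (simp add: algebra_simps)
  qed
  have a_nn: "suminf a \<ge> 0"
    using L b(1) by (intro suminf_nonneg suma) (simp add: a_def)
  define m where "m = R * sqrt (2 * (L 0 + b)) + suminf a + 1"
  have "m \<ge> 0" using R(2) L[of 0] b(1) a_nn by (simp add: m_def)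
  moreover have "\<exists>\<Omega>\<in>sets P. emeasure P (space P - \<Omega>) \<le> ennreal \<eta> \<and> (\<forall>h\<in>B. AE x in P. x \<in> \<Omega> \<longrightarrow> \<bar>W x h\<bar> \<le> m)"
    if "white_noise P D W" for P :: "'x measure" and D W
    using white_noise.chaining[OF that C R b(1) suma[unfolded a_def L_def]] ennreal_leI[OF b(2)]
    unfolding m_def a_def L_def by (meson order_trans)
  ultimately show ?thesis by blast
qed

section \<open>The white noise model\<close>

definition pairing_domain :: "(nat \<Rightarrow> 'h::real_inner) \<Rightarrow> (nat \<Rightarrow> real) \<Rightarrow> 'h set" where
  "pairing_domain e y = {h. summable (\<lambda>k. y k * (h \<bullet> e k))}"

abbreviation obs_space :: "obs measure" where
  "obs_space \<equiv> (\<Pi>\<^sub>M k\<in>UNIV. borel) \<Otimes>\<^sub>M (\<Pi>\<^sub>M k\<in>UNIV. borel)"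

lemma subspace_pairing_domain: "subspace (pairing_domain e y)"
proof (rule subspaceI)
  show "0 \<in> pairing_domain e y" by (simp add: pairing_domain_def)
  show "g + h \<in> pairing_domain e y" if "g \<in> pairing_domain e y" "h \<in> pairing_domain e y" for g h
    using summable_add[of "\<lambda>k. y k * (g \<bullet> e k)" "\<lambda>k. y k * (h \<bullet> e k)"] that
    by (simp add: pairing_domain_def inner_add_left algebra_simps)
  show "c *\<^sub>R h \<in> pairing_domain e y" if "h \<in> pairing_domain e y" for c h
    using summable_mult[of "\<lambda>k. y k * (h \<bullet> e k)" c] that
    by (simp add: pairing_domain_def mult_ac)
qed

lemma pairing_add:
  "g \<in> pairing_domain e y \<Longrightarrow> h \<in> pairing_domain e y \<Longrightarrow> pairing e y (g + h) = pairing e y g + pairing e y h"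
  by (simp add: pairing_domain_def pairing_def inner_add_left distrib_left suminf_add)

lemma pairing_scale: "h \<in> pairing_domain e y \<Longrightarrow> pairing e y (c *\<^sub>R h) = c * pairing e y h"
  using suminf_mult[of "\<lambda>k. y k * (h \<bullet> e k)" c]
  by (simp add: pairing_domain_def pairing_def mult_ac)

lemma measurable_summable:
  fixes f :: "nat \<Rightarrow> 'a \<Rightarrow> real"
  assumes [measurable]: "\<And>k. f k \<in> borel_measurable M"
  shows "{x \<in> space M. summable (\<lambda>k. f k x)} \<in> sets M"
proof -
  have "{x \<in> space M. Cauchy (\<lambda>n. \<Sum>k<n. f k x)} \<in> sets M" by measurable
  then show ?thesis unfolding summable_iff_convergent Cauchy_convergent_iff .
qed

lemma measurable_pairing [measurable (raw)]:
  fixes e :: "nat \<Rightarrow> 'h::{real_inner, second_countable_topology}"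
  assumes y: "y \<in> measurable M (\<Pi>\<^sub>M k\<in>UNIV. borel)" and [measurable]: "h \<in> borel_measurable M"
  shows "(\<lambda>x. pairing e (y x) (h x)) \<in> borel_measurable M"
proof -
  have [measurable]: "(\<lambda>x. y x k) \<in> borel_measurable M" for k
    using measurable_compose[OF y measurable_component_singleton[of k UNIV]] by simp
  show ?thesis unfolding pairing_def by measurable
qed

lemma measurable_pairing_domain:
  fixes e :: "nat \<Rightarrow> 'h::{real_inner, second_countable_topology}"
  assumes y: "y \<in> measurable M (\<Pi>\<^sub>M k\<in>UNIV. borel)" and [measurable]: "h \<in> borel_measurable M"
  shows "{x \<in> space M. h x \<in> pairing_domain e (y x)} \<in> sets M"
proof -
  have [measurable]: "(\<lambda>x. y x k) \<in> borel_measurable M" for k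
    using measurable_compose[OF y measurable_component_singleton[of k UNIV]] by simp
  show ?thesis unfolding pairing_domain_def mem_Collect_eq by (intro measurable_summable) measurable
qed

lemma prob_space_noise_law: "prob_space noise_law"
  unfolding noise_law_def by (intro prob_space_pair gauss_seq.prob_space_axioms)

text \<open>The sequence is reached through a map \<Psi> into the observation space followed by a
  projection X, so that the lemma applies to either half of a pair of sequences. By Parseval the
  mean contributes exactly \<open>g \<bullet> h\<close>; wherever the noise series converges, the
  recovered noise equals its sum.\<close>

lemma white_noise_sequence:
  fixes e :: "nat \<Rightarrow> 'h::{real_inner, second_countable_topology}" and N :: "'a measure"
  assumes e: "orthonormal_basis e" and n: "n \<ge> 1"
    and N: "prob_space N" and Z: "Z \<in> measurable N gauss_seq" "distr N gauss_seq Z = gauss_seq"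
    and \<Psi>[measurable]: "\<Psi> \<in> measurable N M" and X: "X \<in> measurable M (\<Pi>\<^sub>M k\<in>UNIV. borel)"
    and XZ: "\<And>z k. X (\<Psi> z) k = g \<bullet> e k + Z z k / sqrt (real n)"
  shows "white_noise (distr N M \<Psi>) (\<lambda>x. pairing_domain e (X x)) (\<lambda>x. noise_pairing e n g (X x))"
proof -
  note on = orthonormal_basisD[OF e]
  interpret N: prob_space N by fact
  interpret D: prob_space "distr N M \<Psi>" by (rule N.prob_space_distr) fact
  have n0: "sqrt (real n) > 0" using n by simp
  have bes: "(\<Sum>k<m. (h \<bullet> e k)\<^sup>2) \<le> (norm h)\<^sup>2" for h m by (rule bessel[OF on]) simp
  have AE_Z: "AE z in N. summable (\<lambda>k. (h \<bullet> e k) * Z z k)" for h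
  proof -
    have "summable (\<lambda>k. (h \<bullet> e k)\<^sup>2)"
      by (rule summableI_nonneg_bounded[OF _ bes]) simp
    then have "AE z in distr N gauss_seq Z. summable (\<lambda>k. (h \<bullet> e k) * z k)"
      unfolding Z(2) by (rule AE_summable_gauss_seq)
    then show ?thesis by (rule AE_distrD[OF Z(1)])
  qed
  have eq: "h \<in> pairing_domain e (X (\<Psi> z)) \<and> noise_pairing e n g (X (\<Psi> z)) h = (\<Sum>k. (h \<bullet> e k) * Z z k)"
    if s: "summable (\<lambda>k. (h \<bullet> e k) * Z z k)" for h z
  proof -
    have "(\<lambda>k. (g \<bullet> e k) * (h \<bullet> e k) + (1 / sqrt (real n)) * ((h \<bullet> e k) * Z z k)) sums
      (g \<bullet> h + (1 / sqrt (real n)) * (\<Sum>k. (h \<bullet> e k) * Z z k))"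
      by (intro sums_add sums_mult summable_sums parseval_sums e s)
    then have "(\<lambda>k. X (\<Psi> z) k * (h \<bullet> e k)) sums (g \<bullet> h + (1 / sqrt (real n)) * (\<Sum>k. (h \<bullet> e k) * Z z k))"
      by (simp add: XZ algebra_simps)
    then show ?thesis using n0
      by (auto simp: pairing_domain_def noise_pairing_def pairing_def sums_iff)
  qed
  show ?thesis
  proof (unfold_locales, goal_cases)
    case 1 then show ?case by (rule subspace_pairing_domain)
  next
    case 2 then show ?case by (simp add: noise_pairing_def pairing_add inner_add_right algebra_simps)
  next
    case 3 then show ?case by (simp add: noise_pairing_def pairing_scale algebra_simps)
  next
    case (4 h)
    have "{x \<in> space M. h \<in> pairing_domain e (X x)} \<in> sets M"
      using measurable_pairing_domain[OF X, of "\<lambda>_. h" e] by simp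
    then show ?case using AE_Z[of h] eq by (subst AE_distr_iff[OF \<Psi>]) (auto elim: AE_mp)
  next
    case (5 h)
    show ?case unfolding noise_pairing_def using X by measurable
  next
    case (6 h s a)
    have Wm: "(\<lambda>x. noise_pairing e n g (X x) h) \<in> borel_measurable M"
      unfolding noise_pairing_def using X by measurable
    define E where "E = {z \<in> space gauss_seq. \<exists>k. a < \<bar>\<Sum>j<k. (h \<bullet> e j) * z j\<bar>}"
    have Em: "E \<in> sets gauss_seq" unfolding E_def by measurable
    have "emeasure (distr N M \<Psi>) {x \<in> space (distr N M \<Psi>). a < \<bar>noise_pairing e n g (X x) h\<bar>}
       = emeasure N (\<Psi> -` {x \<in> space M. a < \<bar>noise_pairing e n g (X x) h\<bar>} \<inter> space N)"
      using Wm by (subst emeasure_distr) auto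
    \<comment> \<open>A limit strictly above a forces some partial sum above a, so the tail follows
      from the maximal inequality.\<close>
    also have "\<dots> \<le> emeasure N (Z -` E \<inter> space N)"
    proof (rule emeasure_mono_AE)
      show "AE x in N. x \<in> \<Psi> -` {x \<in> space M. a < \<bar>noise_pairing e n g (X x) h\<bar>} \<inter> space N \<longrightarrow> x \<in> Z -` E \<inter> space N"
        using AE_Z[of h]
      proof eventually_elim
        case (elim z)
        show ?case
        proof
          assume z: "z \<in> \<Psi> -` {x \<in> space M. a < \<bar>noise_pairing e n g (X x) h\<bar>} \<inter> space N"
          then have "a < \<bar>\<Sum>k. (h \<bullet> e k) * Z z k\<bar>" using eq[OF elim] by simp
          moreover have "(\<lambda>k. \<bar>\<Sum>j<k. (h \<bullet> e j) * Z z j\<bar>) \<longlonglongrightarrow> \<bar>\<Sum>k. (h \<bullet> e k) * Z z k\<bar>"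
            by (intro tendsto_rabs summable_LIMSEQ elim)
          ultimately have "\<forall>\<^sub>F k in sequentially. a < \<bar>\<Sum>j<k. (h \<bullet> e j) * Z z j\<bar>"
            by (rule order_tendstoD[rotated])
          then obtain k where "a < \<bar>\<Sum>j<k. (h \<bullet> e j) * Z z j\<bar>"
            using eventually_happens by fastforce
          then show "z \<in> Z -` E \<inter> space N"
            using z measurable_space[OF Z(1)] by (auto simp: E_def)
        qed
      qed
    qed (use measurable_sets[OF Z(1) Em] in simp)
    also have "\<dots> = emeasure (distr N gauss_seq Z) E" using Z(1) Em by (simp add: emeasure_distr)
    also have "\<dots> \<le> ennreal (2 * exp (- (a\<^sup>2 / (2 * s\<^sup>2))))"
      unfolding Z(2) E_def
    proof (rule gauss_seq_maximal)
      show "(\<Sum>j<m. (h \<bullet> e j)\<^sup>2) \<le> s\<^sup>2" for m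
        using bes[of h m] power_mono[OF 6(1), of 2] by simp
    qed (use 6 in auto)
    finally show ?case .
  qed
qed

lemma measurable_obs_map:
  "(\<lambda>(z1, z2). (\<lambda>k. a k + z1 k / c, \<lambda>k. b k + z2 k / c)) \<in> measurable noise_law obs_space"
proof -
  have [measurable]: "(\<lambda>z. z k) \<in> borel_measurable gauss_seq" for k by measurable
  show ?thesis unfolding noise_law_def split_beta'
    by (intro measurable_Pair measurable_PiM_single') (auto simp: space_PiM)
qed

lemma
  fixes e :: "nat \<Rightarrow> 'h::{real_inner, second_countable_topology}" and K :: "real \<Rightarrow> 'h \<Rightarrow>\<^sub>L 'h"
  assumes e: "orthonormal_basis e" and n: "n \<ge> 1"
  shows white_noise_fst: "white_noise (obs_law e K n \<theta> f)
      (\<lambda>x. pairing_domain e (fst x)) (\<lambda>x. noise_pairing e n f (fst x))"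
    and white_noise_snd: "white_noise (obs_law e K n \<theta> f)
      (\<lambda>x. pairing_domain e (snd x)) (\<lambda>x. noise_pairing e n (blinfun_apply (K \<theta>) f) (snd x))"
proof -
  have fst: "fst \<in> measurable noise_law gauss_seq" "distr noise_law gauss_seq fst = gauss_seq"
    unfolding noise_law_def by (auto simp: gauss_seq.P.distr_pair_fst)
  have snd: "snd \<in> measurable noise_law gauss_seq" "distr noise_law gauss_seq snd = gauss_seq"
  proof -
    interpret pair_prob_space gauss_seq gauss_seq ..
    show "distr noise_law gauss_seq snd = gauss_seq"
      by (rule measure_eqI)
        (auto simp: noise_law_def emeasure_distr gauss_seq.P.emeasure_pair_measure_Times gauss_seq.P.emeasure_space_1
          vimage_snd Times_Int_Times space_pair_measure dest: sets.sets_into_space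
          intro!: arg_cong2[of _ _ _ _ emeasure])
  qed (simp add: noise_law_def)
  show "white_noise (obs_law e K n \<theta> f) (\<lambda>x. pairing_domain e (fst x)) (\<lambda>x. noise_pairing e n f (fst x))"
    unfolding obs_law_def
    by (rule white_noise_sequence[OF e n prob_space_noise_law fst measurable_obs_map]) auto
  show "white_noise (obs_law e K n \<theta> f)
      (\<lambda>x. pairing_domain e (snd x)) (\<lambda>x. noise_pairing e n (blinfun_apply (K \<theta>) f) (snd x))"
    unfolding obs_law_def
    by (rule white_noise_sequence[OF e n prob_space_noise_law snd measurable_obs_map]) auto
qed

declare measurable_gauss_seq_component [measurable del]

section \<open>Expansions of the log likelihood\<close>

lemma abs_inner_le:
  fixes x y :: "'h::real_inner"
  assumes "norm x \<le> a" "norm y \<le> b"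
  shows "\<bar>x \<bullet> y\<bar> \<le> a * b"
proof -
  have "\<bar>x \<bullet> y\<bar> \<le> norm x * norm y" by (rule Cauchy_Schwarz_ineq2)
  also have "\<dots> \<le> a * b" using assms by (intro mult_mono) (auto intro: order_trans[OF norm_ge_zero])
  finally show ?thesis .
qed

lemma abs_norm_sq_diff_le:
  fixes x y :: "'h::real_inner"
  assumes "norm (x - y) \<le> a" "norm x \<le> b" "norm y \<le> c"
  shows "\<bar>(norm x)\<^sup>2 - (norm y)\<^sup>2\<bar> \<le> a * (b + c)"
proof -
  have "(norm x)\<^sup>2 - (norm y)\<^sup>2 = (x - y) \<bullet> (x + y)"
    by (simp add: power2_norm_eq_inner inner_diff_left inner_add_right inner_commute[of y x])
  moreover have "norm (x + y) \<le> b + c" using norm_triangle_ineq[of x y] assms by linarith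
  ultimately show ?thesis using abs_inner_le[OF assms(1)] by metis
qed

text \<open>
  The noise functionals at one fixed observation: \<open>W1\<close> and \<open>W2\<close> are linear only on the subspaces
  \<open>V1\<close> and \<open>V2\<close> on which the series converge. The direction \<open>w\<close> stands for \<open>\<gamma>\<^sub>n\<close>, and \<open>D\<close> bounds all constants at once.
\<close>

locale llr_setting =
  fixes n :: nat and K :: "real \<Rightarrow> 'h::real_inner \<Rightarrow>\<^sub>L 'h" and Kd :: "'h \<Rightarrow>\<^sub>L 'h"
    and \<Theta> :: "real set" and \<theta>0 :: real and f0 \<gamma> w :: 'h
    and V1 V2 :: "'h set" and W1 W2 :: "'h \<Rightarrow> real" and D \<tau> :: real
  assumes n: "n \<ge> 1" and D: "1 \<le> D" and \<tau>: "0 \<le> \<tau>" and \<theta>0: "\<theta>0 \<in> \<Theta>"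
    and V: "subspace V1" "subspace V2"
    and W1_lin: "\<And>g h. g \<in> V1 \<Longrightarrow> h \<in> V1 \<Longrightarrow> W1 (g + h) = W1 g + W1 h"
      "\<And>c h. h \<in> V1 \<Longrightarrow> W1 (c *\<^sub>R h) = c * W1 h"
    and W2_lin: "\<And>g h. g \<in> V2 \<Longrightarrow> h \<in> V2 \<Longrightarrow> W2 (g + h) = W2 g + W2 h"
      "\<And>c h. h \<in> V2 \<Longrightarrow> W2 (c *\<^sub>R h) = c * W2 h"
    and K_le: "\<And>\<theta>. \<theta> \<in> \<Theta> \<Longrightarrow> norm (K \<theta>) \<le> D" and Kd_le: "norm Kd \<le> D"
    and K_lip: "\<And>\<theta> h. \<theta> \<in> \<Theta> \<Longrightarrow> norm (K \<theta> h - K \<theta>0 h) \<le> D * \<bar>\<theta> - \<theta>0\<bar> * norm h"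
    and K_quad: "\<And>\<theta> h. \<theta> \<in> \<Theta> \<Longrightarrow> norm (K \<theta> h - K \<theta>0 h - (\<theta> - \<theta>0) *\<^sub>R Kd h) \<le> D * (\<theta> - \<theta>0)\<^sup>2 * norm h"
    and f0_le: "norm f0 \<le> D" and \<gamma>_le: "norm \<gamma> \<le> D" and w_le: "norm w \<le> D" and w_close: "norm (w - \<gamma>) \<le> \<tau>"
    and w_V: "w \<in> V1" "K \<theta>0 w \<in> V2" and f0_V: "Kd f0 \<in> V2"
    and \<gamma>_eq: "(norm \<gamma>)\<^sup>2 + (norm (K \<theta>0 \<gamma>))\<^sup>2 = K \<theta>0 \<gamma> \<bullet> Kd f0"
    and W_\<gamma>: "\<bar>W1 \<gamma> + W2 (K \<theta>0 \<gamma>)\<bar> \<le> D" and W_w: "\<bar>(W1 w + W2 (K \<theta>0 w)) - (W1 \<gamma> + W2 (K \<theta>0 \<gamma>))\<bar> \<le> \<tau>"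
    and W_f0: "\<bar>W2 (Kd f0)\<bar> \<le> D"
begin

text \<open>By \<open>\<gamma>_eq\<close>, \<open>c1\<close> is also the sum of the squared norms of
  \<gamma> and \<open>K \<theta>0 \<gamma>\<close>. In the application \<open>k2 - c1\<close> is the
  efficient information, and \<open>\<zeta> - \<xi>\<close> is that information times the centring
  variable of the limit law.\<close>

definition "c1 = K \<theta>0 \<gamma> \<bullet> Kd f0"
definition "k2 = (norm (Kd f0))\<^sup>2"
definition "\<zeta> = W2 (Kd f0)"
definition "\<xi> = W1 \<gamma> + W2 (K \<theta>0 \<gamma>)"
definition "\<U> \<theta> = sqrt (real n) * (\<theta> - \<theta>0)"

text \<open>The score in the direction \<open>w\<close> at \<open>\<theta>0\<close>, up to noise.\<close>

definition "\<D> f = sqrt (real n) * ((f - f0) \<bullet> w + K \<theta>0 (f - f0) \<bullet> K \<theta>0 w)"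

text \<open>The log likelihood up to a summand free of \<theta> and f, which normalisation removes.
  The squares are centred at the true means; the noise terms are not centred.\<close>

definition "ell \<theta> f = sqrt (real n) * W1 f + sqrt (real n) * W2 (K \<theta> f)
   - real n / 2 * (norm (f - f0))\<^sup>2 - real n / 2 * (norm (K \<theta> f - K \<theta>0 f0))\<^sup>2"

text \<open>The increment is \<open>(K \<theta> - K \<theta>0) (f - f0)\<close> plus the
  second-order remainder at \<open>f0\<close>. The Lipschitz and the quadratic bound, each
  multiplied by a bound for the noise on the unit ball of S, give the two summands.\<close>

definition "good \<theta> f \<longleftrightarrow> \<theta> \<in> \<Theta> \<and> f \<in> V1 \<and> K \<theta>0 f \<in> V2 \<and> K \<theta> f \<in> V2 \<and>
   \<bar>W2 (K \<theta> f - K \<theta>0 f - (\<theta> - \<theta>0) *\<^sub>R Kd f0)\<bar> \<le> D * \<bar>\<theta> - \<theta>0\<bar> * (norm (f - f0) + \<bar>\<theta> - \<theta>0\<bar>)"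

definition "good_dir \<theta> \<longleftrightarrow> \<theta> \<in> \<Theta> \<and> K \<theta> w \<in> V2 \<and> \<bar>W2 (K \<theta> w - K \<theta>0 w)\<bar> \<le> D * \<bar>\<theta> - \<theta>0\<bar>"

lemma sqrt_n: "sqrt (real n) > 0" "sqrt (real n) * sqrt (real n) = real n"
  using n by auto

lemma W1_diff: "g \<in> V1 \<Longrightarrow> h \<in> V1 \<Longrightarrow> W1 (g - h) = W1 g - W1 h"
  using W1_lin(1)[of g "- h"] W1_lin(2)[of h "-1"] subspace_neg[OF V(1), of h] by simp

lemma W2_diff: "g \<in> V2 \<Longrightarrow> h \<in> V2 \<Longrightarrow> W2 (g - h) = W2 g - W2 h"
  using W2_lin(1)[of g "- h"] W2_lin(2)[of h "-1"] subspace_neg[OF V(2), of h] by simp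

lemma norm_K_le: "\<theta> \<in> \<Theta> \<Longrightarrow> norm h \<le> a \<Longrightarrow> norm (K \<theta> h) \<le> D * a"
  using norm_blinfun[of "K \<theta>" h] K_le D by (meson mult_mono norm_ge_zero order_trans)

lemma norm_Kd_le: "norm h \<le> a \<Longrightarrow> norm (Kd h) \<le> D * a"
  using norm_blinfun[of Kd h] Kd_le D by (meson mult_mono norm_ge_zero order_trans)

lemma D_pow: "1 \<le> D ^ k" "i \<le> j \<Longrightarrow> D ^ i \<le> D ^ j"
  using D by (auto intro: power_increasing)

lemma remainder_le:
  assumes \<theta>: "\<theta> \<in> \<Theta>" and t: "\<bar>\<theta> - \<theta>0\<bar> \<le> \<rho>" and u: "norm (f - f0) \<le> \<rho>" and \<rho>: "\<rho> \<le> 1"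
  shows "norm (K \<theta> f - K \<theta>0 f - (\<theta> - \<theta>0) *\<^sub>R Kd f) \<le> 2 * D\<^sup>2 * (\<theta> - \<theta>0)\<^sup>2"
    and "norm (K \<theta> f - K \<theta>0 f) \<le> 2 * D\<^sup>2 * \<bar>\<theta> - \<theta>0\<bar>"
    and "norm (K \<theta> f - K \<theta>0 f - (\<theta> - \<theta>0) *\<^sub>R Kd f0) \<le> 3 * D\<^sup>2 * \<bar>\<theta> - \<theta>0\<bar> * \<rho>"
proof -
  define t where "t = \<theta> - \<theta>0"
  have \<rho>0: "0 \<le> \<rho>" using t by linarith
  have nf: "norm f \<le> 2 * D" using norm_triangle_ineq[of f0 "f - f0"] f0_le u \<rho> D by simp
  have "norm (K \<theta> f - K \<theta>0 f - t *\<^sub>R Kd f) \<le> D * t\<^sup>2 * norm f" using K_quad[OF \<theta>] by (simp add: t_def)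
  also have "\<dots> \<le> D * t\<^sup>2 * (2 * D)" using nf D by (intro mult_left_mono) auto
  finally have R: "norm (K \<theta> f - K \<theta>0 f - t *\<^sub>R Kd f) \<le> 2 * D\<^sup>2 * t\<^sup>2" by (simp add: power2_eq_square mult_ac)
  then show "norm (K \<theta> f - K \<theta>0 f - (\<theta> - \<theta>0) *\<^sub>R Kd f) \<le> 2 * D\<^sup>2 * (\<theta> - \<theta>0)\<^sup>2" by (simp add: t_def)
  have "norm (K \<theta> f - K \<theta>0 f) \<le> D * \<bar>t\<bar> * norm f" using K_lip[OF \<theta>] by (simp add: t_def)
  also have "\<dots> \<le> D * \<bar>t\<bar> * (2 * D)" using nf D by (intro mult_left_mono) auto
  finally show "norm (K \<theta> f - K \<theta>0 f) \<le> 2 * D\<^sup>2 * \<bar>\<theta> - \<theta>0\<bar>" by (simp add: t_def power2_eq_square mult_ac)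
  have "K \<theta> f - K \<theta>0 f - t *\<^sub>R Kd f0 = (K \<theta> f - K \<theta>0 f - t *\<^sub>R Kd f) + t *\<^sub>R Kd (f - f0)"
    by (simp add: blinfun.diff_right algebra_simps)
  then have "norm (K \<theta> f - K \<theta>0 f - t *\<^sub>R Kd f0) \<le> norm (K \<theta> f - K \<theta>0 f - t *\<^sub>R Kd f) + norm (t *\<^sub>R Kd (f - f0))"
    by (simp only: norm_triangle_ineq)
  also have "\<dots> \<le> 2 * D\<^sup>2 * t\<^sup>2 + \<bar>t\<bar> * norm (Kd (f - f0))" using R by simp
  also have "\<dots> \<le> 2 * D\<^sup>2 * (\<bar>t\<bar> * \<rho>) + \<bar>t\<bar> * (D * \<rho>)"
  proof (intro add_mono mult_left_mono norm_Kd_le u)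
    have "t\<^sup>2 = \<bar>t\<bar> * \<bar>t\<bar>" by (simp add: power2_eq_square)
    also have "\<dots> \<le> \<bar>t\<bar> * \<rho>" using t by (intro mult_left_mono) (auto simp: t_def)
    finally show "t\<^sup>2 \<le> \<bar>t\<bar> * \<rho>" .
  qed auto
  also have "\<dots> \<le> 2 * D\<^sup>2 * (\<bar>t\<bar> * \<rho>) + \<bar>t\<bar> * (D\<^sup>2 * \<rho>)"
    using D_pow(2)[of 1 2] \<rho>0 by (intro add_left_mono mult_left_mono mult_right_mono) auto
  finally show "norm (K \<theta> f - K \<theta>0 f - (\<theta> - \<theta>0) *\<^sub>R Kd f0) \<le> 3 * D\<^sup>2 * \<bar>\<theta> - \<theta>0\<bar> * \<rho>"
    by (simp add: t_def algebra_simps)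
qed

text \<open>A second-order expansion in \<theta> at fixed f. The noise is paired with the fixed
  direction \<open>Kd f0\<close>, but the drift keeps \<open>Kd f\<close>: replacing it by
  \<open>Kd f0\<close> would cost a term of order \<open>sqrt n |\<U> \<theta>| \<rho>^2\<close>,
  which need not be small. With \<open>Kd f\<close> the drift is the quantity that the bias
  condition compares with \<open>\<D> f\<close>.\<close>

lemma ell_expansion:
  assumes \<theta>: "\<theta> \<in> \<Theta>" and t: "\<bar>\<theta> - \<theta>0\<bar> \<le> \<rho>" and u: "norm (f - f0) \<le> \<rho>" and \<rho>: "\<rho> \<le> 1"
    and in_V: "K \<theta> f \<in> V2" "K \<theta>0 f \<in> V2"
    and W: "\<bar>W2 (K \<theta> f - K \<theta>0 f - (\<theta> - \<theta>0) *\<^sub>R Kd f0)\<bar> \<le> 2 * D * \<bar>\<theta> - \<theta>0\<bar> * \<rho>"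
  shows "\<bar>ell \<theta> f - ell \<theta>0 f - (\<U> \<theta> * \<zeta> - \<U> \<theta> * (sqrt (real n) * (K \<theta>0 (f - f0) \<bullet> Kd f)) - (\<U> \<theta>)\<^sup>2 / 2 * k2)\<bar>
     \<le> 2 * D * \<bar>\<U> \<theta>\<bar> * \<rho> + 7 * D ^ 4 * \<rho> * (\<U> \<theta>)\<^sup>2"
proof -
  define t where "t = \<theta> - \<theta>0"
  define v where "v = K \<theta> f - K \<theta>0 f"
  define a where "a = K \<theta>0 (f - f0)"
  define R where "R = v - t *\<^sub>R Kd f"
  have \<rho>0: "0 \<le> \<rho>" using t by linarith
  have U: "\<U> \<theta> = sqrt (real n) * t" "(\<U> \<theta>)\<^sup>2 = real n * t\<^sup>2"
    using n by (simp_all add: \<U>_def t_def power_mult_distrib)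
  have W2v: "W2 (K \<theta> f) - W2 (K \<theta>0 f) = t * \<zeta> + W2 (v - t *\<^sub>R Kd f0)"
    using in_V f0_V V(2) by (simp add: v_def \<zeta>_def W2_diff W2_lin(2) subspace_diff subspace_scale)
  have nv: "norm (a + v) ^ 2 = (norm a)\<^sup>2 + 2 * t * (a \<bullet> Kd f) + 2 * (a \<bullet> R) + (norm v)\<^sup>2"
  proof -
    have "a \<bullet> v = t * (a \<bullet> Kd f) + a \<bullet> R" by (simp add: R_def inner_diff_right)
    then show ?thesis unfolding power2_norm_eq_inner by (simp add: inner_add_left inner_add_right inner_commute)
  qed
  have diff: "ell \<theta> f - ell \<theta>0 f - (\<U> \<theta> * \<zeta> - \<U> \<theta> * (sqrt (real n) * (K \<theta>0 (f - f0) \<bullet> Kd f)) - (\<U> \<theta>)\<^sup>2 / 2 * k2)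
    = sqrt (real n) * W2 (v - t *\<^sub>R Kd f0) - real n * (a \<bullet> R) - real n / 2 * ((norm v)\<^sup>2 - t\<^sup>2 * k2)"
  proof -
    have "K \<theta> f - K \<theta>0 f0 = a + v" "K \<theta>0 f - K \<theta>0 f0 = a" by (simp_all add: a_def v_def blinfun.diff_right)
    then have "ell \<theta> f - ell \<theta>0 f = sqrt (real n) * (W2 (K \<theta> f) - W2 (K \<theta>0 f)) - real n / 2 * ((norm (a + v))\<^sup>2 - (norm a)\<^sup>2)"
      by (simp add: ell_def algebra_simps)
    also have "\<dots> = sqrt (real n) * (t * \<zeta> + W2 (v - t *\<^sub>R Kd f0)) - real n / 2 * (2 * t * (a \<bullet> Kd f) + 2 * (a \<bullet> R) + (norm v)\<^sup>2)"
      unfolding W2v nv by simp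
    finally have ell: "ell \<theta> f - ell \<theta>0 f = \<dots>" .
    have cross: "\<U> \<theta> * (sqrt (real n) * (a \<bullet> Kd f)) = real n * t * (a \<bullet> Kd f)"
    proof -
      have "\<U> \<theta> * (sqrt (real n) * (a \<bullet> Kd f)) = (sqrt (real n) * sqrt (real n)) * (t * (a \<bullet> Kd f))"
        unfolding U(1) by (simp only: mult_ac)
      then show ?thesis by (simp only: sqrt_n(2) mult.assoc)
    qed
    show ?thesis unfolding a_def[symmetric] cross U(2) ell unfolding U(1) by (simp add: field_simps)
  qed
  have e1: "\<bar>sqrt (real n) * W2 (v - t *\<^sub>R Kd f0)\<bar> \<le> 2 * D * \<bar>\<U> \<theta>\<bar> * \<rho>"
  proof -
    have "\<bar>sqrt (real n) * W2 (v - t *\<^sub>R Kd f0)\<bar> \<le> sqrt (real n) * (2 * D * \<bar>t\<bar> * \<rho>)"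
      using W by (simp add: abs_mult v_def t_def mult_left_mono)
    then show ?thesis by (simp add: U abs_mult mult_ac)
  qed
  have a_le: "norm a \<le> D * \<rho>" unfolding a_def by (intro norm_K_le \<theta>0 u)
  have e2: "\<bar>real n * (a \<bullet> R)\<bar> \<le> 2 * D ^ 3 * \<rho> * (\<U> \<theta>)\<^sup>2"
  proof -
    have "\<bar>a \<bullet> R\<bar> \<le> (D * \<rho>) * (2 * D\<^sup>2 * t\<^sup>2)"
      using remainder_le(1)[OF \<theta> t u \<rho>] by (intro abs_inner_le a_le) (simp add: R_def v_def t_def)
    then have "real n * \<bar>a \<bullet> R\<bar> \<le> real n * ((D * \<rho>) * (2 * D\<^sup>2 * t\<^sup>2))" by (intro mult_left_mono) auto
    then show ?thesis by (simp add: U abs_mult power2_eq_square power3_eq_cube mult_ac)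
  qed
  have e3: "\<bar>real n / 2 * ((norm v)\<^sup>2 - t\<^sup>2 * k2)\<bar> \<le> 9 / 2 * D ^ 4 * \<rho> * (\<U> \<theta>)\<^sup>2"
  proof -
    have "norm (t *\<^sub>R Kd f0) \<le> D\<^sup>2 * \<bar>t\<bar>"
      using mult_left_mono[OF norm_Kd_le[OF f0_le], of "\<bar>t\<bar>"] by (simp add: power2_eq_square mult_ac)
    then have "\<bar>(norm v)\<^sup>2 - (norm (t *\<^sub>R Kd f0))\<^sup>2\<bar> \<le> (3 * D\<^sup>2 * \<bar>t\<bar> * \<rho>) * (2 * D\<^sup>2 * \<bar>t\<bar> + D\<^sup>2 * \<bar>t\<bar>)"
      using remainder_le(2,3)[OF \<theta> t u \<rho>] by (intro abs_norm_sq_diff_le) (auto simp: v_def t_def)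
    also have "\<dots> = 9 * D ^ 4 * \<rho> * t\<^sup>2" by (simp add: power2_eq_square power4_eq_xxxx algebra_simps flip: abs_mult)
    finally have "\<bar>(norm v)\<^sup>2 - t\<^sup>2 * k2\<bar> \<le> 9 * D ^ 4 * \<rho> * t\<^sup>2" by (simp add: k2_def power_mult_distrib)
    then have "real n / 2 * \<bar>(norm v)\<^sup>2 - t\<^sup>2 * k2\<bar> \<le> real n / 2 * (9 * D ^ 4 * \<rho> * t\<^sup>2)" by (intro mult_left_mono) auto
    then show ?thesis by (simp add: U(2) abs_mult mult_ac)
  qed
  have "2 * D ^ 3 * \<rho> * (\<U> \<theta>)\<^sup>2 \<le> 2 * D ^ 4 * \<rho> * (\<U> \<theta>)\<^sup>2"
    using D_pow(2)[of 3 4] \<rho>0 by (intro mult_right_mono mult_left_mono) auto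
  moreover have "0 \<le> D ^ 4 * \<rho> * (\<U> \<theta>)\<^sup>2" using \<rho>0 D by simp
  ultimately show ?thesis unfolding diff using e1 e2 e3 by linarith
qed

text \<open>An exact identity, since at fixed \<theta> the function \<open>ell\<close> is a linear
  noise term plus a quadratic in f.\<close>

lemma ell_shift:
  assumes "f \<in> V1" "K \<theta> f \<in> V2" "K \<theta> w \<in> V2" and \<delta>: "\<delta> = s / sqrt (real n)"
  shows "ell \<theta> (f - \<delta> *\<^sub>R w) - ell \<theta> f = - s * (W1 w + W2 (K \<theta> w))
    + s * (sqrt (real n) * ((f - f0) \<bullet> w + (K \<theta> f - K \<theta>0 f0) \<bullet> K \<theta> w)) - s\<^sup>2 / 2 * ((norm w)\<^sup>2 + (norm (K \<theta> w))\<^sup>2)"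
proof -
  have s: "s = sqrt (real n) * \<delta>" using \<delta> sqrt_n(1) by simp
  have W: "W1 (f - \<delta> *\<^sub>R w) = W1 f - \<delta> * W1 w" "W2 (K \<theta> f - \<delta> *\<^sub>R K \<theta> w) = W2 (K \<theta> f) - \<delta> * W2 (K \<theta> w)"
    using assms w_V V by (simp_all add: W1_diff W2_diff W1_lin W2_lin subspace_scale)
  have nrm: "(norm (b - \<delta> *\<^sub>R y))\<^sup>2 = (norm b)\<^sup>2 - 2 * \<delta> * (b \<bullet> y) + \<delta>\<^sup>2 * (norm y)\<^sup>2" for b y :: 'h
    unfolding power2_norm_eq_inner by (simp add: inner_diff_left inner_diff_right inner_commute power2_eq_square)
  have 1: "f - \<delta> *\<^sub>R w - f0 = (f - f0) - \<delta> *\<^sub>R w" "K \<theta> (f - \<delta> *\<^sub>R w) - K \<theta>0 f0 = (K \<theta> f - K \<theta>0 f0) - \<delta> *\<^sub>R K \<theta> w"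
      "K \<theta> (f - \<delta> *\<^sub>R w) = K \<theta> f - \<delta> *\<^sub>R K \<theta> w"
    by (simp_all add: blinfun.diff_right blinfun.scaleR_right)
  have "ell \<theta> (f - \<delta> *\<^sub>R w) - ell \<theta> f = - sqrt (real n) * \<delta> * (W1 w + W2 (K \<theta> w))
    + real n * \<delta> * ((f - f0) \<bullet> w + (K \<theta> f - K \<theta>0 f0) \<bullet> K \<theta> w) - real n * \<delta>\<^sup>2 / 2 * ((norm w)\<^sup>2 + (norm (K \<theta> w))\<^sup>2)"
    unfolding ell_def 1(1,2) nrm unfolding 1(3) W
    by (simp add: algebra_simps add_divide_distrib)
  also have "real n * \<delta> = s * sqrt (real n)" unfolding s using sqrt_n(2) by (metis mult.assoc mult.commute)
  also have "real n * \<delta>\<^sup>2 = s\<^sup>2" unfolding s using n by (simp add: power_mult_distrib)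
  also have "- sqrt (real n) * \<delta> = - s" by (simp add: s)
  finally show ?thesis by (simp only: mult.assoc)
qed

text \<open>The mean \<open>K \<theta> f - K \<theta>0 f0\<close> is about
  \<open>K \<theta>0 (f - f0) + (\<theta> - \<theta>0) Kd f0\<close>. Paired with
  \<open>K \<theta>0 \<gamma>\<close>, the second part turns the score \<open>\<D> f\<close> into
  \<open>\<D> f + c1 \<U> \<theta>\<close>. The constant \<open>4 D^4\<close> collects the noise and
  the quadratic term of the shift.\<close>

lemma step_fixed_parameter:
  assumes g: "good \<theta> f" "good_dir \<theta>" and t: "\<bar>\<theta> - \<theta>0\<bar> \<le> \<tau>" and u: "norm (f - f0) \<le> \<tau>" and \<tau>1: "\<tau> \<le> 1"
    and s: "\<bar>s\<bar> = 1"
  shows "ell \<theta> (f - (s / sqrt (real n)) *\<^sub>R w) - ell \<theta> f \<ge> s * (\<D> f + c1 * \<U> \<theta>) - (4 * D ^ 4 + 6 * D ^ 4 * \<tau> * \<bar>\<U> \<theta>\<bar>)"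
proof -
  have \<theta>: "\<theta> \<in> \<Theta>" and V': "f \<in> V1" "K \<theta> f \<in> V2" "K \<theta> w \<in> V2" using g by (auto simp: good_def good_dir_def)
  define t where "t = \<theta> - \<theta>0"
  define v where "v = K \<theta> f - K \<theta>0 f"
  define a where "a = K \<theta>0 (f - f0)"
  define b where "b = K \<theta> w - K \<theta>0 w"
  have tt: "\<bar>t\<bar> \<le> \<tau>" using t by (simp add: t_def)
  have s2: "s\<^sup>2 = 1" using s by (metis abs_power2 power_abs one_power2)
  have Kw: "norm (K \<theta> w) \<le> D\<^sup>2" "norm (K \<theta>0 w) \<le> D\<^sup>2"
    using norm_K_le[OF \<theta> w_le] norm_K_le[OF \<theta>0 w_le] by (simp_all add: power2_eq_square)
  have nb: "norm b \<le> D\<^sup>2 * \<bar>t\<bar>"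
  proof -
    have "norm b \<le> D * \<bar>t\<bar> * norm w" using K_lip[OF \<theta>] by (simp add: b_def t_def)
    also have "\<dots> \<le> D * \<bar>t\<bar> * D" using w_le D by (intro mult_left_mono) auto
    finally show ?thesis by (simp add: power2_eq_square mult_ac)
  qed
  have na: "norm a \<le> D * \<tau>" unfolding a_def by (intro norm_K_le \<theta>0 u)
  have nd: "norm (v - t *\<^sub>R Kd f0) \<le> 3 * D\<^sup>2 * \<bar>t\<bar> * \<tau>"
    using remainder_le(3)[OF \<theta> t u \<tau>1] by (simp add: v_def t_def)
  have nK: "norm (Kd f0) \<le> D\<^sup>2" using norm_Kd_le[OF f0_le] by (simp add: power2_eq_square)
  have nc: "norm (b + K \<theta>0 (w - \<gamma>)) \<le> 2 * D\<^sup>2 * \<tau>"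
  proof -
    have "norm (b + K \<theta>0 (w - \<gamma>)) \<le> D\<^sup>2 * \<bar>t\<bar> + D * \<tau>"
      using norm_triangle_ineq[of b "K \<theta>0 (w - \<gamma>)"] nb norm_K_le[OF \<theta>0 w_close] by linarith
    also have "\<dots> \<le> D\<^sup>2 * \<tau> + D\<^sup>2 * \<tau>"
      using tt \<tau> D D_pow(2)[of 1 2] by (intro add_mono mult_left_mono mult_right_mono) auto
    finally show ?thesis by (simp add: mult_ac)
  qed
  \<comment> \<open>The errors are those of replacing \<open>K \<theta> w\<close> by
    \<open>K \<theta>0 w\<close> against a, of linearising in \<theta>, and of replacing
    \<open>K \<theta> w\<close> by \<open>K \<theta>0 \<gamma>\<close> in the linear part. They
    contribute 1, 3 and 2 times \<open>D^4 \<tau> |t|\<close>.\<close>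
  have cross: "\<bar>(K \<theta> f - K \<theta>0 f0) \<bullet> K \<theta> w - a \<bullet> K \<theta>0 w - t * c1\<bar> \<le> 6 * D ^ 4 * \<tau> * \<bar>t\<bar>"
  proof -
    have *: "K \<theta> f - K \<theta>0 f0 = a + v" "K \<theta> w = K \<theta>0 w + b"
      by (simp_all add: a_def v_def b_def blinfun.diff_right)
    have "(K \<theta> f - K \<theta>0 f0) \<bullet> K \<theta> w - a \<bullet> K \<theta>0 w - t * c1
       = a \<bullet> b + (v - t *\<^sub>R Kd f0) \<bullet> K \<theta> w + t * (Kd f0 \<bullet> (b + K \<theta>0 (w - \<gamma>)))"
      unfolding * c1_def inner_commute[of "K \<theta>0 \<gamma>"]
      by (simp add: blinfun.diff_right inner_diff_left inner_diff_right inner_add_left inner_add_right algebra_simps)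
    moreover have "\<bar>a \<bullet> b\<bar> \<le> D ^ 4 * \<tau> * \<bar>t\<bar>"
    proof -
      have "\<bar>a \<bullet> b\<bar> \<le> (D * \<tau>) * (D\<^sup>2 * \<bar>t\<bar>)" by (intro abs_inner_le na nb)
      also have "\<dots> = D ^ 3 * (\<tau> * \<bar>t\<bar>)" by (simp add: power2_eq_square power3_eq_cube mult_ac)
      also have "\<dots> \<le> D ^ 4 * (\<tau> * \<bar>t\<bar>)" using D_pow(2)[of 3 4] \<tau> by (intro mult_right_mono) auto
      finally show ?thesis by (simp add: mult_ac)
    qed
    moreover have "\<bar>(v - t *\<^sub>R Kd f0) \<bullet> K \<theta> w\<bar> \<le> 3 * (D ^ 4 * \<tau> * \<bar>t\<bar>)"
      using abs_inner_le[OF nd Kw(1)] by (simp add: power2_eq_square power4_eq_xxxx mult_ac)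
    moreover have "\<bar>t * (Kd f0 \<bullet> (b + K \<theta>0 (w - \<gamma>)))\<bar> \<le> 2 * (D ^ 4 * \<tau> * \<bar>t\<bar>)"
      using mult_left_mono[OF abs_inner_le[OF nK nc], of "\<bar>t\<bar>"]
      by (simp add: abs_mult power2_eq_square power4_eq_xxxx mult_ac)
    ultimately show ?thesis by linarith
  qed
  define X where "X = sqrt (real n) * ((f - f0) \<bullet> w + (K \<theta> f - K \<theta>0 f0) \<bullet> K \<theta> w) - (\<D> f + c1 * \<U> \<theta>)"
  have "X = sqrt (real n) * ((K \<theta> f - K \<theta>0 f0) \<bullet> K \<theta> w - a \<bullet> K \<theta>0 w - t * c1)"
    by (simp add: X_def \<D>_def \<U>_def a_def t_def algebra_simps)
  then have "\<bar>X\<bar> \<le> sqrt (real n) * (6 * D ^ 4 * \<tau> * \<bar>t\<bar>)"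
    using cross by (simp add: abs_mult mult_left_mono)
  then have X: "\<bar>X\<bar> \<le> 6 * D ^ 4 * \<tau> * \<bar>\<U> \<theta>\<bar>" by (simp add: \<U>_def t_def abs_mult mult_ac)
  have W: "\<bar>W1 w + W2 (K \<theta> w)\<bar> \<le> 3 * D ^ 4"
  proof -
    have "W2 (K \<theta> w) = W2 (K \<theta>0 w) + W2 (K \<theta> w - K \<theta>0 w)" using V' w_V by (simp add: W2_diff)
    moreover have "\<bar>W2 (K \<theta> w - K \<theta>0 w)\<bar> \<le> D * 1"
    proof -
      have "\<bar>W2 (K \<theta> w - K \<theta>0 w)\<bar> \<le> D * \<bar>t\<bar>" using g(2) by (simp add: good_dir_def t_def)
      also have "\<dots> \<le> D * 1" using tt \<tau>1 D by (intro mult_left_mono) auto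
      finally show ?thesis .
    qed
    ultimately have "\<bar>W1 w + W2 (K \<theta> w)\<bar> \<le> 3 * D" using W_\<gamma> W_w \<tau>1 D by linarith
    also have "\<dots> \<le> 3 * D ^ 4" using D_pow(2)[of 1 4] by simp
    finally show ?thesis .
  qed
  have sq: "s\<^sup>2 / 2 * ((norm w)\<^sup>2 + (norm (K \<theta> w))\<^sup>2) \<le> D ^ 4"
  proof -
    have "(norm w)\<^sup>2 \<le> D\<^sup>2" "(norm (K \<theta> w))\<^sup>2 \<le> (D\<^sup>2)\<^sup>2"
      by (rule power_mono[OF w_le norm_ge_zero], rule power_mono[OF Kw(1) norm_ge_zero])
    moreover have "D\<^sup>2 \<le> D ^ 4" by (rule D_pow(2)) simp
    ultimately show ?thesis using s2 by (simp flip: power_mult)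
  qed
  have sX: "\<bar>s * X\<bar> \<le> 6 * D ^ 4 * \<tau> * \<bar>\<U> \<theta>\<bar>" "\<bar>s * (W1 w + W2 (K \<theta> w))\<bar> \<le> 3 * D ^ 4"
    using X W s by (simp_all add: abs_mult)
  have "s * (sqrt (real n) * ((f - f0) \<bullet> w + (K \<theta> f - K \<theta>0 f0) \<bullet> K \<theta> w)) = s * (\<D> f + c1 * \<U> \<theta>) + s * X"
    by (simp add: X_def algebra_simps)
  with ell_shift[OF V', OF refl, of s] sX sq show ?thesis by linarith
qed

text \<open>If the score is at most \<open>r |\<U> \<theta>|\<close>, the drift is about
  \<open>- c1 \<U> \<theta>\<close>, so moving \<theta> towards \<theta>0 by the fraction l gains
  \<open>l (k2 - c1)\<close> times the square of \<open>\<U> \<theta>\<close> to first order in l.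
  The loss \<open>l^2 k2 / 2\<close> is the curvature, and \<open>l r\<close> is the price of a
  score that is small but not zero. Both expansions are made around the same
  \<open>ell \<theta>0 f\<close>, which cancels.\<close>

lemma step_fixed_function:
  assumes g: "good \<theta> f" "good \<theta>' f" and t: "\<bar>\<theta> - \<theta>0\<bar> \<le> \<tau>" and u: "norm (f - f0) \<le> \<tau>" and \<tau>1: "\<tau> \<le> 1"
    and \<theta>': "\<theta>' - \<theta>0 = (1 - l) * (\<theta> - \<theta>0)" and l: "0 \<le> l" "l \<le> 1"
    and bias: "\<bar>sqrt (real n) * (K \<theta>0 (f - f0) \<bullet> Kd f) - \<D> f\<bar> \<le> \<tau>"
    and score: "\<bar>\<D> f + c1 * \<U> \<theta>\<bar> \<le> r * \<bar>\<U> \<theta>\<bar>"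
  shows "ell \<theta>' f - ell \<theta> f \<ge> (\<U> \<theta>)\<^sup>2 * (l * (k2 - c1) - l\<^sup>2 * k2 / 2 - l * r - 14 * D ^ 4 * \<tau>) - 6 * D * \<bar>\<U> \<theta>\<bar>"
proof -
  define U where "U = \<U> \<theta>"
  define q where "q = sqrt (real n) * (K \<theta>0 (f - f0) \<bullet> Kd f)"
  have U': "\<U> \<theta>' = (1 - l) * U" unfolding \<U>_def U_def \<theta>' by simp
  have abs_t': "\<bar>\<theta>' - \<theta>0\<bar> \<le> \<bar>\<theta> - \<theta>0\<bar>" "\<bar>(1 - l) * U\<bar> \<le> \<bar>U\<bar>"
    unfolding \<theta>' abs_mult using l by (auto intro: mult_left_le_one_le)
  have W: "\<bar>W2 (K \<eta> f - K \<theta>0 f - (\<eta> - \<theta>0) *\<^sub>R Kd f0)\<bar> \<le> 2 * D * \<bar>\<eta> - \<theta>0\<bar> * \<tau>"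
    if "good \<eta> f" "\<bar>\<eta> - \<theta>0\<bar> \<le> \<tau>" for \<eta>
  proof -
    have "\<bar>W2 (K \<eta> f - K \<theta>0 f - (\<eta> - \<theta>0) *\<^sub>R Kd f0)\<bar> \<le> D * \<bar>\<eta> - \<theta>0\<bar> * (norm (f - f0) + \<bar>\<eta> - \<theta>0\<bar>)"
      using that(1) by (simp add: good_def)
    also have "\<dots> \<le> D * \<bar>\<eta> - \<theta>0\<bar> * (2 * \<tau>)" using that(2) u D by (intro mult_left_mono) auto
    finally show ?thesis by (simp add: mult_ac)
  qed
  have bd: "2 * D * \<bar>V\<bar> * \<tau> + 7 * D ^ 4 * \<tau> * V\<^sup>2 \<le> 2 * D * \<bar>U\<bar> + 7 * D ^ 4 * \<tau> * U\<^sup>2" if "\<bar>V\<bar> \<le> \<bar>U\<bar>" for V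
  proof -
    have "V\<^sup>2 \<le> U\<^sup>2" using that by (simp add: abs_le_square_iff)
    moreover have "\<bar>V\<bar> * \<tau> \<le> \<bar>U\<bar> * 1" using that \<tau> \<tau>1 by (intro mult_mono) auto
    ultimately have "2 * D * (\<bar>V\<bar> * \<tau>) + 7 * D ^ 4 * \<tau> * V\<^sup>2 \<le> 2 * D * (\<bar>U\<bar> * 1) + 7 * D ^ 4 * \<tau> * U\<^sup>2"
      using D \<tau> by (intro add_mono mult_left_mono) auto
    then show ?thesis by (simp add: mult_ac)
  qed
  have e1: "\<bar>ell \<theta> f - ell \<theta>0 f - (U * \<zeta> - U * q - U\<^sup>2 / 2 * k2)\<bar> \<le> 2 * D * \<bar>U\<bar> + 7 * D ^ 4 * \<tau> * U\<^sup>2"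
    using ell_expansion[OF _ t u \<tau>1 _ _ W[OF g(1) t]] g(1) bd[of U] unfolding U_def q_def good_def by linarith
  have t': "\<bar>\<theta>' - \<theta>0\<bar> \<le> \<tau>" using abs_t' t by linarith
  have e2: "\<bar>ell \<theta>' f - ell \<theta>0 f - ((1 - l) * U * \<zeta> - (1 - l) * U * q - ((1 - l) * U)\<^sup>2 / 2 * k2)\<bar> \<le> 2 * D * \<bar>U\<bar> + 7 * D ^ 4 * \<tau> * U\<^sup>2"
    using ell_expansion[OF _ t' u \<tau>1 _ _ W[OF g(2) t']] g(2) bd[OF abs_t'(2)] unfolding U' q_def good_def by linarith
  have "ell \<theta>' f - ell \<theta> f \<ge> (- l * U * \<zeta> + l * U * q + (U\<^sup>2 - ((1 - l) * U)\<^sup>2) / 2 * k2) - (4 * D * \<bar>U\<bar> + 14 * D ^ 4 * \<tau> * U\<^sup>2)"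
    using e1 e2 by (simp add: algebra_simps diff_divide_distrib)
  moreover have "(U\<^sup>2 - ((1 - l) * U)\<^sup>2) / 2 * k2 = U\<^sup>2 * (l * k2 - l\<^sup>2 * k2 / 2)"
    by (simp add: power2_eq_square algebra_simps add_divide_distrib diff_divide_distrib)
  moreover have "- l * U * \<zeta> \<ge> - (D * \<bar>U\<bar>)"
  proof -
    have "\<bar>l * U * \<zeta>\<bar> \<le> 1 * \<bar>U\<bar> * D" unfolding abs_mult \<zeta>_def using l W_f0 by (intro mult_mono) auto
    then show ?thesis by (simp add: mult.commute abs_le_iff)
  qed
  moreover have "l * U * q \<ge> - (l * c1 * U\<^sup>2) - l * r * U\<^sup>2 - D * \<bar>U\<bar>"
  proof -
    have "\<bar>q + c1 * U\<bar> \<le> r * \<bar>U\<bar> + \<tau>" using bias score by (simp add: q_def U_def)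
    then have "\<bar>l * U * (q + c1 * U)\<bar> \<le> \<bar>l\<bar> * \<bar>U\<bar> * (r * \<bar>U\<bar> + \<tau>)"
      unfolding abs_mult by (intro mult_left_mono) auto
    also have "\<dots> = l * r * U\<^sup>2 + l * \<tau> * \<bar>U\<bar>" using l by (simp add: power2_eq_square algebra_simps flip: abs_mult)
    also have "l * \<tau> * \<bar>U\<bar> \<le> 1 * D * \<bar>U\<bar>" using l \<tau> \<tau>1 D by (intro mult_mono) auto
    finally show ?thesis by (simp add: power2_eq_square algebra_simps abs_le_iff)
  qed
  ultimately show ?thesis unfolding U_def[symmetric] by (simp add: algebra_simps)
qed

text \<open>The path leads from \<theta> to \<theta>0 at f, then from f to f' at \<theta>0, then
  from \<theta>0 to \<theta>' at f'. In the last piece the drift is about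
  \<open>\<D> f - s c1\<close>, so \<open>\<D> f\<close> enters the three pieces with the factors V,
  s and \<open>- (V + s)\<close> and cancels. The terms in \<open>c1\<close> that are left over
  lower the information from \<open>k2\<close> to \<open>k2 - c1\<close>.\<close>

lemma step_exchange:
  assumes g: "good \<theta> f" "good \<theta>' f" "good_dir \<theta>'" and u: "norm (f - f0) \<le> \<tau>"
    and bias: "\<bar>sqrt (real n) * (K \<theta>0 (f - f0) \<bullet> Kd f) - \<D> f\<bar> \<le> \<tau>"
    and \<theta>': "\<theta>' = \<theta> + s / sqrt (real n)" and U: "\<bar>\<U> \<theta>\<bar> \<le> L" "\<bar>\<U> \<theta>'\<bar> \<le> L" and L: "1 \<le> L"
    and small: "L / sqrt (real n) \<le> \<tau>" "3 * D * \<tau> \<le> 1"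
  shows "\<bar>ell \<theta>' (f - (s / sqrt (real n)) *\<^sub>R w) - ell \<theta> f - (s * (\<zeta> - \<xi>) - (k2 - c1) * (\<U> \<theta> * s + s\<^sup>2 / 2))\<bar> \<le> 60 * D ^ 5 * L\<^sup>2 * \<tau>"
proof -
  define \<delta> where "\<delta> = s / sqrt (real n)"
  define f' where "f' = f - \<delta> *\<^sub>R w"
  define V where "V = \<U> \<theta>"
  have V': "\<U> \<theta>' = V + s" using sqrt_n(1) by (simp add: \<U>_def \<theta>' V_def algebra_simps)
  have sL: "\<bar>s\<bar> \<le> 2 * L" using U V' by (simp add: V_def)
  have t_le: "\<bar>\<eta> - \<theta>0\<bar> \<le> \<tau>" if "\<bar>\<U> \<eta>\<bar> \<le> L" for \<eta>
  proof -
    have "\<bar>\<eta> - \<theta>0\<bar> = \<bar>\<U> \<eta>\<bar> / sqrt (real n)" using sqrt_n(1) by (simp add: \<U>_def abs_mult)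
    also have "\<dots> \<le> L / sqrt (real n)" using that by (intro divide_right_mono) auto
    finally show ?thesis using small(1) by linarith
  qed
  have t: "\<bar>\<theta> - \<theta>0\<bar> \<le> \<tau>" and t': "\<bar>\<theta>' - \<theta>0\<bar> \<le> \<tau>" using t_le U by auto
  have \<delta>_le: "\<bar>\<delta>\<bar> \<le> 2 * \<tau>" using t t' by (simp add: \<theta>' \<delta>_def)
  \<comment> \<open>A bound for the distance of f' from \<open>f0\<close>, which is at most
    \<open>\<tau> + 2 \<tau> D\<close> because \<open>|\<delta>| \<le> 2 \<tau>\<close> and
    \<open>norm w \<le> D\<close>.\<close>
  define \<rho> where "\<rho> = 3 * D * \<tau>"
  have \<rho>: "\<tau> \<le> \<rho>" "\<rho> \<le> 1" "0 \<le> \<rho>" "2 * \<tau> \<le> \<rho>"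
    using small(2) \<tau> D mult_right_mono[of 1 D "3 * \<tau>"] by (auto simp: \<rho>_def)
  have u': "norm (f' - f0) \<le> \<rho>"
  proof -
    have "norm (f' - f0) \<le> norm (f - f0) + norm (\<delta> *\<^sub>R w)"
      using norm_triangle_ineq4[of "f - f0" "\<delta> *\<^sub>R w"] by (simp add: f'_def algebra_simps)
    also have "\<dots> \<le> \<tau> + 2 * \<tau> * D" using u \<delta>_le w_le \<tau> by (simp add: mult_mono add_mono)
    also have "\<dots> \<le> \<tau> * D + 2 * \<tau> * D" using \<tau> D mult_left_mono[of 1 D \<tau>] by (simp add: mult.commute)
    finally show ?thesis by (simp add: \<rho>_def mult_ac)
  qed
  have gV: "f \<in> V1" "K \<theta>0 f \<in> V2" "K \<theta> f \<in> V2" "K \<theta>' f \<in> V2" "K \<theta>' w \<in> V2" "\<theta> \<in> \<Theta>" "\<theta>' \<in> \<Theta>"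
    using g by (auto simp: good_def good_dir_def)
  have Kf': "K \<eta> f' = K \<eta> f - \<delta> *\<^sub>R K \<eta> w" for \<eta> by (simp add: f'_def blinfun.diff_right blinfun.scaleR_right)
  have V2': "K \<theta>' f' \<in> V2" "K \<theta>0 f' \<in> V2" unfolding Kf' using gV w_V V by (auto intro!: subspace_diff subspace_scale)
  have W': "\<bar>W2 (K \<theta>' f' - K \<theta>0 f' - (\<theta>' - \<theta>0) *\<^sub>R Kd f0)\<bar> \<le> 2 * D * \<bar>\<theta>' - \<theta>0\<bar> * \<rho>"
  proof -
    have "K \<theta>' f' - K \<theta>0 f' - (\<theta>' - \<theta>0) *\<^sub>R Kd f0 = (K \<theta>' f - K \<theta>0 f - (\<theta>' - \<theta>0) *\<^sub>R Kd f0) - \<delta> *\<^sub>R (K \<theta>' w - K \<theta>0 w)"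
      unfolding Kf' by (simp add: algebra_simps)
    then have "W2 (K \<theta>' f' - K \<theta>0 f' - (\<theta>' - \<theta>0) *\<^sub>R Kd f0) = W2 (K \<theta>' f - K \<theta>0 f - (\<theta>' - \<theta>0) *\<^sub>R Kd f0) - \<delta> * W2 (K \<theta>' w - K \<theta>0 w)"
      using gV w_V f0_V V by (simp add: W2_diff W2_lin(2) subspace_diff subspace_scale)
    moreover have "\<bar>W2 (K \<theta>' f - K \<theta>0 f - (\<theta>' - \<theta>0) *\<^sub>R Kd f0)\<bar> \<le> D * \<bar>\<theta>' - \<theta>0\<bar> * \<rho>"
    proof -
      have "\<bar>W2 (K \<theta>' f - K \<theta>0 f - (\<theta>' - \<theta>0) *\<^sub>R Kd f0)\<bar> \<le> D * \<bar>\<theta>' - \<theta>0\<bar> * (norm (f - f0) + \<bar>\<theta>' - \<theta>0\<bar>)"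
        using g(2) by (simp add: good_def)
      also have "\<dots> \<le> D * \<bar>\<theta>' - \<theta>0\<bar> * \<rho>" using u t' \<rho> D by (intro mult_left_mono) auto
      finally show ?thesis .
    qed
    moreover have "\<bar>\<delta> * W2 (K \<theta>' w - K \<theta>0 w)\<bar> \<le> \<rho> * (D * \<bar>\<theta>' - \<theta>0\<bar>)"
      unfolding abs_mult using g(3) \<delta>_le \<rho> by (intro mult_mono) (auto simp: good_dir_def)
    ultimately show ?thesis by (simp add: mult_ac)
  qed
  have W: "\<bar>W2 (K \<theta> f - K \<theta>0 f - (\<theta> - \<theta>0) *\<^sub>R Kd f0)\<bar> \<le> 2 * D * \<bar>\<theta> - \<theta>0\<bar> * \<tau>"
  proof -
    have "\<bar>W2 (K \<theta> f - K \<theta>0 f - (\<theta> - \<theta>0) *\<^sub>R Kd f0)\<bar> \<le> D * \<bar>\<theta> - \<theta>0\<bar> * (norm (f - f0) + \<bar>\<theta> - \<theta>0\<bar>)"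
      using g(1) by (simp add: good_def)
    also have "\<dots> \<le> D * \<bar>\<theta> - \<theta>0\<bar> * (2 * \<tau>)" using u t D by (intro mult_left_mono) auto
    finally show ?thesis by (simp add: mult_ac)
  qed
  define q where "q = sqrt (real n) * (K \<theta>0 (f - f0) \<bullet> Kd f)"
  define q' where "q' = sqrt (real n) * (K \<theta>0 (f' - f0) \<bullet> Kd f')"
  \<comment> \<open>Since D and L are at least 1, P dominates every error
    \<open>D^i L^j \<tau>\<close> with \<open>i \<le> 5\<close> and \<open>j \<le> 2\<close>, so the
    errors below are counted in multiples of P.\<close>
  define P where "P = D ^ 5 * L\<^sup>2 * \<tau>"
  have mono: "D ^ i * L ^ j * \<tau> \<le> P" if "i \<le> 5" "j \<le> 2" for i j
    unfolding P_def using that D L \<tau> by (intro mult_right_mono mult_mono power_increasing) auto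
  have UL: "(\<U> \<theta>)\<^sup>2 \<le> L\<^sup>2" "(\<U> \<theta>')\<^sup>2 \<le> L\<^sup>2" using U L abs_le_square_iff[of _ L] by auto
  have e1: "\<bar>ell \<theta>' f' - ell \<theta>0 f' - ((V + s) * \<zeta> - (V + s) * q' - (V + s)\<^sup>2 / 2 * k2)\<bar> \<le> 27 * P"
  proof -
    have "\<bar>ell \<theta>' f' - ell \<theta>0 f' - ((V + s) * \<zeta> - (V + s) * q' - (V + s)\<^sup>2 / 2 * k2)\<bar>
       \<le> 2 * D * \<bar>\<U> \<theta>'\<bar> * \<rho> + 7 * D ^ 4 * \<rho> * (\<U> \<theta>')\<^sup>2"
      using ell_expansion[OF gV(7) order_trans[OF t' \<rho>(1)] u' \<rho>(2) V2' W'] unfolding V' q'_def by simp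
    also have "\<dots> \<le> 2 * D * L * \<rho> + 7 * D ^ 4 * \<rho> * L\<^sup>2"
      using U UL \<rho> D by (intro add_mono mult_left_mono mult_right_mono) auto
    also have "\<dots> = 6 * (D ^ 2 * L ^ 1 * \<tau>) + 21 * (D ^ 5 * L ^ 2 * \<tau>)"
      by (simp add: \<rho>_def power2_eq_square eval_nat_numeral algebra_simps)
    also have "\<dots> \<le> 6 * P + 21 * P" by (intro add_mono mult_left_mono mono) auto
    finally show ?thesis by simp
  qed
  have e2: "\<bar>ell \<theta> f - ell \<theta>0 f - (V * \<zeta> - V * q - V\<^sup>2 / 2 * k2)\<bar> \<le> 9 * P"
  proof -
    have "\<tau> \<le> 1" using \<rho> by linarith
    then have "\<bar>ell \<theta> f - ell \<theta>0 f - (V * \<zeta> - V * q - V\<^sup>2 / 2 * k2)\<bar>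
       \<le> 2 * D * \<bar>\<U> \<theta>\<bar> * \<tau> + 7 * D ^ 4 * \<tau> * (\<U> \<theta>)\<^sup>2"
      using ell_expansion[OF gV(6) t u _ gV(3,2) W] unfolding V_def q_def by simp
    also have "\<dots> \<le> 2 * D * L * \<tau> + 7 * D ^ 4 * \<tau> * L\<^sup>2"
      using U UL \<tau> D by (intro add_mono mult_left_mono mult_right_mono) auto
    also have "\<dots> = 2 * (D ^ 1 * L ^ 1 * \<tau>) + 7 * (D ^ 4 * L ^ 2 * \<tau>)" by (simp add: algebra_simps)
    also have "\<dots> \<le> 2 * P + 7 * P" by (intro add_mono mult_left_mono mono) auto
    finally show ?thesis by simp
  qed
  define cn where "cn = (norm w)\<^sup>2 + (norm (K \<theta>0 w))\<^sup>2"
  have e3: "ell \<theta>0 f' - ell \<theta>0 f = - s * (W1 w + W2 (K \<theta>0 w)) + s * \<D> f - s\<^sup>2 / 2 * cn"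
    using ell_shift[OF gV(1,2) w_V(2) \<delta>_def] by (simp add: f'_def cn_def \<D>_def blinfun.diff_right)
  \<comment> \<open>Here the normal equation enters: at \<gamma> the quadratic term of the shift
    equals \<open>c1\<close>, the constant that also appears in the drift.\<close>
  have cn: "\<bar>cn - c1\<bar> \<le> 4 * D ^ 3 * \<tau>"
  proof -
    have "\<bar>(norm w)\<^sup>2 - (norm \<gamma>)\<^sup>2\<bar> \<le> 2 * D ^ 3 * \<tau>"
    proof -
      have "\<bar>(norm w)\<^sup>2 - (norm \<gamma>)\<^sup>2\<bar> \<le> \<tau> * (D + D)" by (intro abs_norm_sq_diff_le w_close w_le \<gamma>_le)
      also have "\<dots> = 2 * D * \<tau>" by simp
      also have "\<dots> \<le> 2 * D ^ 3 * \<tau>" using D_pow(2)[of 1 3] \<tau> by (intro mult_right_mono) auto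
      finally show ?thesis .
    qed
    moreover have "\<bar>(norm (K \<theta>0 w))\<^sup>2 - (norm (K \<theta>0 \<gamma>))\<^sup>2\<bar> \<le> 2 * D ^ 3 * \<tau>"
      using abs_norm_sq_diff_le[OF norm_K_le[OF \<theta>0 w_close, unfolded blinfun.diff_right] norm_K_le[OF \<theta>0 w_le] norm_K_le[OF \<theta>0 \<gamma>_le]]
      by (simp add: power3_eq_cube algebra_simps)
    moreover have "cn - c1 = ((norm w)\<^sup>2 - (norm \<gamma>)\<^sup>2) + ((norm (K \<theta>0 w))\<^sup>2 - (norm (K \<theta>0 \<gamma>))\<^sup>2)"
      using \<gamma>_eq by (simp add: cn_def c1_def)
    ultimately show ?thesis by linarith
  qed
  \<comment> \<open>The drift changes through both of its factors,
    \<open>K \<theta>0 (f' - f0)\<close> and \<open>Kd f'\<close>. Only the pairing of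
    \<open>K \<theta>0 w\<close> with \<open>Kd f\<close> contributes at the order of s, namely
    \<open>- s c1\<close>; the rest is small with \<tau>.\<close>
  have q': "\<bar>q' - (\<D> f - s * c1)\<bar> \<le> \<tau> + 2 * L * (6 * D ^ 4 * \<tau>)"
  proof -
    have q'_eq: "q' = q - s * (K \<theta>0 w \<bullet> Kd f) - s * (K \<theta>0 (f - f0) \<bullet> Kd w) + s * (\<delta> * (K \<theta>0 w \<bullet> Kd w))"
    proof -
      have sd: "sqrt (real n) * \<delta> = s" using sqrt_n(1) by (simp add: \<delta>_def)
      have *: "K \<theta>0 (f' - f0) = K \<theta>0 (f - f0) - \<delta> *\<^sub>R K \<theta>0 w" "Kd f' = Kd f - \<delta> *\<^sub>R Kd w"
        by (simp_all add: f'_def blinfun.diff_right blinfun.scaleR_right)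
      have "q' = q - (sqrt (real n) * \<delta>) * (K \<theta>0 w \<bullet> Kd f) - (sqrt (real n) * \<delta>) * (K \<theta>0 (f - f0) \<bullet> Kd w)
          + (sqrt (real n) * \<delta>) * (\<delta> * (K \<theta>0 w \<bullet> Kd w))"
        unfolding q_def q'_def * by (simp add: inner_diff_left inner_diff_right algebra_simps)
      then show ?thesis unfolding sd .
    qed
    define Z where "Z = (K \<theta>0 w \<bullet> Kd f - c1) + (K \<theta>0 (f - f0) \<bullet> Kd w) - \<delta> * (K \<theta>0 w \<bullet> Kd w)"
    have "\<bar>Z\<bar> \<le> 6 * D ^ 4 * \<tau>"
    proof -
      have "K \<theta>0 w \<bullet> Kd f - c1 = K \<theta>0 (w - \<gamma>) \<bullet> Kd f0 + K \<theta>0 w \<bullet> Kd (f - f0)"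
        by (simp add: c1_def blinfun.diff_right inner_diff_left inner_diff_right)
      moreover have "\<bar>K \<theta>0 (w - \<gamma>) \<bullet> Kd f0\<bar> \<le> D ^ 3 * \<tau>"
        using abs_inner_le[OF norm_K_le[OF \<theta>0 w_close] norm_Kd_le[OF f0_le]] by (simp add: power3_eq_cube mult_ac)
      moreover have "\<bar>K \<theta>0 w \<bullet> Kd (f - f0)\<bar> \<le> D ^ 3 * \<tau>"
        using abs_inner_le[OF norm_K_le[OF \<theta>0 w_le] norm_Kd_le[OF u]] by (simp add: power3_eq_cube mult_ac)
      moreover have "\<bar>K \<theta>0 (f - f0) \<bullet> Kd w\<bar> \<le> D ^ 3 * \<tau>"
        using abs_inner_le[OF norm_K_le[OF \<theta>0 u] norm_Kd_le[OF w_le]] by (simp add: power3_eq_cube mult_ac)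
      moreover have "\<bar>\<delta> * (K \<theta>0 w \<bullet> Kd w)\<bar> \<le> 2 * (D ^ 4 * \<tau>)"
      proof -
        have "\<bar>\<delta> * (K \<theta>0 w \<bullet> Kd w)\<bar> \<le> (2 * \<tau>) * ((D * D) * (D * D))"
          unfolding abs_mult using \<delta>_le \<tau> by (intro mult_mono abs_inner_le norm_K_le norm_Kd_le \<theta>0 w_le) auto
        then show ?thesis by (simp add: power4_eq_xxxx mult_ac)
      qed
      moreover have "D ^ 3 * \<tau> \<le> D ^ 4 * \<tau>" using D_pow(2)[of 3 4] \<tau> by (intro mult_right_mono) auto
      moreover have "0 \<le> D ^ 4 * \<tau>" using D \<tau> by simp
      ultimately show ?thesis unfolding Z_def by linarith
    qed
    then have "\<bar>s * Z\<bar> \<le> 2 * L * (6 * D ^ 4 * \<tau>)" unfolding abs_mult using sL L by (intro mult_mono) auto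
    moreover have "q' - (\<D> f - s * c1) = (q - \<D> f) - s * Z"
      unfolding q'_eq Z_def by (simp add: algebra_simps)
    ultimately show ?thesis using bias unfolding q_def by linarith
  qed
  have main: "ell \<theta>' f' - ell \<theta> f - (s * (\<zeta> - \<xi>) - (k2 - c1) * (V * s + s\<^sup>2 / 2))
    = (ell \<theta>' f' - ell \<theta>0 f' - ((V + s) * \<zeta> - (V + s) * q' - (V + s)\<^sup>2 / 2 * k2))
      - (ell \<theta> f - ell \<theta>0 f - (V * \<zeta> - V * q - V\<^sup>2 / 2 * k2))
      - s * ((W1 w + W2 (K \<theta>0 w)) - \<xi>) - s\<^sup>2 / 2 * (cn - c1) - (V + s) * (q' - (\<D> f - s * c1)) + V * (q - \<D> f)"
    using e3 by (simp add: power2_eq_square algebra_simps add_divide_distrib diff_divide_distrib)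
  have a1: "\<bar>s * ((W1 w + W2 (K \<theta>0 w)) - \<xi>)\<bar> \<le> 2 * P"
  proof -
    have "\<bar>s * ((W1 w + W2 (K \<theta>0 w)) - \<xi>)\<bar> \<le> (2 * L) * \<tau>"
      unfolding abs_mult using sL W_w L by (intro mult_mono) (auto simp: \<xi>_def)
    then show ?thesis using mono[of 0 1] by simp
  qed
  have a2: "\<bar>s\<^sup>2 / 2 * (cn - c1)\<bar> \<le> 8 * P"
  proof -
    have "s\<^sup>2 \<le> (2 * L)\<^sup>2" using sL L abs_le_square_iff[of s "2 * L"] by simp
    then have "\<bar>s\<^sup>2 / 2 * (cn - c1)\<bar> \<le> (2 * L\<^sup>2) * (4 * D ^ 3 * \<tau>)"
      unfolding abs_mult using cn by (intro mult_mono) (auto simp: power_mult_distrib)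
    also have "\<dots> = 8 * (D ^ 3 * L ^ 2 * \<tau>)" by (simp add: mult_ac)
    also have "\<dots> \<le> 8 * P" by (intro mult_left_mono mono) auto
    finally show ?thesis .
  qed
  have a3: "\<bar>(V + s) * (q' - (\<D> f - s * c1))\<bar> \<le> 13 * P"
  proof -
    have "\<bar>(V + s) * (q' - (\<D> f - s * c1))\<bar> \<le> L * (\<tau> + 2 * L * (6 * D ^ 4 * \<tau>))"
      unfolding abs_mult using q' U(2) L V' by (intro mult_mono) auto
    also have "\<dots> = D ^ 0 * L ^ 1 * \<tau> + 12 * (D ^ 4 * L ^ 2 * \<tau>)" by (simp add: power2_eq_square algebra_simps)
    also have "\<dots> \<le> P + 12 * P" by (intro add_mono mult_left_mono mono) auto
    finally show ?thesis by simp
  qed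
  have a4: "\<bar>V * (q - \<D> f)\<bar> \<le> P"
  proof -
    have "\<bar>V * (q - \<D> f)\<bar> \<le> L * \<tau>" unfolding abs_mult using U(1) L bias by (intro mult_mono) (auto simp: V_def q_def)
    then show ?thesis using mono[of 0 1] by simp
  qed
  have "\<bar>ell \<theta>' f' - ell \<theta> f - (s * (\<zeta> - \<xi>) - (k2 - c1) * (V * s + s\<^sup>2 / 2))\<bar> \<le> 60 * P"
    unfolding main using e1 e2 a1 a2 a3 a4 by linarith
  then show ?thesis by (simp add: P_def f'_def \<delta>_def V_def mult.assoc)
qed

end

section \<open>Concentration and exchange\<close>

lemma gauss_tail: "emeasure gauss {z. R < \<bar>z\<bar>} \<le> ennreal (4 * exp (- R))"
proof -
  have one: "emeasure gauss {z. R < c * z} \<le> ennreal (2 * exp (- R))" if c: "c\<^sup>2 = 1" for c :: real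
  proof -
    have "emeasure gauss {z. R < c * z} = (\<integral>\<^sup>+z. indicator {z. R < c * z} z \<partial>gauss)" by simp
    also have "\<dots> \<le> (\<integral>\<^sup>+z. ennreal (exp (- R)) * ennreal (exp (c * z)) \<partial>gauss)"
      by (intro nn_integral_mono)
        (auto simp: indicator_def ennreal_mult[symmetric] exp_add[symmetric] simp flip: ennreal_1 intro!: ennreal_leI)
    also have "\<dots> = ennreal (exp (- R)) * ennreal (exp (1 / 2))"
      by (subst nn_integral_cmult) (simp_all add: nn_integral_gauss_exp c)
    also have "\<dots> = ennreal (exp (1/2) * exp (- R))" by (simp add: ennreal_mult mult.commute)
    also have "\<dots> \<le> ennreal (2 * exp (- R))"
      using exp_half_le2 by (intro ennreal_leI mult_right_mono) auto
    finally show ?thesis .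
  qed
  have "emeasure gauss {z. R < \<bar>z\<bar>} \<le> emeasure gauss ({z. R < 1 * z} \<union> {z. R < -1 * z})"
    by (intro emeasure_mono) (auto simp: abs_real_def split: if_splits)
  also have "\<dots> \<le> emeasure gauss {z. R < 1 * z} + emeasure gauss {z. R < -1 * z}"
    by (intro emeasure_subadditive) auto
  also have "\<dots> \<le> ennreal (2 * exp (- R)) + ennreal (2 * exp (- R))" by (intro add_mono one) auto
  finally show ?thesis by (simp add: ennreal_plus[symmetric] del: ennreal_plus)
qed

lemma normal_density_affine_eq:
  assumes "\<sigma> > 0" "c > 0"
  shows "normal_density (a + c * \<mu>) (c * \<sigma>) (a + c * x) = normal_density \<mu> \<sigma> x / c"
proof -
  have "(a + c * x - (a + c * \<mu>))\<^sup>2 / (2 * (c * \<sigma>)\<^sup>2) = (x - \<mu>)\<^sup>2 / (2 * \<sigma>\<^sup>2)"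
    using assms by (simp add: power_mult_distrib flip: right_diff_distrib)
  moreover have "sqrt (2 * pi * (c * \<sigma>)\<^sup>2) = c * sqrt (2 * pi * \<sigma>\<^sup>2)"
    using assms by (simp add: power_mult_distrib real_sqrt_mult)
  ultimately show ?thesis using assms by (simp add: normal_density_def)
qed

lemma nn_integral_normal_density_affine:
  fixes h :: "real \<Rightarrow> ennreal"
  assumes "\<sigma> > 0" "c > 0" and [measurable]: "h \<in> borel_measurable borel"
  shows "(\<integral>\<^sup>+x. h x * normal_density (a + c * \<mu>) (c * \<sigma>) x \<partial>lborel) = (\<integral>\<^sup>+u. h (a + c * u) * normal_density \<mu> \<sigma> u \<partial>lborel)"
proof -
  have "(\<integral>\<^sup>+x. h x * normal_density (a + c * \<mu>) (c * \<sigma>) x \<partial>lborel)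
      = ennreal \<bar>c\<bar> * (\<integral>\<^sup>+u. h (a + c * u) * normal_density (a + c * \<mu>) (c * \<sigma>) (a + c * u) \<partial>lborel)"
    using assms by (intro nn_integral_real_affine) auto
  also have "\<dots> = (\<integral>\<^sup>+u. ennreal c * (h (a + c * u) * ennreal (normal_density \<mu> \<sigma> u / c)) \<partial>lborel)"
    using assms by (subst nn_integral_cmult[symmetric]) (simp_all add: normal_density_affine_eq)
  also have "\<dots> = (\<integral>\<^sup>+u. h (a + c * u) * normal_density \<mu> \<sigma> u \<partial>lborel)"
  proof (intro nn_integral_cong)
    fix u
    have "ennreal c * ennreal (normal_density \<mu> \<sigma> u / c) = ennreal (normal_density \<mu> \<sigma> u)"
      using assms by (subst ennreal_mult[symmetric]) auto
    then show "ennreal c * (h (a + c * u) * ennreal (normal_density \<mu> \<sigma> u / c)) = h (a + c * u) * ennreal (normal_density \<mu> \<sigma> u)"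
      by (metis mult.left_commute)
  qed
  finally show ?thesis .
qed

lemma normal_density_tail:
  assumes "\<sigma> > 0" "\<bar>\<mu>\<bar> \<le> b"
  shows "(\<integral>\<^sup>+u. indicator {u. L < \<bar>u\<bar>} u * ennreal (normal_density \<mu> \<sigma> u) \<partial>lborel) \<le> ennreal (4 * exp (- ((L - b) / \<sigma>)))"
proof -
  have "(\<integral>\<^sup>+u. indicator {u. L < \<bar>u\<bar>} u * ennreal (normal_density \<mu> \<sigma> u) \<partial>lborel)
     = (\<integral>\<^sup>+u. indicator {u. L < \<bar>u\<bar>} u * ennreal (normal_density (\<mu> + \<sigma> * 0) (\<sigma> * 1) u) \<partial>lborel)" by simp
  also have "\<dots> = (\<integral>\<^sup>+z. indicator {u. L < \<bar>u\<bar>} (\<mu> + \<sigma> * z) * ennreal (std_normal_density z) \<partial>lborel)"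
    by (rule nn_integral_normal_density_affine) (use assms in auto)
  also have "\<dots> = (\<integral>\<^sup>+z. indicator {u. L < \<bar>u\<bar>} (\<mu> + \<sigma> * z) \<partial>gauss)"
    by (subst nn_integral_density) (auto simp: mult.commute)
  also have "\<dots> \<le> (\<integral>\<^sup>+z. indicator {z. (L - b) / \<sigma> < \<bar>z\<bar>} z \<partial>gauss)"
  proof (intro nn_integral_mono)
    fix z :: real
    have "(L - b) / \<sigma> < \<bar>z\<bar>" if "L < \<bar>\<mu> + \<sigma> * z\<bar>"
    proof -
      have "\<bar>\<mu> + \<sigma> * z\<bar> \<le> b + \<sigma> * \<bar>z\<bar>" using abs_triangle_ineq[of \<mu> "\<sigma> * z"] assms by (simp add: abs_mult)
      then show ?thesis using that assms by (simp add: divide_less_eq mult.commute)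
    qed
    then show "(indicator {u. L < \<bar>u\<bar>} (\<mu> + \<sigma> * z) :: ennreal) \<le> indicator {z. (L - b) / \<sigma> < \<bar>z\<bar>} z"
      by (auto simp: indicator_def)
  qed
  also have "\<dots> = emeasure gauss {z. (L - b) / \<sigma> < \<bar>z\<bar>}" by simp
  finally show ?thesis using gauss_tail[of "(L - b) / \<sigma>"] by (rule order_trans)
qed

text \<open>One observation on the good event, with w, T and H in the roles of
  \<open>\<gamma>\<^sub>n\<close>, \<open>\<Theta>\<^sub>n\<close> and \<open>H\<^sub>n\<close>, and
  with c the normalising constant. The posterior density is taken with respect to
  \<open>lborel \<Otimes>\<^sub>M \<pi>f\<close> and cut off outside \<Theta>, so that translations
  and dilations of \<theta> act on the whole line. T is required to contain the shifts up to
  \<open>2 L\<close> only outside a set of measure at most \<tau>, because the exhaustion of the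
  line is pointwise.\<close>

locale bvm_setting = llr_setting n K Kd \<Theta> \<theta>0 f0 \<gamma> w V1 V2 W1 W2 D \<tau>
  for n :: nat and K :: "real \<Rightarrow> 'h::{real_inner, second_countable_topology} \<Rightarrow>\<^sub>L 'h" and Kd \<Theta> \<theta>0 f0 \<gamma> w V1 V2 W1 W2 D \<tau> +
  fixes p :: "real \<Rightarrow> real" and c pl pu :: real and \<pi>f :: "'h measure" and H :: "'h set"
    and T :: "real set" and r :: "real \<Rightarrow> 'h \<Rightarrow> ennreal" and L :: real
  assumes \<pi>f: "prob_space \<pi>f" and sets_\<pi>f [measurable_cong]: "sets \<pi>f = sets borel"
    and info_pos: "k2 - c1 > 0"
    and pl: "0 < pl" and p_bounds: "\<And>\<theta>. \<theta> \<in> \<Theta> \<Longrightarrow> pl \<le> p \<theta> \<and> p \<theta> \<le> pu"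
    and p_close: "\<And>\<theta> \<theta>'. \<bar>\<theta> - \<theta>0\<bar> \<le> L / sqrt (real n) \<Longrightarrow> \<bar>\<theta>' - \<theta>0\<bar> \<le> L / sqrt (real n) \<Longrightarrow> exp (- \<tau>) * p \<theta> \<le> p \<theta>'"
    and c: "0 < c"
    and \<Theta>_nbhd: "\<And>\<theta>. \<bar>\<theta> - \<theta>0\<bar> \<le> \<tau> \<Longrightarrow> \<theta> \<in> \<Theta>"
    and wt_measurable [measurable]: "(\<lambda>q. ennreal (c * p (fst q) * exp (ell (fst q) (snd q))) * indicator \<Theta> (fst q)) \<in> borel_measurable (borel \<Otimes>\<^sub>M borel)"
    and wt_prob: "prob_space (density (lborel \<Otimes>\<^sub>M \<pi>f) (\<lambda>q. ennreal (c * p (fst q) * exp (ell (fst q) (snd q))) * indicator \<Theta> (fst q)))"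
    and AE_good: "AE q in lborel \<Otimes>\<^sub>M \<pi>f. fst q \<in> \<Theta> \<longrightarrow> good (fst q) (snd q) \<and> good_dir (fst q)"
    and H [measurable]: "H \<in> sets borel"
    and bias: "\<And>f. f \<in> H \<Longrightarrow> \<bar>sqrt (real n) * (K \<theta>0 (f - f0) \<bullet> Kd f) - \<D> f\<bar> \<le> \<tau>"
    and T_measurable [measurable]: "T \<in> sets borel"
    and shift: "\<And>\<theta>. \<theta> \<in> T \<Longrightarrow> shift_density \<pi>f ((\<theta> - \<theta>0) *\<^sub>R w) (r \<theta>)"
    and r_ge: "\<And>\<theta> f. \<theta> \<in> T \<Longrightarrow> f \<in> H \<Longrightarrow> ennreal (exp (- \<tau> * (1 + (\<U> \<theta>)\<^sup>2))) \<le> r \<theta> f"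
    and T_unit: "\<theta>0 + 1 / sqrt (real n) \<in> T" "\<theta>0 - 1 / sqrt (real n) \<in> T"
    and L: "1 \<le> L" "L / sqrt (real n) \<le> \<tau>"
    and T_large: "emeasure lborel {s. \<bar>s\<bar> \<le> 2 * L \<and> \<theta>0 + s / sqrt (real n) \<notin> T} \<le> ennreal \<tau>"
    and \<tau>_small: "3 * D * \<tau> \<le> 1" "48 * D ^ 4 * \<tau> \<le> k2 - c1" "112 * k2 * D ^ 4 * \<tau> \<le> (k2 - c1)\<^sup>2"
begin

definition "wt q = ennreal (c * p (fst q) * exp (ell (fst q) (snd q))) * indicator \<Theta> (fst q)"
abbreviation "M \<equiv> lborel \<Otimes>\<^sub>M \<pi>f"
definition "post = density M wt"
definition "G = {q. \<bar>fst q - \<theta>0\<bar> \<le> \<tau> \<and> norm (snd q - f0) \<le> \<tau> \<and> snd q \<in> H}"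
definition "I = k2 - c1"
text \<open>The density of the limit law \<open>N\<close> in the local coordinate
  \<open>\<U> \<theta>\<close>.\<close>

definition "\<nu> u = normal_density ((\<zeta> - \<xi>) / I) (1 / sqrt I) u"
definition "N = normal_law (\<theta>0 + 1 / sqrt (real n) * ((\<zeta> - \<xi>) / I)) (1 / real n * inverse I)"

lemma I: "I > 0" using info_pos by (simp add: I_def)

lemma \<tau>_le1: "\<tau> \<le> 1"
  using \<tau>_small(1) D \<tau> mult_right_mono[of 1 D "3 * \<tau>"] by simp

lemma wt_meas [measurable]: "wt \<in> borel_measurable (borel \<Otimes>\<^sub>M borel)"
  unfolding wt_def[abs_def] by (rule wt_measurable)

lemma sets_M [measurable_cong]: "sets M = sets (borel \<Otimes>\<^sub>M borel)"
  using sets_pair_measure_cong[OF sets_lborel sets_\<pi>f] .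

lemma space_M: "space M = UNIV"
  using sets_eq_imp_space_eq[OF sets_\<pi>f] by (simp add: space_pair_measure)

lemma prob_post: "prob_space post"
  using wt_prob by (simp add: post_def wt_def[abs_def])

lemma sets_post [measurable_cong]: "sets post = sets (borel \<Otimes>\<^sub>M borel)"
  unfolding post_def sets_density by (rule sets_M)

lemma nn_integral_wt: "(\<integral>\<^sup>+q. wt q \<partial>M) = 1"
proof -
  have "(\<integral>\<^sup>+q. wt q \<partial>M) = emeasure post (space post)"
  proof -
    have "wt \<in> borel_measurable M" by measurable
    from emeasure_density[OF this sets.top] show ?thesis
      unfolding post_def space_density by (simp add: space_M)
  qed
  then show ?thesis using prob_space.emeasure_space_1[OF prob_post] by simp
qed

lemma emeasure_post: "E \<in> sets (borel \<Otimes>\<^sub>M borel) \<Longrightarrow> emeasure post E = (\<integral>\<^sup>+q. wt q * indicator E q \<partial>M)"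
  unfolding post_def by (subst emeasure_density) (auto simp: sets_M)

interpretation \<pi>f: prob_space \<pi>f by (rule \<pi>f)
interpretation P: pair_sigma_finite lborel \<pi>f ..

text \<open>The change of variables under the prior: \<open>r (\<theta>0 + \<delta>)\<close> is the
  density of the law of \<open>f + \<delta> w\<close>, so weighting by it undoes the substitution of
  \<open>f - \<delta> w\<close>. A lower bound for r thus turns a pointwise comparison with the
  moved point into a comparison of integrals.\<close>

lemma shift_integral:
  fixes F :: "real \<times> 'h \<Rightarrow> ennreal"
  assumes [measurable]: "F \<in> borel_measurable (borel \<Otimes>\<^sub>M borel)" and \<theta>: "\<theta>0 + \<delta> \<in> T"
  shows "(\<integral>\<^sup>+q. F (fst q, snd q - \<delta> *\<^sub>R w) * r (\<theta>0 + \<delta>) (snd q) \<partial>M) = (\<integral>\<^sup>+q. F q \<partial>M)"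
proof -
  have [measurable]: "r (\<theta>0 + \<delta>) \<in> borel_measurable \<pi>f" and dens: "density \<pi>f (r (\<theta>0 + \<delta>)) = distr \<pi>f borel (\<lambda>f. f + \<delta> *\<^sub>R w)"
    using shift[OF \<theta>] by (simp_all add: shift_density_def)
  have inner: "(\<integral>\<^sup>+f. F (t, f - \<delta> *\<^sub>R w) * r (\<theta>0 + \<delta>) f \<partial>\<pi>f) = (\<integral>\<^sup>+f. F (t, f) \<partial>\<pi>f)" for t
  proof -
    have "(\<integral>\<^sup>+f. F (t, f - \<delta> *\<^sub>R w) * r (\<theta>0 + \<delta>) f \<partial>\<pi>f) = (\<integral>\<^sup>+f. F (t, f - \<delta> *\<^sub>R w) \<partial>density \<pi>f (r (\<theta>0 + \<delta>)))"
      by (subst nn_integral_density) (auto simp: mult.commute)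
    also have "\<dots> = (\<integral>\<^sup>+f. F (t, f) \<partial>\<pi>f)"
      unfolding dens by (subst nn_integral_distr) auto
    finally show ?thesis .
  qed
  have "(\<integral>\<^sup>+q. F (fst q, snd q - \<delta> *\<^sub>R w) * r (\<theta>0 + \<delta>) (snd q) \<partial>M)
      = (\<integral>\<^sup>+t. (\<integral>\<^sup>+f. F (t, f - \<delta> *\<^sub>R w) * r (\<theta>0 + \<delta>) f \<partial>\<pi>f) \<partial>lborel)"
    by (subst \<pi>f.nn_integral_fst[symmetric]) auto
  also have "\<dots> = (\<integral>\<^sup>+q. F q \<partial>M)"
    unfolding inner by (subst \<pi>f.nn_integral_fst[symmetric]) auto
  finally show ?thesis .
qed

lemma affine_integral:
  fixes F :: "real \<times> 'h \<Rightarrow> ennreal"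
  assumes [measurable]: "F \<in> borel_measurable (borel \<Otimes>\<^sub>M borel)" and b: "b \<noteq> 0"
  shows "(\<integral>\<^sup>+q. F q \<partial>M) = ennreal \<bar>b\<bar> * (\<integral>\<^sup>+q. F (a + b * fst q, snd q) \<partial>M)"
proof -
  have "(\<integral>\<^sup>+q. F q \<partial>M) = (\<integral>\<^sup>+f. \<integral>\<^sup>+t. F (t, f) \<partial>lborel \<partial>\<pi>f)"
    by (subst P.nn_integral_snd[symmetric]) auto
  also have "\<dots> = (\<integral>\<^sup>+f. ennreal \<bar>b\<bar> * (\<integral>\<^sup>+t. F (a + b * t, f) \<partial>lborel) \<partial>\<pi>f)"
    by (intro nn_integral_cong nn_integral_real_affine b) measurable
  also have "\<dots> = ennreal \<bar>b\<bar> * (\<integral>\<^sup>+f. \<integral>\<^sup>+t. F (a + b * t, f) \<partial>lborel \<partial>\<pi>f)"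
    by (intro nn_integral_cmult) measurable
  also have "(\<integral>\<^sup>+f. \<integral>\<^sup>+t. F (a + b * t, f) \<partial>lborel \<partial>\<pi>f) = (\<integral>\<^sup>+q. F (a + b * fst q, snd q) \<partial>M)"
    by (subst P.nn_integral_snd[symmetric]) auto
  finally show ?thesis .
qed

text \<open>The noise bounds hold only almost everywhere, and a comparison involves two parameters.
  An affine map with \<open>b \<noteq> 0\<close> preserves null sets, so for almost every starting
  point the bounds also hold at the moved parameter.\<close>

lemma AE_affine:
  fixes a b :: real
  assumes ae: "AE q in M. P (fst q) (snd q)" and b: "b \<noteq> 0"
  shows "AE q in M. P (a + b * fst q) (snd q)"
proof -
  obtain Z where Z: "Z \<in> sets M" "emeasure M Z = 0" "{q \<in> space M. \<not> P (fst q) (snd q)} \<subseteq> Z"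
    using ae by (auto elim!: AE_E)
  have [measurable]: "Z \<in> sets (borel \<Otimes>\<^sub>M borel)" using Z(1) unfolding sets_M .
  have "0 = ennreal \<bar>b\<bar> * (\<integral>\<^sup>+q. indicator Z (a + b * fst q, snd q) \<partial>M)"
    using affine_integral[of "indicator Z" b a] Z b by simp
  then have "(\<integral>\<^sup>+q. indicator Z (a + b * fst q, snd q) \<partial>M) = 0" using b by simp
  then have "AE q in M. (indicator Z (a + b * fst q, snd q) :: ennreal) = 0"
    by (subst (asm) nn_integral_0_iff_AE) measurable
  then show ?thesis
    by eventually_elim (use Z(3) in \<open>force simp: space_M indicator_eq_0_iff\<close>)
qed

lemma G_measurable [measurable]: "G \<in> sets (borel \<Otimes>\<^sub>M borel)"
proof -
  have "{q \<in> space (borel \<Otimes>\<^sub>M borel). \<bar>fst q - \<theta>0\<bar> \<le> \<tau> \<and> norm (snd q - f0) \<le> \<tau> \<and> snd q \<in> H} \<in> sets (borel \<Otimes>\<^sub>M borel)"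
    by measurable
  then show ?thesis by (simp add: G_def space_pair_measure)
qed

lemma \<D>_measurable [measurable]: "\<D> \<in> borel_measurable borel"
  unfolding \<D>_def[abs_def] by (intro borel_measurable_continuous_onI continuous_intros)

lemma \<U>_measurable [measurable]: "\<U> \<in> borel_measurable borel"
  unfolding \<U>_def[abs_def] by measurable

text \<open>Shifting \<open>f\<close> at fixed \<open>\<theta>\<close>: far from \<open>\<theta>0\<close>, the score in the direction \<open>w\<close> must nearly vanish.\<close>

lemma far_score_large:
  assumes s: "s = 1 \<or> s = -1"
  shows "emeasure post {q \<in> G. L < \<bar>\<U> (fst q)\<bar> \<and> I / 4 * \<bar>\<U> (fst q)\<bar> \<le> s * (\<D> (snd q) + c1 * \<U> (fst q))}
    \<le> ennreal (exp (4 * D ^ 4 + 2 - I / 8 * L))"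
proof -
  define \<delta> where "\<delta> = s / sqrt (real n)"
  define E where "E = {q \<in> G. L < \<bar>\<U> (fst q)\<bar> \<and> I / 4 * \<bar>\<U> (fst q)\<bar> \<le> s * (\<D> (snd q) + c1 * \<U> (fst q))}"
  \<comment> \<open>The summand 2 absorbs a factor \<open>exp (2 \<tau>)\<close>: for the unit shift
    the lower bound for r is \<open>exp (- 2 \<tau>)\<close>, and \<open>\<tau> \<le> 1\<close>. The
    rest is the loss \<open>4 D^4\<close> minus half of the gain \<open>I / 4 * L\<close>; the other
    half pays for the error proportional to \<open>|\<U> \<theta>|\<close>.\<close>
  define k where "k = 4 * D ^ 4 + 2 - I / 8 * L"
  have \<delta>T: "\<theta>0 + \<delta> \<in> T" using T_unit s by (auto simp: \<delta>_def)
  have U\<delta>: "(\<U> (\<theta>0 + \<delta>))\<^sup>2 = 1" using sqrt_n s by (auto simp: \<U>_def \<delta>_def)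
  have [measurable]: "E \<in> sets (borel \<Otimes>\<^sub>M borel)"
  proof -
    have "{q \<in> space (borel \<Otimes>\<^sub>M borel). q \<in> G \<and> L < \<bar>\<U> (fst q)\<bar> \<and> I / 4 * \<bar>\<U> (fst q)\<bar> \<le> s * (\<D> (snd q) + c1 * \<U> (fst q))}
        \<in> sets (borel \<Otimes>\<^sub>M borel)" by measurable
    then show ?thesis by (simp add: E_def space_pair_measure Collect_conj_eq)
  qed
  have "emeasure post E = (\<integral>\<^sup>+q. wt q * indicator E q \<partial>M)" by (rule emeasure_post) measurable
  also have "\<dots> \<le> (\<integral>\<^sup>+q. ennreal (exp k) * (wt (fst q, snd q - \<delta> *\<^sub>R w) * r (\<theta>0 + \<delta>) (snd q)) \<partial>M)"
  proof (rule nn_integral_mono_AE)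
    show "AE q in M. wt q * indicator E q \<le> ennreal (exp k) * (wt (fst q, snd q - \<delta> *\<^sub>R w) * r (\<theta>0 + \<delta>) (snd q))"
      using AE_good
    proof eventually_elim
      case (elim q)
      show ?case
      proof (cases "q \<in> E \<and> fst q \<in> \<Theta>")
        case True
        obtain \<theta> f where q: "q = (\<theta>, f)" by force
        have E: "\<bar>\<theta> - \<theta>0\<bar> \<le> \<tau>" "norm (f - f0) \<le> \<tau>" "f \<in> H" "L < \<bar>\<U> \<theta>\<bar>" "I / 4 * \<bar>\<U> \<theta>\<bar> \<le> s * (\<D> f + c1 * \<U> \<theta>)" and \<theta>: "\<theta> \<in> \<Theta>"
          using True by (auto simp: q E_def G_def)
        have g: "good \<theta> f" "good_dir \<theta>" using elim \<theta> by (auto simp: q)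
        have "ell \<theta> (f - \<delta> *\<^sub>R w) - ell \<theta> f \<ge> s * (\<D> f + c1 * \<U> \<theta>) - (4 * D ^ 4 + 6 * D ^ 4 * \<tau> * \<bar>\<U> \<theta>\<bar>)"
          unfolding \<delta>_def by (rule step_fixed_parameter[OF g E(1,2) \<tau>_le1]) (use s in auto)
        moreover have "6 * D ^ 4 * \<tau> * \<bar>\<U> \<theta>\<bar> \<le> I / 8 * \<bar>\<U> \<theta>\<bar>"
          using \<tau>_small(2) by (intro mult_right_mono) (auto simp: I_def)
        moreover have "I / 4 * \<bar>\<U> \<theta>\<bar> = I / 8 * \<bar>\<U> \<theta>\<bar> + I / 8 * \<bar>\<U> \<theta>\<bar>" by simp
        moreover have "I / 8 * L \<le> I / 8 * \<bar>\<U> \<theta>\<bar>" using E(4) I by (intro mult_left_mono) auto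
        ultimately have "ell \<theta> f \<le> (k - 2) + ell \<theta> (f - \<delta> *\<^sub>R w)" using E(5) unfolding k_def by linarith
        then have "c * p \<theta> * exp (ell \<theta> f) \<le> c * p \<theta> * exp (k + ell \<theta> (f - \<delta> *\<^sub>R w) + - 2 * \<tau>)"
          using c p_bounds[OF \<theta>] pl \<tau>_le1 by (intro mult_left_mono) auto
        then have "c * p \<theta> * exp (ell \<theta> f) \<le> exp k * ((c * p \<theta> * exp (ell \<theta> (f - \<delta> *\<^sub>R w))) * exp (- \<tau> * (1 + 1)))"
          by (simp add: exp_add exp_diff exp_minus field_simps)
        then have "ennreal (c * p \<theta> * exp (ell \<theta> f)) \<le> ennreal (exp k) * (ennreal (c * p \<theta> * exp (ell \<theta> (f - \<delta> *\<^sub>R w))) * ennreal (exp (- \<tau> * (1 + 1))))"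
          using c p_bounds[OF \<theta>] pl by (subst ennreal_mult[symmetric] | simp add: ennreal_leI)+
        also have "\<dots> \<le> ennreal (exp k) * (ennreal (c * p \<theta> * exp (ell \<theta> (f - \<delta> *\<^sub>R w))) * r (\<theta>0 + \<delta>) f)"
          using r_ge[OF \<delta>T E(3)] unfolding U\<delta> by (intro mult_left_mono) auto
        finally show ?thesis using True by (simp add: q wt_def)
      qed (auto simp: wt_def)
    qed
  qed
  also have "\<dots> = ennreal (exp k) * (\<integral>\<^sup>+q. wt (fst q, snd q - \<delta> *\<^sub>R w) * r (\<theta>0 + \<delta>) (snd q) \<partial>M)"
  proof (rule nn_integral_cmult)
    have [measurable]: "r (\<theta>0 + \<delta>) \<in> borel_measurable \<pi>f" using shift[OF \<delta>T] by (simp add: shift_density_def)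
    show "(\<lambda>q. wt (fst q, snd q - \<delta> *\<^sub>R w) * r (\<theta>0 + \<delta>) (snd q)) \<in> borel_measurable M" by measurable
  qed
  also have "\<dots> = ennreal (exp k)"
    using shift_integral[OF wt_meas \<delta>T] by (simp add: nn_integral_wt)
  finally show ?thesis by (simp add: E_def k_def)
qed

text \<open>Contracting \<open>\<theta>\<close> towards \<open>\<theta>0\<close> at fixed \<open>f\<close>: where the score nearly vanishes, this increases the likelihood.\<close>

lemma far_score_small:
  assumes L_large: "96 * D * k2 \<le> I\<^sup>2 * L"
  shows "emeasure post {q \<in> G. L < \<bar>\<U> (fst q)\<bar> \<and> \<bar>\<D> (snd q) + c1 * \<U> (fst q)\<bar> \<le> I / 4 * \<bar>\<U> (fst q)\<bar>}
    \<le> ennreal (2 * pu / pl * exp (- (I\<^sup>2 / (16 * k2) * L\<^sup>2)))"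
proof -
  have c1: "0 \<le> c1" using \<gamma>_eq unfolding c1_def by (metis add_nonneg_nonneg zero_le_power2)
  have k2: "k2 > 0" "I \<le> k2" using I c1 by (auto simp: I_def)
  \<comment> \<open>With this l and \<open>r = I / 4\<close>, the coefficient
    \<open>l I - l^2 k2 / 2 - l r\<close> of the gain equals \<open>I^2 / (4 k2)\<close>, that is,
    \<open>2 a\<close>. Moreover \<open>I \<le> k2\<close> gives \<open>l \<le> 1/2\<close>, so the
    change of variables costs a factor of at most 2.\<close>
  define l where "l = I / (2 * k2)"
  have l: "0 < l" "l \<le> 1/2" using I k2 by (auto simp: l_def field_simps)
  define a where "a = I\<^sup>2 / (8 * k2)"
  have a: "a > 0" using I k2 by (simp add: a_def)
  define b where "b = 1 - l"
  define t0 where "t0 = l * \<theta>0"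
  have b: "b \<noteq> 0" "1/2 \<le> b" using l by (auto simp: b_def)
  define k where "k = a / 2 * L\<^sup>2"
  define E where "E = {q \<in> G. L < \<bar>\<U> (fst q)\<bar> \<and> \<bar>\<D> (snd q) + c1 * \<U> (fst q)\<bar> \<le> I / 4 * \<bar>\<U> (fst q)\<bar>}"
  have [measurable]: "E \<in> sets (borel \<Otimes>\<^sub>M borel)"
  proof -
    have "{q \<in> space (borel \<Otimes>\<^sub>M borel). q \<in> G \<and> L < \<bar>\<U> (fst q)\<bar> \<and> \<bar>\<D> (snd q) + c1 * \<U> (fst q)\<bar> \<le> I / 4 * \<bar>\<U> (fst q)\<bar>}
        \<in> sets (borel \<Otimes>\<^sub>M borel)" by measurable
    then show ?thesis by (simp add: E_def space_pair_measure Collect_conj_eq)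
  qed
  define R where "R = pu / pl"
  have pul: "R \<ge> 0" unfolding R_def using p_bounds[OF \<theta>0] pl by (simp add: divide_nonneg_pos)
  have "emeasure post E = (\<integral>\<^sup>+q. wt q * indicator E q \<partial>M)" by (rule emeasure_post) measurable
  also have "\<dots> \<le> (\<integral>\<^sup>+q. ennreal (R * exp (- k)) * wt (t0 + b * fst q, snd q) \<partial>M)"
  proof (rule nn_integral_mono_AE)
    show "AE q in M. wt q * indicator E q \<le> ennreal (R * exp (- k)) * wt (t0 + b * fst q, snd q)"
      using AE_good AE_affine[OF AE_good b(1), of t0]
    proof eventually_elim
      case (elim q)
      show ?case
      proof (cases "q \<in> E \<and> fst q \<in> \<Theta>")
        case True
        obtain \<theta> f where q: "q = (\<theta>, f)" by force
        have E: "\<bar>\<theta> - \<theta>0\<bar> \<le> \<tau>" "norm (f - f0) \<le> \<tau>" "f \<in> H" "L < \<bar>\<U> \<theta>\<bar>" "\<bar>\<D> f + c1 * \<U> \<theta>\<bar> \<le> I / 4 * \<bar>\<U> \<theta>\<bar>" and \<theta>: "\<theta> \<in> \<Theta>"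
          using True by (auto simp: q E_def G_def)
        define \<theta>' where "\<theta>' = t0 + b * \<theta>"
        have \<theta>'0: "\<theta>' - \<theta>0 = (1 - l) * (\<theta> - \<theta>0)" by (simp add: \<theta>'_def t0_def b_def algebra_simps)
        have "\<bar>\<theta>' - \<theta>0\<bar> \<le> \<bar>\<theta> - \<theta>0\<bar>" unfolding \<theta>'0 abs_mult using l by (intro mult_left_le_one_le) auto
        then have \<theta>': "\<theta>' \<in> \<Theta>" using E(1) by (intro \<Theta>_nbhd) simp
        have g: "good \<theta> f" "good \<theta>' f" using elim \<theta> \<theta>' by (auto simp: q \<theta>'_def)
        have "ell \<theta>' f - ell \<theta> f \<ge> (\<U> \<theta>)\<^sup>2 * (l * (k2 - c1) - l\<^sup>2 * k2 / 2 - l * (I / 4) - 14 * D ^ 4 * \<tau>) - 6 * D * \<bar>\<U> \<theta>\<bar>"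
          by (rule step_fixed_function[OF g E(1,2) \<tau>_le1 \<theta>'0 _ _ bias[OF E(3)] E(5)]) (use l in auto)
        moreover have "l * (k2 - c1) - l\<^sup>2 * k2 / 2 - l * (I / 4) = 2 * a"
          using k2 by (simp add: l_def a_def I_def[symmetric] power2_eq_square field_simps)
        \<comment> \<open>Half of the gain \<open>2 a\<close> pays for this error; the 112 in
          \<open>\<tau>_small\<close> is 14 times 8.\<close>
        moreover have "14 * D ^ 4 * \<tau> \<le> a"
          using \<tau>_small(3) k2 by (simp add: a_def I_def[symmetric] pos_le_divide_eq mult_ac)
        ultimately have "(\<U> \<theta>)\<^sup>2 * a \<le> (\<U> \<theta>)\<^sup>2 * (l * (k2 - c1) - l\<^sup>2 * k2 / 2 - l * (I / 4) - 14 * D ^ 4 * \<tau>)"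
          and "ell \<theta>' f - ell \<theta> f \<ge> (\<U> \<theta>)\<^sup>2 * (l * (k2 - c1) - l\<^sup>2 * k2 / 2 - l * (I / 4) - 14 * D ^ 4 * \<tau>) - 6 * D * \<bar>\<U> \<theta>\<bar>"
          by (auto intro!: mult_left_mono)
        then have "ell \<theta>' f - ell \<theta> f \<ge> a * (\<U> \<theta>)\<^sup>2 - 6 * D * \<bar>\<U> \<theta>\<bar>"
          unfolding mult.commute[of a] by linarith
        moreover have "6 * D * \<bar>\<U> \<theta>\<bar> \<le> a * (\<U> \<theta>)\<^sup>2 / 2"
        proof -
          \<comment> \<open>Half of the remaining a absorbs the linear term; the 96 in
            \<open>L_large\<close> is 6 times 16.\<close>
          have "6 * D \<le> a / 2 * L" using L_large k2 by (simp add: a_def field_simps)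
          also have "\<dots> \<le> a / 2 * \<bar>\<U> \<theta>\<bar>" using E(4) a by (intro mult_left_mono) auto
          finally have "6 * D * \<bar>\<U> \<theta>\<bar> \<le> a / 2 * \<bar>\<U> \<theta>\<bar> * \<bar>\<U> \<theta>\<bar>" by (rule mult_right_mono) simp
          then show ?thesis by (simp add: power2_eq_square mult.assoc flip: abs_mult)
        qed
        moreover have "k \<le> a * (\<U> \<theta>)\<^sup>2 / 2"
          unfolding k_def using E(4) L(1) a abs_le_square_iff[of L "\<U> \<theta>"] by (simp add: mult_left_mono)
        ultimately have ell: "ell \<theta> f \<le> - k + ell \<theta>' f" by linarith
        have pp: "p \<theta> \<le> R * p \<theta>'"
        proof -
          have "p \<theta> \<le> R * pl" using p_bounds[OF \<theta>] pl by (simp add: R_def)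
          also have "\<dots> \<le> R * p \<theta>'" using p_bounds[OF \<theta>'] pul by (intro mult_left_mono) auto
          finally show ?thesis .
        qed
        have "c * p \<theta> * exp (ell \<theta> f) \<le> c * (R * p \<theta>') * exp (- k + ell \<theta>' f)"
          using c p_bounds[OF \<theta>] p_bounds[OF \<theta>'] pl pp ell pul by (intro mult_mono) auto
        then have "ennreal (c * p \<theta> * exp (ell \<theta> f)) \<le> ennreal ((R * exp (- k)) * (c * p \<theta>' * exp (ell \<theta>' f)))"
          by (intro ennreal_leI) (simp add: exp_add exp_minus exp_diff field_simps)
        also have "\<dots> = ennreal (R * exp (- k)) * ennreal (c * p \<theta>' * exp (ell \<theta>' f))"
          using c pul p_bounds[OF \<theta>'] pl by (intro ennreal_mult) auto
        finally show ?thesis using True \<theta>' by (simp add: q wt_def \<theta>'_def)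
      qed (auto simp: wt_def)
    qed
  qed
  also have "\<dots> = ennreal (R * exp (- k)) * (\<integral>\<^sup>+q. wt (t0 + b * fst q, snd q) \<partial>M)"
    by (rule nn_integral_cmult) measurable
  also have "\<dots> \<le> ennreal (R * exp (- k)) * ennreal 2"
  proof (rule mult_left_mono)
    have "1 = ennreal \<bar>b\<bar> * (\<integral>\<^sup>+q. wt (t0 + b * fst q, snd q) \<partial>M)"
      using affine_integral[OF wt_meas b(1)] by (simp add: nn_integral_wt)
    then have "ennreal (1/2) * (\<integral>\<^sup>+q. wt (t0 + b * fst q, snd q) \<partial>M) \<le> 1"
      using b(2) by (smt (verit) ennreal_leI mult_right_mono zero_le abs_ge_self order_trans)
    then have "ennreal 2 * (ennreal (1/2) * (\<integral>\<^sup>+q. wt (t0 + b * fst q, snd q) \<partial>M)) \<le> ennreal 2 * 1"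
      by (rule mult_left_mono) simp
    moreover have "ennreal 2 * ennreal (1/2) = 1" by (subst ennreal_mult[symmetric]) auto
    ultimately show "(\<integral>\<^sup>+q. wt (t0 + b * fst q, snd q) \<partial>M) \<le> ennreal 2"
      by (simp only: mult.assoc[symmetric] mult_1_left mult_1_right)
  qed simp
  also have "\<dots> = ennreal (2 * pu / pl * exp (- (I\<^sup>2 / (16 * k2) * L\<^sup>2)))"
  proof -
    have "ennreal (R * exp (- k)) * ennreal 2 = ennreal (R * exp (- k) * 2)"
      using pul by (intro ennreal_mult[symmetric]) auto
    also have "R * exp (- k) * 2 = 2 * pu / pl * exp (- (I\<^sup>2 / (16 * k2) * L\<^sup>2))"
      by (simp add: R_def k_def a_def mult_ac)
    finally show ?thesis .
  qed
  finally show ?thesis by (simp add: E_def)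
qed


lemma far_mass:
  assumes L_large: "96 * D * k2 \<le> I\<^sup>2 * L"
  shows "emeasure post {q \<in> G. L < \<bar>\<U> (fst q)\<bar>}
    \<le> ennreal (2 * exp (4 * D ^ 4 + 2 - I / 8 * L) + 2 * pu / pl * exp (- (I\<^sup>2 / (16 * k2) * L\<^sup>2)))"
proof -
  define E where "E s = {q \<in> G. L < \<bar>\<U> (fst q)\<bar> \<and> I / 4 * \<bar>\<U> (fst q)\<bar> \<le> s * (\<D> (snd q) + c1 * \<U> (fst q))}" for s
  define F where "F = {q \<in> G. L < \<bar>\<U> (fst q)\<bar> \<and> \<bar>\<D> (snd q) + c1 * \<U> (fst q)\<bar> \<le> I / 4 * \<bar>\<U> (fst q)\<bar>}"
  have UNIV: "space (borel \<Otimes>\<^sub>M borel :: (real \<times> 'h) measure) = UNIV" by (simp add: space_pair_measure)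
  have "{q \<in> space (borel \<Otimes>\<^sub>M borel). q \<in> G \<and> L < \<bar>\<U> (fst q)\<bar> \<and> I / 4 * \<bar>\<U> (fst q)\<bar> \<le> s * (\<D> (snd q) + c1 * \<U> (fst q))}
        \<in> sets (borel \<Otimes>\<^sub>M borel)" for s by measurable
  then have E: "E s \<in> sets post" for s unfolding UNIV by (simp add: E_def sets_post Collect_conj_eq)
  have "{q \<in> space (borel \<Otimes>\<^sub>M borel). q \<in> G \<and> L < \<bar>\<U> (fst q)\<bar> \<and> \<bar>\<D> (snd q) + c1 * \<U> (fst q)\<bar> \<le> I / 4 * \<bar>\<U> (fst q)\<bar>}
        \<in> sets (borel \<Otimes>\<^sub>M borel)" by measurable
  then have F: "F \<in> sets post" unfolding UNIV by (simp add: F_def sets_post Collect_conj_eq)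
  have "emeasure post {q \<in> G. L < \<bar>\<U> (fst q)\<bar>} \<le> emeasure post (E 1 \<union> E (-1) \<union> F)"
  proof (rule emeasure_mono)
    show "{q \<in> G. L < \<bar>\<U> (fst q)\<bar>} \<subseteq> E 1 \<union> E (-1) \<union> F"
    proof
      fix q assume q: "q \<in> {q \<in> G. L < \<bar>\<U> (fst q)\<bar>}"
      have "\<bar>x\<bar> \<le> k \<or> k \<le> 1 * x \<or> k \<le> -1 * x" for x k :: real by linarith
      from this[of "\<D> (snd q) + c1 * \<U> (fst q)" "I / 4 * \<bar>\<U> (fst q)\<bar>"] q
      show "q \<in> E 1 \<union> E (-1) \<union> F" unfolding E_def F_def by blast
    qed
  qed (use E F in auto)
  also have "\<dots> \<le> emeasure post (E 1 \<union> E (-1)) + emeasure post F"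
    by (intro emeasure_subadditive E F sets.Un)
  also have "\<dots> \<le> (emeasure post (E 1) + emeasure post (E (-1))) + emeasure post F"
    by (intro add_right_mono emeasure_subadditive E)
  also have "\<dots> \<le> (ennreal (exp (4 * D ^ 4 + 2 - I / 8 * L)) + ennreal (exp (4 * D ^ 4 + 2 - I / 8 * L)))
      + ennreal (2 * pu / pl * exp (- (I\<^sup>2 / (16 * k2) * L\<^sup>2)))"
    unfolding E_def F_def by (intro add_mono far_score_large far_score_small L_large) auto
  also have "\<dots> = ennreal (2 * exp (4 * D ^ 4 + 2 - I / 8 * L) + 2 * pu / pl * exp (- (I\<^sup>2 / (16 * k2) * L\<^sup>2)))"
    using p_bounds[OF \<theta>0] pl by (simp add: ennreal_plus[symmetric] divide_nonneg_pos del: ennreal_plus)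
  finally show ?thesis .
qed

text \<open>The exponent is exactly the main term of \<open>step_exchange\<close>. This identity
  fixes the limit law: a Gaussian density with this response to shifts has mean
  \<open>(\<zeta> - \<xi>) / I\<close> and variance \<open>1 / I\<close>.\<close>

lemma \<nu>_shift: "\<nu> (u + s) = \<nu> u * exp (s * (\<zeta> - \<xi>) - I * (u * s + s\<^sup>2 / 2))"
proof -
  have "(1 / sqrt I)\<^sup>2 = 1 / I" using I by (simp add: power_divide)
  moreover have "- (u + s - (\<zeta> - \<xi>) / I)\<^sup>2 / (2 * (1 / I)) = - (u - (\<zeta> - \<xi>) / I)\<^sup>2 / (2 * (1 / I)) + (s * (\<zeta> - \<xi>) - I * (u * s + s\<^sup>2 / 2))"
    using I by (simp add: power2_eq_square field_simps)
  ultimately show ?thesis by (simp only: \<nu>_def normal_density_def exp_add mult.assoc)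
qed

lemma \<nu>_nonneg: "0 \<le> \<nu> u" by (simp add: \<nu>_def)

text \<open>Bounds the contribution of the shifts s at which no exchange is available.\<close>

lemma \<nu>_le: "\<nu> u \<le> sqrt I"
proof -
  have "sqrt (2 * pi * (1 / sqrt I)\<^sup>2) = sqrt (2 * pi) / sqrt I"
    using I by (simp add: real_sqrt_mult power_divide real_sqrt_divide)
  then have "\<nu> u = exp (- (u - (\<zeta> - \<xi>) / I)\<^sup>2 / (2 * (1 / sqrt I)\<^sup>2)) * (sqrt I / sqrt (2 * pi))"
    by (simp add: \<nu>_def normal_density_def)
  also have "\<dots> \<le> 1 * (sqrt I / 1)"
  proof (intro mult_mono divide_left_mono)
    show "1 \<le> sqrt (2 * pi)" using pi_ge_two by simp
  qed (use I in auto)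
  finally show ?thesis by simp
qed

lemma \<nu>_measurable [measurable]: "\<nu> \<in> borel_measurable borel"
  unfolding \<nu>_def[abs_def] by measurable

lemma emeasure_N:
  assumes B [measurable]: "B \<in> sets borel"
  shows "(\<integral>\<^sup>+u. indicator B (\<theta>0 + u / sqrt (real n)) * ennreal (\<nu> u) \<partial>lborel) = emeasure N B"
proof -
  have sd: "sqrt (1 / real n * inverse I) = 1 / sqrt (real n) * (1 / sqrt I)"
    by (simp add: real_sqrt_mult real_sqrt_divide real_sqrt_inverse inverse_eq_divide)
  have "emeasure N B = (\<integral>\<^sup>+x. indicator B x * ennreal (normal_density (\<theta>0 + 1 / sqrt (real n) * ((\<zeta> - \<xi>) / I)) (1 / sqrt (real n) * (1 / sqrt I)) x) \<partial>lborel)"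
    unfolding N_def normal_law_def sd by (subst emeasure_density) (auto simp: mult.commute)
  also have "\<dots> = (\<integral>\<^sup>+u. indicator B (\<theta>0 + 1 / sqrt (real n) * u) * ennreal (normal_density ((\<zeta> - \<xi>) / I) (1 / sqrt I) u) \<partial>lborel)"
    using sqrt_n I by (intro nn_integral_normal_density_affine) auto
  finally show ?thesis by (simp add: \<nu>_def)
qed

lemma prob_N: "prob_space N"
  unfolding N_def normal_law_def by (intro prob_space_normal_density) (use n I in simp)

lemma sets_N: "sets N = sets borel" by (simp add: N_def normal_law_def)

definition "C = {\<theta>. \<bar>\<U> \<theta>\<bar> \<le> L}"

lemma C_measurable [measurable]: "C \<in> sets borel"
  unfolding C_def by measurable

lemma in_C_le: "\<theta> \<in> C \<Longrightarrow> \<bar>\<theta> - \<theta>0\<bar> \<le> L / sqrt (real n)"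
  using sqrt_n(1) by (simp add: C_def \<U>_def abs_mult pos_le_divide_eq mult.commute)

lemma N_outside_C: "emeasure N (- C) \<le> ennreal (4 * exp (- ((L - 2 * D / I) * sqrt I)))"
proof -
  have "emeasure N (- C) = (\<integral>\<^sup>+u. indicator (- C) (\<theta>0 + u / sqrt (real n)) * ennreal (\<nu> u) \<partial>lborel)"
    by (rule emeasure_N[symmetric]) measurable
  also have "\<dots> = (\<integral>\<^sup>+u. indicator {u. L < \<bar>u\<bar>} u * ennreal (\<nu> u) \<partial>lborel)"
    by (intro nn_integral_cong) (use n in \<open>auto simp: C_def \<U>_def indicator_def\<close>)
  also have "\<dots> \<le> ennreal (4 * exp (- ((L - 2 * D / I) / (1 / sqrt I))))"
    unfolding \<nu>_def
  proof (rule normal_density_tail)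
    have "\<bar>\<zeta> - \<xi>\<bar> \<le> 2 * D" using W_\<gamma> W_f0 by (simp add: \<zeta>_def \<xi>_def)
    then show "\<bar>(\<zeta> - \<xi>) / I\<bar> \<le> 2 * D / I" using I by (simp add: abs_div divide_right_mono)
  qed (use I in simp)
  finally show ?thesis by simp
qed

text \<open>The sum of the logarithmic errors of one exchange with \<open>|s| \<le> 2 L\<close>:
  \<tau> from the density p, \<open>\<tau> (1 + s^2)\<close> from the shift density, and
  \<open>60 D^5 L^2 \<tau>\<close> from the likelihood.\<close>

definition "\<eta> = \<tau> * (2 + 4 * L\<^sup>2 + 60 * D ^ 5 * L\<^sup>2)"

text \<open>An approximate detailed balance. On the left \<theta> carries the posterior and
  \<open>\<theta> + s / sqrt n\<close> the normal density; on the right the roles are swapped. Only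
  the starting point is restricted to G, because the right side will be bounded through total
  mass.\<close>

lemma exchange_at_shift:
  assumes B [measurable]: "B \<in> sets borel" and sT: "\<theta>0 + s / sqrt (real n) \<in> T"
  shows "(\<integral>\<^sup>+q. wt q * (indicator G q * indicator (B \<inter> C) (fst q) * indicator C (fst q + s / sqrt (real n)) * ennreal (\<nu> (\<U> (fst q) + s))) \<partial>M)
    \<le> ennreal (exp \<eta>) * (\<integral>\<^sup>+q. wt q * (indicator (B \<inter> C) (fst q - s / sqrt (real n)) * indicator C (fst q) * ennreal (\<nu> (\<U> (fst q) - s))) \<partial>M)"
proof -
  define \<delta> where "\<delta> = s / sqrt (real n)"
  have \<delta>T: "\<theta>0 + \<delta> \<in> T" using sT by (simp add: \<delta>_def)
  have U\<delta>: "\<U> (\<theta>0 + \<delta>) = s" "\<U> (\<theta> + \<delta>) = \<U> \<theta> + s" for \<theta>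
    using sqrt_n(1) by (auto simp: \<U>_def \<delta>_def algebra_simps)
  define F where "F q = wt q * (indicator (B \<inter> C) (fst q - \<delta>) * indicator C (fst q) * ennreal (\<nu> (\<U> (fst q) - s)))" for q
  have [measurable]: "F \<in> borel_measurable (borel \<Otimes>\<^sub>M borel)" unfolding F_def[abs_def] by measurable
  have [measurable]: "r (\<theta>0 + \<delta>) \<in> borel_measurable \<pi>f" using shift[OF \<delta>T] by (simp add: shift_density_def)
  have "(\<integral>\<^sup>+q. wt q * (indicator G q * indicator (B \<inter> C) (fst q) * indicator C (fst q + \<delta>) * ennreal (\<nu> (\<U> (fst q) + s))) \<partial>M)
     \<le> (\<integral>\<^sup>+q. ennreal (exp \<eta>) * (F (\<delta> + 1 * fst q, snd q - \<delta> *\<^sub>R w) * r (\<theta>0 + \<delta>) (snd q)) \<partial>M)"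
  proof (rule nn_integral_mono_AE)
    show "AE q in M. wt q * (indicator G q * indicator (B \<inter> C) (fst q) * indicator C (fst q + \<delta>) * ennreal (\<nu> (\<U> (fst q) + s)))
       \<le> ennreal (exp \<eta>) * (F (\<delta> + 1 * fst q, snd q - \<delta> *\<^sub>R w) * r (\<theta>0 + \<delta>) (snd q))"
      using AE_good AE_affine[OF AE_good, of 1 \<delta>, simplified]
    proof eventually_elim
      case (elim q)
      obtain \<theta> f where q: "q = (\<theta>, f)" by force
      show ?case
      proof (cases "q \<in> G \<and> \<theta> \<in> B \<and> \<theta> \<in> C \<and> \<theta> + \<delta> \<in> C")
        case True
        define \<theta>' where "\<theta>' = \<theta> + \<delta>"
        have E: "norm (f - f0) \<le> \<tau>" "f \<in> H" using True by (auto simp: q G_def)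
        have \<theta>: "\<bar>\<theta> - \<theta>0\<bar> \<le> L / sqrt (real n)" "\<bar>\<theta>' - \<theta>0\<bar> \<le> L / sqrt (real n)"
          using True in_C_le by (auto simp: \<theta>'_def)
        then have in_\<Theta>: "\<theta> \<in> \<Theta>" "\<theta>' \<in> \<Theta>" using \<Theta>_nbhd L(2) by auto
        have g: "good \<theta> f" "good \<theta>' f" "good_dir \<theta>'" using elim in_\<Theta> by (auto simp: q \<theta>'_def add.commute)
        have U: "\<bar>\<U> \<theta>\<bar> \<le> L" "\<bar>\<U> \<theta>'\<bar> \<le> L" using True by (auto simp: C_def \<theta>'_def)
        have "\<bar>ell \<theta>' (f - (s / sqrt (real n)) *\<^sub>R w) - ell \<theta> f - (s * (\<zeta> - \<xi>) - (k2 - c1) * (\<U> \<theta> * s + s\<^sup>2 / 2))\<bar> \<le> 60 * D ^ 5 * L\<^sup>2 * \<tau>"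
          by (rule step_exchange[OF g E(1) bias[OF E(2)] _ U L \<tau>_small(1)]) (simp add: \<theta>'_def \<delta>_def)
        then have ell: "ell \<theta> f + (s * (\<zeta> - \<xi>) - I * (\<U> \<theta> * s + s\<^sup>2 / 2)) \<le> 60 * D ^ 5 * L\<^sup>2 * \<tau> + ell \<theta>' (f - \<delta> *\<^sub>R w)"
          unfolding \<delta>_def I_def by linarith
        have pp: "p \<theta> \<le> exp \<tau> * p \<theta>'" using p_close[OF \<theta>] by (simp add: exp_minus field_simps)
        have s2: "s\<^sup>2 \<le> 4 * L\<^sup>2"
        proof -
          have "\<bar>s\<bar> \<le> \<bar>2 * L\<bar>" using U L(1) by (simp add: \<theta>'_def U\<delta>)
          then have "s\<^sup>2 \<le> (2 * L)\<^sup>2" by (simp add: abs_le_square_iff)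
          then show ?thesis by (simp add: power_mult_distrib)
        qed
        have "c * p \<theta> * exp (ell \<theta> f) * \<nu> (\<U> \<theta> + s) = \<nu> (\<U> \<theta>) * (c * p \<theta>) * exp (ell \<theta> f + (s * (\<zeta> - \<xi>) - I * (\<U> \<theta> * s + s\<^sup>2 / 2)))"
          unfolding \<nu>_shift exp_add by (simp only: mult_ac)
        also have "\<dots> \<le> \<nu> (\<U> \<theta>) * (c * (exp \<tau> * p \<theta>')) * exp (60 * D ^ 5 * L\<^sup>2 * \<tau> + ell \<theta>' (f - \<delta> *\<^sub>R w))"
          using c pp ell \<nu>_nonneg p_bounds[OF in_\<Theta>(1)] p_bounds[OF in_\<Theta>(2)] pl by (intro mult_mono mult_nonneg_nonneg) auto
        also have "\<dots> = exp (\<tau> + 60 * D ^ 5 * L\<^sup>2 * \<tau>) * ((c * p \<theta>' * exp (ell \<theta>' (f - \<delta> *\<^sub>R w))) * \<nu> (\<U> \<theta>))"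
          unfolding exp_add by (simp only: mult_ac)
        also have "\<dots> \<le> exp (\<eta> + - \<tau> * (1 + s\<^sup>2)) * ((c * p \<theta>' * exp (ell \<theta>' (f - \<delta> *\<^sub>R w))) * \<nu> (\<U> \<theta>))"
        proof (intro mult_right_mono mult_nonneg_nonneg)
          have "\<tau> * s\<^sup>2 \<le> \<tau> * (4 * L\<^sup>2)" using s2 \<tau> by (rule mult_left_mono)
          then show "exp (\<tau> + 60 * D ^ 5 * L\<^sup>2 * \<tau>) \<le> exp (\<eta> + - \<tau> * (1 + s\<^sup>2))"
            by (simp add: \<eta>_def algebra_simps)
        qed (use c \<nu>_nonneg p_bounds[OF in_\<Theta>(2)] pl in auto)
        also have "\<dots> = exp \<eta> * ((c * p \<theta>' * exp (ell \<theta>' (f - \<delta> *\<^sub>R w))) * \<nu> (\<U> \<theta>) * exp (- \<tau> * (1 + s\<^sup>2)))"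
          unfolding exp_add by (simp only: mult_ac)
        finally have "ennreal (c * p \<theta> * exp (ell \<theta> f) * \<nu> (\<U> \<theta> + s))
           \<le> ennreal (exp \<eta> * ((c * p \<theta>' * exp (ell \<theta>' (f - \<delta> *\<^sub>R w))) * \<nu> (\<U> \<theta>) * exp (- \<tau> * (1 + s\<^sup>2))))"
          by (rule ennreal_leI)
        also have "\<dots> = ennreal (exp \<eta>) * (ennreal (c * p \<theta>' * exp (ell \<theta>' (f - \<delta> *\<^sub>R w))) * ennreal (\<nu> (\<U> \<theta>)) * ennreal (exp (- \<tau> * (1 + s\<^sup>2))))"
        proof -
          have "0 \<le> c * p \<theta>' * exp (ell \<theta>' (f - \<delta> *\<^sub>R w))" using c p_bounds[OF in_\<Theta>(2)] pl by simp
          then show ?thesis by (simp only: ennreal_mult \<nu>_nonneg exp_ge_zero mult_nonneg_nonneg)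
        qed
        also have "\<dots> \<le> ennreal (exp \<eta>) * (ennreal (c * p \<theta>' * exp (ell \<theta>' (f - \<delta> *\<^sub>R w))) * ennreal (\<nu> (\<U> \<theta>)) * r (\<theta>0 + \<delta>) f)"
          using r_ge[OF \<delta>T E(2)] unfolding U\<delta>(1) by (intro mult_left_mono) auto
        finally have "ennreal (c * p \<theta> * exp (ell \<theta> f) * \<nu> (\<U> \<theta> + s)) \<le> \<dots>" .
        moreover have "ennreal (c * p \<theta> * exp (ell \<theta> f) * \<nu> (\<U> \<theta> + s)) = ennreal (c * p \<theta> * exp (ell \<theta> f)) * ennreal (\<nu> (\<U> \<theta> + s))"
          using c \<nu>_nonneg p_bounds[OF in_\<Theta>(1)] pl by (intro ennreal_mult) auto
        ultimately show ?thesis using True in_\<Theta> by (simp add: q F_def wt_def \<theta>'_def add.commute[of \<delta>] U\<delta>)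
      next
        case False
        then show ?thesis by (auto simp: q indicator_def)
      qed
    qed
  qed
  also have "\<dots> = ennreal (exp \<eta>) * (\<integral>\<^sup>+q. F (\<delta> + 1 * fst q, snd q - \<delta> *\<^sub>R w) * r (\<theta>0 + \<delta>) (snd q) \<partial>M)"
    by (rule nn_integral_cmult) measurable
  \<comment> \<open>Weighting by r undoes the shift of f, and translation invariance of Lebesgue
    measure undoes that of \<theta>.\<close>
  also have "(\<integral>\<^sup>+q. F (\<delta> + 1 * fst q, snd q - \<delta> *\<^sub>R w) * r (\<theta>0 + \<delta>) (snd q) \<partial>M) = (\<integral>\<^sup>+q. F (\<delta> + 1 * fst q, snd q) \<partial>M)"
    using shift_integral[OF _ \<delta>T, of "\<lambda>q. F (\<delta> + 1 * fst q, snd q)"] by simp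
  also have "\<dots> = (\<integral>\<^sup>+q. F q \<partial>M)"
    using affine_integral[of F 1 \<delta>] by simp
  finally show ?thesis by (simp add: F_def \<delta>_def)
qed

end

section \<open>Comparison of the posterior with the normal law at a good observation\<close>

context bvm_setting
begin

interpretation \<pi>f: prob_space \<pi>f by (rule \<pi>f)
interpretation P: pair_sigma_finite lborel \<pi>f ..
interpretation post: prob_space post by (rule prob_post)
interpretation N: prob_space N by (rule prob_N)
interpretation S: pair_sigma_finite lborel M ..

lemma \<nu>_integral:
  assumes B [measurable]: "B \<in> sets borel" and \<epsilon>: "\<epsilon> = 1 \<or> \<epsilon> = -1"
  shows "(\<integral>\<^sup>+s. indicator B (\<theta> + \<epsilon> * s / sqrt (real n)) * ennreal (\<nu> (\<U> \<theta> + \<epsilon> * s)) \<partial>lborel) = emeasure N B"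
proof -
  have eq: "\<theta> + \<epsilon> * s / sqrt (real n) = \<theta>0 + (\<U> \<theta> + \<epsilon> * s) / sqrt (real n)" for s
    using sqrt_n(1) by (simp add: \<U>_def add_divide_distrib)
  have "emeasure N B = (\<integral>\<^sup>+u. indicator B (\<theta>0 + u / sqrt (real n)) * ennreal (\<nu> u) \<partial>lborel)"
    by (rule emeasure_N[symmetric]) measurable
  also have "\<dots> = ennreal \<bar>\<epsilon>\<bar> * (\<integral>\<^sup>+s. indicator B (\<theta>0 + (\<U> \<theta> + \<epsilon> * s) / sqrt (real n)) * ennreal (\<nu> (\<U> \<theta> + \<epsilon> * s)) \<partial>lborel)"
    using \<epsilon> by (intro nn_integral_real_affine) auto
  finally show ?thesis using \<epsilon> unfolding eq by auto
qed

text \<open>Averaging the exchange of \<open>\<theta>\<close> with a draw from the normal law over all shifts.\<close>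

lemma exchange:
  assumes B [measurable]: "B \<in> sets borel"
  shows "emeasure post (G \<inter> (B \<inter> C) \<times> UNIV) * emeasure N C \<le> ennreal (exp \<eta>) * emeasure N B + ennreal (sqrt I * \<tau>)"
proof -
  define h1 where "h1 s q = wt q * (indicator G q * indicator (B \<inter> C) (fst q) * indicator C (fst q + s / sqrt (real n)) * ennreal (\<nu> (\<U> (fst q) + s)))" for s q
  define h2 where "h2 s q = wt q * (indicator (B \<inter> C) (fst q - s / sqrt (real n)) * indicator C (fst q) * ennreal (\<nu> (\<U> (fst q) - s)))" for s q
  \<comment> \<open>The shifts without an exchange. Only \<open>|s| \<le> 2 L\<close> counts, since
    \<theta> and \<open>\<theta> + s / sqrt n\<close> both lie in C.\<close>
  define Bad where "Bad = {s. \<bar>s\<bar> \<le> 2 * L \<and> \<theta>0 + s / sqrt (real n) \<notin> T}"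
  have [measurable]: "Bad \<in> sets borel" unfolding Bad_def by measurable
  have [measurable]: "(\<lambda>(s, q). h1 s q) \<in> borel_measurable (lborel \<Otimes>\<^sub>M M)"
    "(\<lambda>(s, q). h2 s q) \<in> borel_measurable (lborel \<Otimes>\<^sub>M M)"
    unfolding h1_def h2_def by measurable
  \<comment> \<open>With \<theta> fixed, integration over s makes
    \<open>\<theta> + s / sqrt n\<close> a draw from \<open>N\<close>, so the inner integral yields
    \<open>emeasure N C\<close>.\<close>
  have X: "(\<integral>\<^sup>+s. \<integral>\<^sup>+q. h1 s q \<partial>M \<partial>lborel) = emeasure post (G \<inter> (B \<inter> C) \<times> UNIV) * emeasure N C"
  proof -
    have "(\<integral>\<^sup>+s. \<integral>\<^sup>+q. h1 s q \<partial>M \<partial>lborel) = (\<integral>\<^sup>+q. \<integral>\<^sup>+s. h1 s q \<partial>lborel \<partial>M)"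
      by (rule S.Fubini'[symmetric]) measurable
    also have "\<dots> = (\<integral>\<^sup>+q. wt q * indicator (G \<inter> (B \<inter> C) \<times> UNIV) q * emeasure N C \<partial>M)"
    proof (rule nn_integral_cong)
      fix q :: "real \<times> 'h"
      have "(\<integral>\<^sup>+s. h1 s q \<partial>lborel) = (\<integral>\<^sup>+s. wt q * (indicator G q * indicator (B \<inter> C) (fst q)) *
          (indicator C (fst q + 1 * s / sqrt (real n)) * ennreal (\<nu> (\<U> (fst q) + 1 * s))) \<partial>lborel)"
        unfolding h1_def by (simp add: mult.assoc)
      also have "\<dots> = wt q * (indicator G q * indicator (B \<inter> C) (fst q)) * emeasure N C"
      proof -
        have "(\<lambda>s. indicator C (t + 1 * s / sqrt (real n)) * ennreal (\<nu> (u + 1 * s))) \<in> borel_measurable lborel" for t u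
          by measurable
        from nn_integral_cmult[OF this[of "fst q" "\<U> (fst q)"]] \<nu>_integral[OF C_measurable, of 1 "fst q"] show ?thesis by simp
      qed
      also have "(indicator G q * indicator (B \<inter> C) (fst q) :: ennreal) = indicator (G \<inter> (B \<inter> C) \<times> UNIV) q"
        by (auto simp: indicator_def mem_Times_iff)
      finally show "(\<integral>\<^sup>+s. h1 s q \<partial>lborel) = wt q * indicator (G \<inter> (B \<inter> C) \<times> UNIV) q * emeasure N C" .
    qed
    also have "\<dots> = (\<integral>\<^sup>+q. wt q * indicator (G \<inter> (B \<inter> C) \<times> UNIV) q \<partial>M) * emeasure N C"
      by (rule nn_integral_multc) measurable
    also have "(\<integral>\<^sup>+q. wt q * indicator (G \<inter> (B \<inter> C) \<times> UNIV) q \<partial>M) = emeasure post (G \<inter> (B \<inter> C) \<times> UNIV)"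
      by (rule emeasure_post[symmetric]) measurable
    finally show ?thesis .
  qed
  \<comment> \<open>Here the normal law carries the starting point
    \<open>\<theta> - s / sqrt n\<close>, which must lie in B, while the posterior of the end point
    contributes at most its total mass 1.\<close>
  have Y: "(\<integral>\<^sup>+s. \<integral>\<^sup>+q. h2 s q \<partial>M \<partial>lborel) \<le> emeasure N B"
  proof -
    have "(\<integral>\<^sup>+s. \<integral>\<^sup>+q. h2 s q \<partial>M \<partial>lborel) = (\<integral>\<^sup>+q. \<integral>\<^sup>+s. h2 s q \<partial>lborel \<partial>M)"
      by (rule S.Fubini'[symmetric]) measurable
    also have "\<dots> \<le> (\<integral>\<^sup>+q. wt q * emeasure N B \<partial>M)"
    proof (rule nn_integral_mono)
      fix q :: "real \<times> 'h"
      have "(\<integral>\<^sup>+s. h2 s q \<partial>lborel) \<le> (\<integral>\<^sup>+s. wt q *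
          (indicator B (fst q + -1 * s / sqrt (real n)) * ennreal (\<nu> (\<U> (fst q) + -1 * s))) \<partial>lborel)"
        unfolding h2_def by (intro nn_integral_mono mult_left_mono) (auto simp: indicator_def)
      also have "\<dots> = wt q * emeasure N B"
      proof -
        have "(\<lambda>s. indicator B (t + -1 * s / sqrt (real n)) * ennreal (\<nu> (u + -1 * s))) \<in> borel_measurable lborel" for t u
          by measurable
        from nn_integral_cmult[OF this[of "fst q" "\<U> (fst q)"]] \<nu>_integral[OF B, of "-1" "fst q"] show ?thesis by simp
      qed
      finally show "(\<integral>\<^sup>+s. h2 s q \<partial>lborel) \<le> wt q * emeasure N B" .
    qed
    also have "\<dots> = emeasure N B"
      by (subst nn_integral_multc) (simp_all add: nn_integral_wt)
    finally show ?thesis .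
  qed
  have pointwise: "(\<integral>\<^sup>+q. h1 s q \<partial>M) \<le> ennreal (exp \<eta>) * (\<integral>\<^sup>+q. h2 s q \<partial>M) + ennreal (sqrt I) * indicator Bad s" for s
  proof (cases "\<theta>0 + s / sqrt (real n) \<in> T")
    case True
    from exchange_at_shift[OF B True] show ?thesis
      unfolding h1_def h2_def by (rule order_trans) simp
  next
    case False
    have "(\<integral>\<^sup>+q. h1 s q \<partial>M) \<le> (\<integral>\<^sup>+q. wt q * (ennreal (sqrt I) * indicator Bad s) \<partial>M)"
    proof (intro nn_integral_mono)
      fix q :: "real \<times> 'h"
      have U: "\<U> (fst q + s / sqrt (real n)) = \<U> (fst q) + s"
        using sqrt_n(1) by (simp add: \<U>_def algebra_simps)
      have "s \<in> Bad" if "fst q \<in> C" "fst q + s / sqrt (real n) \<in> C"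
        using that False unfolding Bad_def C_def mem_Collect_eq U by auto
      then show "h1 s q \<le> wt q * (ennreal (sqrt I) * indicator Bad s)"
        unfolding h1_def using \<nu>_le by (intro mult_left_mono) (auto simp: indicator_def intro!: ennreal_leI)
    qed
    also have "\<dots> = ennreal (sqrt I) * indicator Bad s"
      by (subst nn_integral_multc) (simp_all add: nn_integral_wt)
    finally show ?thesis by (simp add: add_increasing)
  qed
  have "emeasure post (G \<inter> (B \<inter> C) \<times> UNIV) * emeasure N C
      \<le> (\<integral>\<^sup>+s. ennreal (exp \<eta>) * (\<integral>\<^sup>+q. h2 s q \<partial>M) + ennreal (sqrt I) * indicator Bad s \<partial>lborel)"
    unfolding X[symmetric] by (intro nn_integral_mono pointwise)
  also have "\<dots> = ennreal (exp \<eta>) * (\<integral>\<^sup>+s. \<integral>\<^sup>+q. h2 s q \<partial>M \<partial>lborel) + ennreal (sqrt I) * emeasure lborel Bad"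
    by (subst nn_integral_add) (simp_all add: nn_integral_cmult nn_integral_cmult_indicator)
  also have "\<dots> \<le> ennreal (exp \<eta>) * emeasure N B + ennreal (sqrt I) * ennreal \<tau>"
    using Y T_large unfolding Bad_def by (intro add_mono mult_left_mono) auto
  finally show ?thesis using I \<tau> by (simp add: ennreal_mult)
qed

text \<open>In order: the exchange error, the shifts outside T, the posterior mass outside G, the
  normal mass outside C, and the two bounds for the posterior mass in G with
  \<open>|\<U> \<theta>| > L\<close>.\<close>

definition "err = (exp \<eta> - 1) + sqrt I * \<tau> + \<tau> + 4 * exp (- ((L - 2 * D / I) * sqrt I))
   + 2 * exp (4 * D ^ 4 + 2 - I / 8 * L) + 2 * pu / pl * exp (- (I\<^sup>2 / (16 * k2) * L\<^sup>2))"

lemma one_sided: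
  assumes B [measurable]: "B \<in> sets borel" and L_large: "96 * D * k2 \<le> I\<^sup>2 * L"
    and G: "measure post G \<ge> 1 - \<tau>"
  shows "measure post (B \<times> UNIV) \<le> measure N B + err"
proof -
  define \<kappa>0 where "\<kappa>0 = 4 * exp (- ((L - 2 * D / I) * sqrt I))"
  define \<kappa>1 where "\<kappa>1 = 2 * exp (4 * D ^ 4 + 2 - I / 8 * L) + 2 * pu / pl * exp (- (I\<^sup>2 / (16 * k2) * L\<^sup>2))"
  have \<kappa>1_0: "0 \<le> \<kappa>1" using p_bounds[OF \<theta>0] pl by (simp add: \<kappa>1_def divide_nonneg_pos)
  define x where "x = measure post (G \<inter> (B \<inter> C) \<times> UNIV)"
  have sp: "space post = UNIV" using sets_eq_imp_space_eq[OF sets_post] by (simp add: space_pair_measure)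
  have Gs: "G \<in> sets post" "(B \<inter> C) \<times> UNIV \<in> sets post" "B \<times> UNIV \<in> sets post" by measurable
  have "{q \<in> space (borel \<Otimes>\<^sub>M borel). q \<in> G \<and> L < \<bar>\<U> (fst q)\<bar>} \<in> sets (borel \<Otimes>\<^sub>M borel)" by measurable
  then have Fs: "{q \<in> G. L < \<bar>\<U> (fst q)\<bar>} \<in> sets post" by (simp add: space_pair_measure sets_post Collect_conj_eq)
  have far: "measure post {q \<in> G. L < \<bar>\<U> (fst q)\<bar>} \<le> \<kappa>1"
    using far_mass[OF L_large] \<kappa>1_0 by (simp add: post.emeasure_eq_measure \<kappa>1_def)
  have outG: "measure post (UNIV - G) \<le> \<tau>" using G post.prob_compl[OF Gs(1)] by (simp add: sp)
  have NC: "measure N C \<ge> 1 - \<kappa>0"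
  proof -
    have "measure N (- C) \<le> \<kappa>0" using N_outside_C by (simp add: N.emeasure_eq_measure \<kappa>0_def)
    moreover have "measure N (space N - C) = 1 - measure N C" by (rule N.prob_compl) (simp add: sets_N)
    moreover have "space N = UNIV" using sets_eq_imp_space_eq[OF sets_N] by simp
    ultimately show ?thesis by (simp add: Compl_eq_Diff_UNIV)
  qed
  have "B \<times> UNIV \<subseteq> (G \<inter> (B \<inter> C) \<times> UNIV) \<union> {q \<in> G. L < \<bar>\<U> (fst q)\<bar>} \<union> (UNIV - G)"
    by (auto simp: C_def)
  then have "measure post (B \<times> UNIV) \<le> measure post ((G \<inter> (B \<inter> C) \<times> UNIV) \<union> {q \<in> G. L < \<bar>\<U> (fst q)\<bar>} \<union> (UNIV - G))"
    using Gs Fs by (intro post.finite_measure_mono) (auto simp: sp[symmetric])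
  also have "\<dots> \<le> measure post ((G \<inter> (B \<inter> C) \<times> UNIV) \<union> {q \<in> G. L < \<bar>\<U> (fst q)\<bar>}) + measure post (UNIV - G)"
    using Gs Fs by (intro measure_Un_le) (auto simp: sp[symmetric])
  also have "\<dots> \<le> x + measure post {q \<in> G. L < \<bar>\<U> (fst q)\<bar>} + measure post (UNIV - G)"
    unfolding x_def using Gs Fs by (intro add_right_mono measure_Un_le) auto
  finally have 1: "measure post (B \<times> UNIV) \<le> x + \<kappa>1 + \<tau>" using far outG by linarith
  have "ennreal (x * measure N C) \<le> ennreal (exp \<eta> * measure N B + sqrt I * \<tau>)"
    using exchange[OF B] I \<tau>
    by (simp add: post.emeasure_eq_measure N.emeasure_eq_measure x_def ennreal_mult ennreal_plus)
  then have 2: "x * measure N C \<le> exp \<eta> * measure N B + sqrt I * \<tau>"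
    using I \<tau> by (subst (asm) ennreal_le_iff) (auto intro!: add_nonneg_nonneg)
  \<comment> \<open>No division by \<open>measure N C\<close> takes place: since
    \<open>x \<le> 1\<close>, x differs from \<open>x * measure N C\<close> by at most
    \<kappa>0.\<close>
  have "x * (1 - measure N C) \<le> 1 * \<kappa>0"
    using NC by (intro mult_mono) (auto simp: x_def \<kappa>0_def)
  moreover have "(exp \<eta> - 1) * measure N B \<le> (exp \<eta> - 1) * 1"
    using \<tau> L D by (intro mult_left_mono) (auto simp: \<eta>_def)
  ultimately have "x \<le> measure N B + (exp \<eta> - 1) + sqrt I * \<tau> + \<kappa>0"
    using 2 by (simp add: algebra_simps)
  with 1 show ?thesis unfolding err_def \<kappa>0_def \<kappa>1_def by linarith
qed

lemma posterior_close_to_normal: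
  assumes B: "B \<in> sets borel" and L_large: "96 * D * k2 \<le> I\<^sup>2 * L" and G: "measure post G \<ge> 1 - \<tau>"
  shows "\<bar>measure post (B \<times> UNIV) - measure N B\<bar> \<le> err"
proof -
  have sp: "space post = UNIV" using sets_eq_imp_space_eq[OF sets_post] by (simp add: space_pair_measure)
  have sN: "space N = UNIV" using sets_eq_imp_space_eq[OF sets_N] by simp
  have "B \<times> UNIV \<in> sets post" using B by measurable
  then have "measure post (UNIV - B \<times> UNIV) = 1 - measure post (B \<times> UNIV)" using post.prob_compl by (simp add: sp)
  moreover have "UNIV - B \<times> UNIV = (- B) \<times> (UNIV :: 'h set)" by auto
  moreover have "measure N (UNIV - B) = 1 - measure N B" using N.prob_compl[of B] B by (simp add: sN sets_N)
  ultimately show ?thesis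
    using one_sided[OF B L_large G] one_sided[of "- B", OF _ L_large G] B by (simp add: Compl_eq_Diff_UNIV abs_le_iff)
qed

end

section \<open>Consequences of the hypotheses on \<open>\<Theta>\<close>, \<open>\<Theta>\<^sub>n\<close> and \<open>K\<close>\<close>

text \<open>Baire's theorem provides an interval from x to b of local parameters u with
  \<open>\<theta>0 + \<sigma> * u / sqrt n \<in> \<Theta>\<close> for all n from some N on. Divided
  by \<open>sqrt n\<close>, these intervals overlap for consecutive n once
  \<open>n (b^2 - x^2) \<ge> b^2\<close>, so together they cover a one-sided neighbourhood. The
  range from 1 to 2 keeps x away from 0.\<close>

lemma one_sided_neighbourhood:
  fixes \<Theta> :: "real set"
  assumes closed: "closed \<Theta>" and ex: "\<And>u. \<exists>N\<ge>1. \<forall>n\<ge>N. \<theta>0 + u / sqrt (real n) \<in> \<Theta>"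
    and \<sigma>: "\<sigma> = 1 \<or> \<sigma> = -1"
  shows "\<exists>\<epsilon>>0. \<forall>t. 0 < t \<and> t < \<epsilon> \<longrightarrow> \<theta>0 + \<sigma> * t \<in> \<Theta>"
proof -
  define A where "A N = {1..2} \<inter> (\<Inter>n\<in>{N..}. (\<lambda>u. \<theta>0 + \<sigma> / sqrt (real n) * u) -` \<Theta>)" for N :: nat
  have clA: "closed (A N)" for N
    unfolding A_def by (intro closed_Int closed_INT ballI closed_vimage[OF closed] continuous_intros)
  have union: "{1..2} \<subseteq> (\<Union>N. A N)"
  proof
    fix u :: real assume u: "u \<in> {1..2}"
    obtain N where "\<forall>n\<ge>N. \<theta>0 + (\<sigma> * u) / sqrt (real n) \<in> \<Theta>" using ex by blast
    then show "u \<in> (\<Union>N. A N)" using u by (auto simp: A_def)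
  qed
  have "\<exists>N. interior (A N) \<noteq> {}"
  proof (rule ccontr)
    assume "\<nexists>N. interior (A N) \<noteq> {}"
    then have "euclidean interior_of \<Union>(range A) = {}"
      by (intro Baire_category_alt disjI1 completely_metrizable_space_euclidean) (auto simp: clA)
    then have "interior (\<Union>N. A N) = {}" by simp
    moreover have "interior {1..2::real} \<subseteq> interior (\<Union>N. A N)" by (rule interior_mono[OF union])
    ultimately show False by simp
  qed
  then obtain N x where "x \<in> interior (A N)" by blast
  then obtain e where e: "e > 0" "cball x e \<subseteq> A N" by (auto simp: mem_interior_cball)
  define b where "b = x + e"
  have x1: "x \<ge> 1" using subsetD[OF e(2), of x] e(1) by (simp add: A_def)
  have xb: "u \<in> A N" if "x \<le> u" "u \<le> b" for u
    using e that by (intro subsetD[OF e(2)]) (auto simp: b_def dist_real_def)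
  have bx: "x\<^sup>2 < b\<^sup>2" using x1 e by (intro power_strict_mono) (auto simp: b_def)
  obtain m :: nat where m: "m \<ge> N" "m \<ge> 1" "real m * (b\<^sup>2 - x\<^sup>2) \<ge> b\<^sup>2"
  proof -
    obtain k :: nat where "real k * (b\<^sup>2 - x\<^sup>2) > b\<^sup>2" using reals_Archimedean3[of "b\<^sup>2 - x\<^sup>2"] bx by auto
    moreover have "real k * (b\<^sup>2 - x\<^sup>2) \<le> real (max (max k N) 1) * (b\<^sup>2 - x\<^sup>2)" using bx by (intro mult_right_mono) auto
    ultimately show thesis using that[of "max (max k N) 1"] by auto
  qed
  have "\<theta>0 + \<sigma> * t \<in> \<Theta>" if t: "0 < t" "t < x / sqrt (real m)" for t
  proof -
    \<comment> \<open>The least n with \<open>x \<le> t * sqrt n\<close>; by the overlap condition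
      on m it also satisfies \<open>t * sqrt n \<le> b\<close>.\<close>
    define n where "n = nat \<lceil>(x / t)\<^sup>2\<rceil>"
    have n_ge: "(x / t)\<^sup>2 \<le> real n" and n_lt: "real n < (x / t)\<^sup>2 + 1"
      unfolding n_def by (auto simp: of_nat_nat) linarith+
    have "sqrt (real m) < x / t" using t m(2) by (simp add: field_simps)
    then have "(sqrt (real m))\<^sup>2 < (x / t)\<^sup>2" by (rule power_strict_mono) auto
    then have "real m < (x / t)\<^sup>2" by simp
    then have mn: "m \<le> n" using n_ge by linarith
    have n0: "real n > 0" using mn m(2) by simp
    have "x \<le> t * sqrt (real n)"
    proof -
      have "x / t \<le> sqrt (real n)" using n_ge by (rule real_le_rsqrt)
      then show ?thesis using t by (simp add: field_simps)
    qed
    moreover have "t * sqrt (real n) \<le> b"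
    proof -
      have "real m * (b\<^sup>2 - x\<^sup>2) \<le> real n * (b\<^sup>2 - x\<^sup>2)" using mn bx by (intro mult_right_mono) auto
      then have "b\<^sup>2 \<le> real n * (b\<^sup>2 - x\<^sup>2)" using m(3) by linarith
      then have "(real n - 1) * b\<^sup>2 \<ge> real n * x\<^sup>2" by (simp add: algebra_simps)
      moreover have "(real n - 1) * t\<^sup>2 \<le> x\<^sup>2" using n_lt t by (simp add: power_divide field_simps)
      ultimately have "real n * ((real n - 1) * t\<^sup>2) \<le> (real n - 1) * b\<^sup>2"
        using mult_left_mono[of "(real n - 1) * t\<^sup>2" "x\<^sup>2" "real n"] by linarith
      moreover have "real n > 1"
      proof -
        have "real n * x\<^sup>2 \<le> (real n - 1) * b\<^sup>2" using \<open>(real n - 1) * b\<^sup>2 \<ge> real n * x\<^sup>2\<close> .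
        moreover have "real n * x\<^sup>2 > 0" using n0 x1 by simp
        ultimately have "(real n - 1) * b\<^sup>2 > 0" by linarith
        then show ?thesis by (simp add: zero_less_mult_iff)
      qed
      ultimately have "(t * sqrt (real n))\<^sup>2 \<le> b\<^sup>2"
        by (simp add: power_mult_distrib mult.left_commute[of "real n"] mult.commute)
      then show ?thesis using x1 e by (auto simp: b_def intro: power2_le_imp_le)
    qed
    ultimately have "t * sqrt (real n) \<in> A N" by (rule xb)
    then have "t * sqrt (real n) \<in> (\<lambda>u. \<theta>0 + \<sigma> / sqrt (real n) * u) -` \<Theta>"
      unfolding A_def by (meson IntD2 INT_D atLeast_iff order_trans mn m(1))
    then show ?thesis using n0 by simp
  qed
  moreover have "x / sqrt (real m) > 0" using x1 m(2) by simp
  ultimately show ?thesis by blast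
qed

lemma neighbourhood_of_exhaustion:
  fixes \<Theta> :: "real set"
  assumes "closed \<Theta>" "\<And>u. \<exists>N\<ge>1. \<forall>n\<ge>N. \<theta>0 + u / sqrt (real n) \<in> \<Theta>"
  shows "\<exists>\<epsilon>>0. \<forall>\<theta>. \<bar>\<theta> - \<theta>0\<bar> \<le> \<epsilon> \<longrightarrow> \<theta> \<in> \<Theta>"
proof -
  obtain \<epsilon>1 where \<epsilon>1: "\<epsilon>1 > 0" "\<And>t. 0 < t \<Longrightarrow> t < \<epsilon>1 \<Longrightarrow> \<theta>0 + t \<in> \<Theta>"
    using one_sided_neighbourhood[OF assms, where \<sigma>=1] by auto
  obtain \<epsilon>2 where \<epsilon>2: "\<epsilon>2 > 0" "\<And>t. 0 < t \<Longrightarrow> t < \<epsilon>2 \<Longrightarrow> \<theta>0 - t \<in> \<Theta>"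
    using one_sided_neighbourhood[OF assms, where \<sigma>="-1"] by auto
  have 0: "\<theta>0 \<in> \<Theta>" using assms(2)[of 0] by auto
  have "\<theta> \<in> \<Theta>" if "\<bar>\<theta> - \<theta>0\<bar> \<le> min \<epsilon>1 \<epsilon>2 / 2" for \<theta>
    using \<epsilon>1(2)[of "\<theta> - \<theta>0"] \<epsilon>2(2)[of "\<theta>0 - \<theta>"] 0 \<epsilon>1(1) \<epsilon>2(1) that
    by (cases \<theta> \<theta>0 rule: linorder_cases) (auto simp: min_def split: if_splits)
  then show ?thesis using \<epsilon>1(1) \<epsilon>2(1) by (intro exI[of _ "min \<epsilon>1 \<epsilon>2 / 2"]) auto
qed

lemma opnorm_intoD:
  assumes S: "norm_on S nS" and A: "opnorm_into S nS A \<le> ereal c"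
  shows "blinfun_apply A h \<in> S" "nS (blinfun_apply A h) \<le> c * norm h"
proof -
  have unit: "blinfun_apply A g \<in> S \<and> nS (blinfun_apply A g) \<le> c" if "norm g \<le> 1" for g
  proof -
    have "(if blinfun_apply A g \<in> S then ereal (nS (blinfun_apply A g)) else \<infinity>) \<le> opnorm_into S nS A"
      unfolding opnorm_into_def by (rule SUP_upper) (use that in simp)
    then have "(if blinfun_apply A g \<in> S then ereal (nS (blinfun_apply A g)) else \<infinity>) \<le> ereal c"
      using A by (rule order_trans)
    then show ?thesis by (auto split: if_splits)
  qed
  have sub: "subspace S" and scale: "\<And>c h. h \<in> S \<Longrightarrow> nS (c *\<^sub>R h) = \<bar>c\<bar> * nS h" and zero: "nS 0 = 0"
    using S by (auto simp: norm_on_def subspace_0)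
  define g where "g = (1 / norm h) *\<^sub>R h"
  show "blinfun_apply A h \<in> S" "nS (blinfun_apply A h) \<le> c * norm h"
  proof (atomize (full), cases "h = 0")
    case True
    then show "blinfun_apply A h \<in> S \<and> nS (blinfun_apply A h) \<le> c * norm h"
      using sub by (simp add: subspace_0 zero)
  next
    case False
    have g: "blinfun_apply A g \<in> S" "nS (blinfun_apply A g) \<le> c" using unit[of g] False by (auto simp: g_def)
    have h: "h = norm h *\<^sub>R g" using False by (simp add: g_def)
    have "blinfun_apply A h = norm h *\<^sub>R blinfun_apply A g" by (subst h) (simp add: blinfun.scaleR_right)
    then show "blinfun_apply A h \<in> S \<and> nS (blinfun_apply A h) \<le> c * norm h"
      using g sub mult_left_mono[OF g(2), of "norm h"] by (simp add: subspace_scale scale mult.commute)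
  qed
qed

text \<open>Differentiability gives continuity in \<theta> only at each fixed f; the uniform bound
  on the operator norms makes it joint. Joint continuity is the source of the measurability of the
  likelihood in \<theta> and f.\<close>

lemma continuous_on_operator_family:
  fixes K K' :: "real \<Rightarrow> 'h::real_normed_vector \<Rightarrow>\<^sub>L 'h"
  assumes deriv: "\<And>\<theta> f. \<theta> \<in> \<Theta> \<Longrightarrow> ((\<lambda>s. (blinfun_apply (K (\<theta> + s)) f - blinfun_apply (K \<theta>) f) /\<^sub>R s)
        \<longlongrightarrow> blinfun_apply (K' \<theta>) f) (at 0 within {s. \<theta> + s \<in> \<Theta>})"
    and bounded: "\<And>\<theta>. \<theta> \<in> \<Theta> \<Longrightarrow> norm (K \<theta>) \<le> D"
  shows "continuous_on (\<Theta> \<times> UNIV) (\<lambda>q. blinfun_apply (K (fst q)) (snd q))"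
proof -
  have cont: "continuous_on \<Theta> (\<lambda>\<theta>. blinfun_apply (K \<theta>) f)" for f
    unfolding continuous_on_iff
  proof (intro ballI allI impI)
    fix \<theta> e :: real assume \<theta>: "\<theta> \<in> \<Theta>" and e: "0 < e"
    have "((\<lambda>s. s *\<^sub>R ((blinfun_apply (K (\<theta> + s)) f - blinfun_apply (K \<theta>) f) /\<^sub>R s)) \<longlongrightarrow> 0 *\<^sub>R blinfun_apply (K' \<theta>) f) (at 0 within {s. \<theta> + s \<in> \<Theta>})"
      by (intro tendsto_scaleR deriv \<theta> tendsto_ident_at)
    from tendstoD[OF this e]
    have "\<forall>\<^sub>F s in at 0 within {s. \<theta> + s \<in> \<Theta>}. dist (s *\<^sub>R ((blinfun_apply (K (\<theta> + s)) f - blinfun_apply (K \<theta>) f) /\<^sub>R s)) 0 < e"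
      by (simp only: scaleR_zero_left)
    then obtain d where d: "d > 0" "\<And>s. \<theta> + s \<in> \<Theta> \<Longrightarrow> s \<noteq> 0 \<Longrightarrow> \<bar>s\<bar> < d \<Longrightarrow> norm (s *\<^sub>R ((blinfun_apply (K (\<theta> + s)) f - blinfun_apply (K \<theta>) f) /\<^sub>R s)) < e"
      unfolding eventually_at by auto
    have "dist (blinfun_apply (K \<theta>') f) (blinfun_apply (K \<theta>) f) < e" if "\<theta>' \<in> \<Theta>" "dist \<theta>' \<theta> < d" for \<theta>'
      using d(2)[of "\<theta>' - \<theta>"] that e by (cases "\<theta>' = \<theta>") (auto simp: dist_norm dist_real_def)
    then show "\<exists>d>0. \<forall>\<theta>'\<in>\<Theta>. dist \<theta>' \<theta> < d \<longrightarrow> dist (blinfun_apply (K \<theta>') f) (blinfun_apply (K \<theta>) f) < e"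
      using d(1) by blast
  qed
  show ?thesis
    unfolding continuous_on_iff
  proof (intro ballI allI impI)
    fix q :: "real \<times> 'h" and e :: real assume q: "q \<in> \<Theta> \<times> UNIV" and e: "0 < e"
    obtain \<theta> f where qq: "q = (\<theta>, f)" "\<theta> \<in> \<Theta>" using q by auto
    define B where "B = \<bar>D\<bar> + 1"
    have B: "B > 0" by (simp add: B_def)
    obtain d where d: "d > 0" "\<And>\<theta>'. \<theta>' \<in> \<Theta> \<Longrightarrow> dist \<theta>' \<theta> < d \<Longrightarrow> dist (blinfun_apply (K \<theta>') f) (blinfun_apply (K \<theta>) f) < e / 2"
      using cont[of f] qq(2) e unfolding continuous_on_iff by (meson half_gt_zero)
    have "dist (blinfun_apply (K (fst q')) (snd q')) (blinfun_apply (K \<theta>) f) < e"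
      if q': "q' \<in> \<Theta> \<times> UNIV" "dist q' q < min d (e / (2 * B))" for q'
    proof -
      have 1: "dist (fst q') \<theta> < d" using dist_fst_le[of q' q] q'(2) by (simp add: qq)
      have 2: "dist (snd q') f < e / (2 * B)" using dist_snd_le[of q' q] q'(2) by (simp add: qq)
      have "dist (blinfun_apply (K (fst q')) (snd q')) (blinfun_apply (K (fst q')) f) = norm (blinfun_apply (K (fst q')) (snd q' - f))"
        by (simp add: dist_norm blinfun.diff_right)
      also have "\<dots> \<le> B * norm (snd q' - f)"
      proof (rule order_trans[OF norm_blinfun mult_right_mono])
        show "norm (K (fst q')) \<le> B" using bounded[of "fst q'"] q'(1) by (auto simp: B_def)
      qed simp
      also have "\<dots> < B * (e / (2 * B))" using 2 B by (intro mult_strict_left_mono) (auto simp: dist_norm)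
      also have "\<dots> = e / 2" using B by simp
      finally have "dist (blinfun_apply (K (fst q')) (snd q')) (blinfun_apply (K (fst q')) f) < e / 2" .
      moreover have "dist (blinfun_apply (K (fst q')) f) (blinfun_apply (K \<theta>) f) < e / 2" using d(2) 1 q'(1) by auto
      ultimately show ?thesis
        using dist_triangle[of "blinfun_apply (K (fst q')) (snd q')" "blinfun_apply (K \<theta>) f" "blinfun_apply (K (fst q')) f"] by linarith
    qed
    then show "\<exists>d>0. \<forall>q'\<in>\<Theta> \<times> UNIV. dist q' q < d \<longrightarrow> dist (blinfun_apply (K (fst q')) (snd q')) (blinfun_apply (K (fst q)) (snd q)) < e"
      using d(1) e B by (intro exI[of _ "min d (e / (2 * B))"]) (auto simp: qq)
  qed
qed

lemma (in white_noise) AE_bound_norm_on: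
  assumes S: "norm_on S nS" and h: "h \<in> S"
    and bound: "\<And>h. h \<in> S \<Longrightarrow> nS h \<le> 1 \<Longrightarrow> AE x in P. x \<in> \<Omega> \<longrightarrow> \<bar>W x h\<bar> \<le> m"
  shows "AE x in P. x \<in> \<Omega> \<longrightarrow> \<bar>W x h\<bar> \<le> m * nS h"
proof (cases "h = 0")
  case True
  have "W x 0 = 0" for x using W_scale[OF subspace_0[OF subspace_D], of x 0] by simp
  moreover have "nS 0 = 0" using S by (auto simp: norm_on_def subspace_0)
  ultimately show ?thesis using True by simp
next
  case False
  then have nh: "nS h > 0" and scale: "\<And>c. nS (c *\<^sub>R h) = \<bar>c\<bar> * nS h" and sub: "subspace S"
    using S h by (auto simp: norm_on_def less_le)
  define g where "g = (1 / nS h) *\<^sub>R h"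
  have "AE x in P. x \<in> \<Omega> \<longrightarrow> \<bar>W x g\<bar> \<le> m"
    using nh h sub by (intro bound) (auto simp: g_def scale subspace_scale)
  then show ?thesis using AE_D[of h]
  proof eventually_elim
    case (elim x)
    then show ?case using nh by (simp add: g_def W_scale abs_mult pos_divide_le_eq)
  qed
qed

text \<open>The covering event \<open>B\<close> makes it unnecessary to show that the total variation distance is measurable in the data.\<close>

definition rare :: "(nat \<Rightarrow> 'x measure) \<Rightarrow> real \<Rightarrow> (nat \<Rightarrow> 'x \<Rightarrow> bool) \<Rightarrow> bool" where
  "rare P \<eta> A \<longleftrightarrow> (\<forall>\<^sub>F n in sequentially. \<exists>B\<in>sets (P n). emeasure (P n) B \<le> ennreal \<eta> \<and> {x \<in> space (P n). A n x} \<subseteq> B)"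

section \<open>Calculus of exceptional events and exhaustion by local parameter sets\<close>

lemma rare_disj:
  assumes "rare P \<eta>1 A1" "rare P \<eta>2 A2" "0 \<le> \<eta>1" "0 \<le> \<eta>2"
  shows "rare P (\<eta>1 + \<eta>2) (\<lambda>n x. A1 n x \<or> A2 n x)"
  using assms(1,2) unfolding rare_def
proof eventually_elim
  case (elim n)
  then obtain B1 B2 where B: "B1 \<in> sets (P n)" "emeasure (P n) B1 \<le> ennreal \<eta>1" "{x \<in> space (P n). A1 n x} \<subseteq> B1"
    "B2 \<in> sets (P n)" "emeasure (P n) B2 \<le> ennreal \<eta>2" "{x \<in> space (P n). A2 n x} \<subseteq> B2" by blast
  have "emeasure (P n) (B1 \<union> B2) \<le> emeasure (P n) B1 + emeasure (P n) B2"
    using B by (intro emeasure_subadditive)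
  also have "\<dots> \<le> ennreal (\<eta>1 + \<eta>2)" using B assms(3,4) by (simp add: ennreal_plus add_mono)
  finally show ?case using B by (intro bexI[of _ "B1 \<union> B2"]) auto
qed

lemma rare_mono:
  assumes "rare P \<eta> A" "\<forall>\<^sub>F n in sequentially. \<forall>x\<in>space (P n). A' n x \<longrightarrow> A n x"
  shows "rare P \<eta> A'"
  using assms unfolding rare_def by eventually_elim blast

lemma tendsto_in_prob_imp_rare:
  assumes "tendsto_in_prob P Y c" "0 < \<epsilon>" "0 < \<eta>"
  shows "rare P \<eta> (\<lambda>n x. \<epsilon> < \<bar>Y n x - c\<bar>)"
proof -
  have "(\<lambda>n. outer_measure_of (P n) {x \<in> space (P n). \<epsilon> < \<bar>Y n x - c\<bar>}) \<longlonglongrightarrow> 0"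
    using assms by (simp add: tendsto_in_prob_def)
  then have "\<forall>\<^sub>F n in sequentially. outer_measure_of (P n) {x \<in> space (P n). \<epsilon> < \<bar>Y n x - c\<bar>} < ennreal \<eta>"
    by (rule order_tendstoD) (use assms in simp)
  then show ?thesis unfolding rare_def
  proof eventually_elim
    case (elim n)
    obtain B where "B \<in> sets (P n)" "{x \<in> space (P n). \<epsilon> < \<bar>Y n x - c\<bar>} \<subseteq> B"
      "outer_measure_of (P n) {x \<in> space (P n). \<epsilon> < \<bar>Y n x - c\<bar>} = emeasure (P n) B"
      using outer_measure_of_attain[of "{x \<in> space (P n). \<epsilon> < \<bar>Y n x - c\<bar>}" "P n"] by auto
    then show ?case using elim by (intro bexI[of _ B]) auto
  qed
qed

lemma rare_imp_tendsto_in_prob: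
  assumes "\<And>\<epsilon> \<eta>. 0 < \<epsilon> \<Longrightarrow> 0 < \<eta> \<Longrightarrow> rare P \<eta> (\<lambda>n x. \<epsilon> < \<bar>Y n x - c\<bar>)"
  shows "tendsto_in_prob P Y c"
  unfolding tendsto_in_prob_def
proof (intro allI impI order_tendstoI)
  fix \<epsilon> :: real and a :: ennreal assume \<epsilon>: "0 < \<epsilon>" and a: "0 < a"
  obtain \<eta> where \<eta>: "0 < \<eta>" "ennreal \<eta> < a"
  proof (cases a)
    case (real b)
    then show thesis using that[of "b / 2"] a by (auto simp: ennreal_less_iff)
  next
    case top
    then show thesis using that[of 1] by simp
  qed
  show "\<forall>\<^sub>F n in sequentially. outer_measure_of (P n) {x \<in> space (P n). \<epsilon> < \<bar>Y n x - c\<bar>} < a"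
    using assms[OF \<epsilon> \<eta>(1)] unfolding rare_def
  proof eventually_elim
    case (elim n)
    then obtain B where "B \<in> sets (P n)" "emeasure (P n) B \<le> ennreal \<eta>" "{x \<in> space (P n). \<epsilon> < \<bar>Y n x - c\<bar>} \<subseteq> B" by blast
    then have "outer_measure_of (P n) {x \<in> space (P n). \<epsilon> < \<bar>Y n x - c\<bar>} \<le> ennreal \<eta>"
      using outer_measure_of_mono[of _ B "P n"] by (metis order_trans outer_measure_of_eq)
    then show ?case using \<eta>(2) by (rule le_less_trans)
  qed
qed simp

text \<open>The families are indexed by \<open>Suc n\<close> because at \<open>n = 0\<close> the
  local scale \<open>sqrt n\<close> degenerates.\<close>

lemma eventually_exhaust:
  assumes mono: "\<And>n. n \<ge> 1 \<Longrightarrow> (\<lambda>\<theta>. sqrt (real n) * (\<theta> - \<theta>0)) ` T n \<subseteq> (\<lambda>\<theta>. sqrt (real (Suc n)) * (\<theta> - \<theta>0)) ` T (Suc n)"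
    and ex: "(\<Union>n\<in>{1..}. (\<lambda>\<theta>. sqrt (real n) * (\<theta> - \<theta>0)) ` T n) = UNIV"
  shows "incseq (\<lambda>n. {s. \<theta>0 + s / sqrt (real (Suc n)) \<in> T (Suc n)})"
    and "(\<Union>n. {s. \<theta>0 + s / sqrt (real (Suc n)) \<in> T (Suc n)}) = UNIV"
proof -
  have eq: "{s. \<theta>0 + s / sqrt (real (Suc n)) \<in> T (Suc n)} = (\<lambda>\<theta>. sqrt (real (Suc n)) * (\<theta> - \<theta>0)) ` T (Suc n)" for n
  proof (intro equalityI subsetI)
    fix s assume "s \<in> {s. \<theta>0 + s / sqrt (real (Suc n)) \<in> T (Suc n)}"
    then show "s \<in> (\<lambda>\<theta>. sqrt (real (Suc n)) * (\<theta> - \<theta>0)) ` T (Suc n)"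
      by (intro image_eqI[of _ _ "\<theta>0 + s / sqrt (real (Suc n))"]) (auto simp del: of_nat_Suc)
  qed (auto simp del: of_nat_Suc)
  show "incseq (\<lambda>n. {s. \<theta>0 + s / sqrt (real (Suc n)) \<in> T (Suc n)})"
    unfolding eq by (intro incseq_SucI mono) simp
  show "(\<Union>n. {s. \<theta>0 + s / sqrt (real (Suc n)) \<in> T (Suc n)}) = UNIV"
  proof -
    have "s \<in> (\<Union>n. (\<lambda>\<theta>. sqrt (real (Suc n)) * (\<theta> - \<theta>0)) ` T (Suc n))" for s
    proof -
      obtain n where "n \<ge> 1" "s \<in> (\<lambda>\<theta>. sqrt (real n) * (\<theta> - \<theta>0)) ` T n" using ex by blast
      then obtain k where "n = Suc k" by (cases n) auto
      then show ?thesis using \<open>s \<in> _\<close> by (intro UN_I[of k]) simp_all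
    qed
    then show ?thesis unfolding eq by blast
  qed
qed

text \<open>The exhaustion is pointwise in s, so a bounded range need not be contained in any single
  set. Continuity of Lebesgue measure from above still makes the missing part small.\<close>

lemma exhaust_measure:
  assumes T: "\<And>n. T n \<in> sets borel" and inc: "incseq (\<lambda>n. {s. \<theta>0 + s / sqrt (real (Suc n)) \<in> T (Suc n)})"
    and un: "(\<Union>n. {s. \<theta>0 + s / sqrt (real (Suc n)) \<in> T (Suc n)}) = UNIV" and \<tau>: "0 < \<tau>"
  shows "\<forall>\<^sub>F n in sequentially. emeasure lborel {s. \<bar>s\<bar> \<le> R \<and> \<theta>0 + s / sqrt (real n) \<notin> T n} \<le> ennreal \<tau>"
proof -
  define A where "A n = {s. \<bar>s\<bar> \<le> R \<and> \<theta>0 + s / sqrt (real (Suc n)) \<notin> T (Suc n)}" for n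
  have [measurable]: "T n \<in> sets borel" for n by (rule T)
  have Am: "A n \<in> sets lborel" for n unfolding A_def by measurable
  have "(\<lambda>n. emeasure lborel (A n)) \<longlonglongrightarrow> emeasure lborel (\<Inter>n. A n)"
  proof (rule Lim_emeasure_decseq)
    show "decseq A" using inc unfolding A_def decseq_def incseq_def by blast
    have "emeasure lborel (A n) \<le> emeasure lborel {-R..R}" for n
      by (intro emeasure_mono) (auto simp: A_def)
    also have "\<dots> < \<infinity>" by (simp add: emeasure_lborel_Icc_eq)
    finally show "emeasure lborel (A n) \<noteq> \<infinity>" for n by (metis less_irrefl)
  qed (use Am in auto)
  moreover have "(\<Inter>n. A n) = {}" using un by (auto simp: A_def set_eq_iff)
  ultimately have "(\<lambda>n. emeasure lborel (A n)) \<longlonglongrightarrow> 0" by simp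
  then have "\<forall>\<^sub>F n in sequentially. emeasure lborel (A n) < ennreal \<tau>"
    by (rule order_tendstoD) (use \<tau> in simp)
  then have "\<forall>\<^sub>F n in sequentially. emeasure lborel {s. \<bar>s\<bar> \<le> R \<and> \<theta>0 + s / sqrt (real (Suc n)) \<notin> T (Suc n)} \<le> ennreal \<tau>"
    unfolding A_def by eventually_elim simp
  then show ?thesis by (subst (asm) eventually_sequentially_Suc)
qed

section \<open>The posterior and the good event\<close>

locale bvm_model =
  fixes \<Theta> :: "real set" and \<theta>0 :: real and e :: "nat \<Rightarrow> 'h :: {real_inner, polish_space}" and f0 :: 'h
    and K K' :: "real \<Rightarrow> 'h \<Rightarrow>\<^sub>L 'h" and p :: "real \<Rightarrow> real" and \<pi>f :: "'h measure"
    and S :: "'h set" and nS :: "'h \<Rightarrow> real" and D0 D1 D2 :: real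
  assumes Theta: "compact \<Theta>" "\<theta>0 \<in> \<Theta>"
    and basis: "orthonormal_basis e"
    and prior_theta: "prob_space (theta_prior \<Theta> p)" "continuous_on \<Theta> p"
      "\<exists>c C. 0 < c \<and> (\<forall>\<theta>\<in>\<Theta>. c \<le> p \<theta> \<and> p \<theta> \<le> C)"
    and prior_f: "prob_space \<pi>f" "sets \<pi>f = sets borel"
    and S_norm: "norm_on S nS" "\<exists>C. \<forall>h\<in>S. norm h \<le> C * nS h"
    and entropy: "(\<integral>\<^sup>+\<epsilon>\<in>{0<..1}. sqrt_log (covering_number \<epsilon> {h\<in>S. nS h \<le> 1}) \<partial>lborel) < \<infinity>"
    and derivative: "\<And>\<theta> f. \<theta> \<in> \<Theta> \<Longrightarrow>
      ((\<lambda>s. (blinfun_apply (K (\<theta> + s)) f - blinfun_apply (K \<theta>) f) /\<^sub>R s)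
        \<longlongrightarrow> blinfun_apply (K' \<theta>) f) (at 0 within {s. \<theta> + s \<in> \<Theta>})"
    and bounded: "\<And>\<theta>. \<theta> \<in> \<Theta> \<Longrightarrow> norm (K \<theta>) \<le> D0 \<and> norm (K' \<theta>) \<le> D0"
    and lipschitz: "\<And>\<theta>. \<theta> \<in> \<Theta> \<Longrightarrow> opnorm_into S nS (K \<theta> - K \<theta>0) \<le> ereal (D1 * \<bar>\<theta> - \<theta>0\<bar>)"
    and quadratic: "\<And>\<theta>. \<theta> \<in> \<Theta> \<Longrightarrow>
      opnorm_into S nS (K \<theta> - K \<theta>0 - (\<theta> - \<theta>0) *\<^sub>R K' \<theta>0) \<le> ereal (D2 * (\<theta> - \<theta>0)\<^sup>2)"
begin

abbreviation "prior \<equiv> theta_prior \<Theta> p \<Otimes>\<^sub>M \<pi>f"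
abbreviation "lprior \<equiv> lborel \<Otimes>\<^sub>M \<pi>f"
abbreviation "noise1 n x \<equiv> noise_pairing e n f0 (fst x)"
abbreviation "noise2 n x \<equiv> noise_pairing e n (blinfun_apply (K \<theta>0) f0) (snd x)"

definition "llr n x \<theta> f = sqrt (real n) * noise1 n x f + sqrt (real n) * noise2 n x (blinfun_apply (K \<theta>) f)
   - real n / 2 * (norm (f - f0))\<^sup>2 - real n / 2 * (norm (blinfun_apply (K \<theta>) f - blinfun_apply (K \<theta>0) f0))\<^sup>2"

text \<open>Nothing is assumed about \<open>K \<theta>\<close> for \<open>\<theta>\<close> outside \<open>\<Theta>\<close>, not even measurability in \<open>\<theta>\<close>.\<close>

definition "\<kappa> q = (if fst q \<in> \<Theta> then blinfun_apply (K (fst q)) (snd q) else 0)"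

interpretation \<pi>f: prob_space \<pi>f by (rule prior_f)
interpretation \<pi>\<theta>: prob_space "theta_prior \<Theta> p" by (rule prior_theta)
interpretation Q: pair_prob_space "theta_prior \<Theta> p" \<pi>f ..

lemma \<Theta>_borel [measurable]: "\<Theta> \<in> sets borel"
  using compact_imp_closed[OF Theta(1)] by simp

lemma sets_\<pi>f [measurable_cong]: "sets \<pi>f = sets borel" by (rule prior_f)

lemma sets_M [measurable_cong]: "sets lprior = sets (borel \<Otimes>\<^sub>M borel)"
  using sets_pair_measure_cong[OF sets_lborel sets_\<pi>f] .

lemma space_\<pi>f [simp]: "space \<pi>f = UNIV"
  using sets_eq_imp_space_eq[OF sets_\<pi>f] by simp

lemma space_theta_prior [simp]: "space (theta_prior \<Theta> p) = \<Theta>"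
  by (simp add: theta_prior_def space_restrict_space)

lemma space_prior: "space prior = \<Theta> \<times> UNIV"
  by (simp add: space_pair_measure)

lemma \<kappa>_measurable [measurable]: "\<kappa> \<in> borel_measurable (borel \<Otimes>\<^sub>M borel)"
proof -
  have "continuous_on (\<Theta> \<times> UNIV) (\<lambda>q. blinfun_apply (K (fst q)) (snd q))"
    using derivative bounded by (intro continuous_on_operator_family[where K'=K' and D=D0]) auto
  then have "(\<lambda>q. indicator (\<Theta> \<times> UNIV) q *\<^sub>R blinfun_apply (K (fst q)) (snd q)) \<in> borel_measurable borel"
    by (intro borel_measurable_continuous_on_indicator borel_closed closed_Times[OF compact_imp_closed[OF Theta(1)] closed_UNIV])
  also have "(\<lambda>q. indicator (\<Theta> \<times> UNIV) q *\<^sub>R blinfun_apply (K (fst q)) (snd q)) = \<kappa>"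
    by (auto simp: \<kappa>_def indicator_def mem_Times_iff fun_eq_iff)
  finally show ?thesis by (simp add: borel_prod)
qed

lemma p_measurable [measurable]: "(\<lambda>\<theta>. indicator \<Theta> \<theta> * p \<theta>) \<in> borel_measurable borel"
  using borel_measurable_continuous_on_indicator[OF \<Theta>_borel prior_theta(2)] by simp

lemma wt_measurable:
  "(\<lambda>q. ennreal (c * p (fst q) * exp (llr n x (fst q) (snd q))) * indicator \<Theta> (fst q)) \<in> borel_measurable (borel \<Otimes>\<^sub>M borel)"
proof -
  define l where "l q = sqrt (real n) * noise1 n x (snd q) + sqrt (real n) * noise2 n x (\<kappa> q)
   - real n / 2 * (norm (snd q - f0))\<^sup>2 - real n / 2 * (norm (\<kappa> q - blinfun_apply (K \<theta>0) f0))\<^sup>2" for q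
  have "(\<lambda>q. y) \<in> measurable (borel \<Otimes>\<^sub>M borel) (\<Pi>\<^sub>M k\<in>UNIV. (borel :: real measure))" for y
    by (rule measurable_const) (simp add: space_PiM)
  then have [measurable]: "l \<in> borel_measurable (borel \<Otimes>\<^sub>M borel)"
    unfolding l_def[abs_def] noise_pairing_def by measurable
  have "(\<lambda>q. ennreal (c * p (fst q) * exp (llr n x (fst q) (snd q))) * indicator \<Theta> (fst q))
     = (\<lambda>q. ennreal (c * (indicator \<Theta> (fst q) * p (fst q)) * exp (l q)))"
    by (auto simp: llr_def l_def \<kappa>_def indicator_def fun_eq_iff)
  also have "\<dots> \<in> borel_measurable (borel \<Otimes>\<^sub>M borel)" by measurable
  finally show ?thesis .
qed

lemma fst_prior_measurable: "fst \<in> measurable prior borel"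
proof -
  have "(\<lambda>x. x) \<in> measurable (theta_prior \<Theta> p) borel"
    unfolding theta_prior_def by (simp add: measurable_restrict_space1)
  from measurable_compose[OF measurable_fst this] show ?thesis .
qed

lemma prior_measurable: "(\<lambda>q. q) \<in> measurable prior (borel \<Otimes>\<^sub>M borel)"
proof -
  have "snd \<in> measurable prior borel" by measurable
  from measurable_Pair[OF fst_prior_measurable this] show ?thesis by simp
qed

text \<open>Passes from the prior, which lives on subsets of \<Theta>, to Lebesgue measure on the
  line, where translations and dilations of \<theta> are available.\<close>

lemma nn_integral_prior:
  fixes F :: "real \<times> 'h \<Rightarrow> ennreal"
  assumes F [measurable]: "F \<in> borel_measurable (borel \<Otimes>\<^sub>M borel)"
  shows "(\<integral>\<^sup>+q. F q \<partial>prior) = (\<integral>\<^sup>+q. F q * ennreal (indicator \<Theta> (fst q) * p (fst q)) \<partial>lprior)"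
proof -
  have "F \<in> borel_measurable prior" using measurable_compose[OF prior_measurable F] .
  then have "(\<integral>\<^sup>+q. F q \<partial>prior) = (\<integral>\<^sup>+\<theta>. (\<integral>\<^sup>+f. F (\<theta>, f) \<partial>\<pi>f) \<partial>theta_prior \<Theta> p)"
    by (simp add: \<pi>f.nn_integral_fst)
  also have "\<dots> = (\<integral>\<^sup>+\<theta>. ennreal (p \<theta>) * (\<integral>\<^sup>+f. F (\<theta>, f) \<partial>\<pi>f) \<partial>restrict_space lborel \<Theta>)"
    unfolding theta_prior_def
  proof (rule nn_integral_density)
    have "p \<in> borel_measurable (restrict_space borel \<Theta>)"
      by (rule borel_measurable_continuous_on_restrict[OF prior_theta(2)])
    then show "(\<lambda>\<theta>. ennreal (p \<theta>)) \<in> borel_measurable (restrict_space lborel \<Theta>)"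
      by (simp add: measurable_cong_sets[OF sets_restrict_space_cong[OF sets_lborel] refl])
    have "(\<lambda>\<theta>. \<integral>\<^sup>+f. F (\<theta>, f) \<partial>\<pi>f) \<in> borel_measurable lborel" by measurable
    then show "(\<lambda>\<theta>. \<integral>\<^sup>+f. F (\<theta>, f) \<partial>\<pi>f) \<in> borel_measurable (restrict_space lborel \<Theta>)"
      by (rule measurable_restrict_space1)
  qed
  also have "\<dots> = (\<integral>\<^sup>+\<theta>. (ennreal (p \<theta>) * (\<integral>\<^sup>+f. F (\<theta>, f) \<partial>\<pi>f)) * indicator \<Theta> \<theta> \<partial>lborel)"
    by (rule nn_integral_restrict_space) simp
  also have "\<dots> = (\<integral>\<^sup>+\<theta>. (\<integral>\<^sup>+f. F (\<theta>, f) * ennreal (indicator \<Theta> \<theta> * p \<theta>) \<partial>\<pi>f) \<partial>lborel)"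
    by (intro nn_integral_cong, subst nn_integral_multc) (auto simp: indicator_def mult.commute)
  also have "\<dots> = (\<integral>\<^sup>+q. F q * ennreal (indicator \<Theta> (fst q) * p (fst q)) \<partial>lprior)"
    by (subst \<pi>f.nn_integral_fst[symmetric]) simp_all
  finally show ?thesis .
qed

text \<open>Completing the squares around the true means. The first factor is free of \<theta> and f
  and drops out of the posterior.\<close>

lemma likelihood_eq:
  assumes n: "n \<ge> 1"
  shows "likelihood e K n x \<theta> f
    = exp (real n / 2 * ((norm f0)\<^sup>2 + (norm (blinfun_apply (K \<theta>0) f0))\<^sup>2)) * exp (llr n x \<theta> f)"
proof -
  have *: "real n * pairing e y h = sqrt (real n) * noise_pairing e n g y h + real n * (g \<bullet> h)" for y g h
  proof -
    have "sqrt (real n) * noise_pairing e n g y h = (sqrt (real n) * sqrt (real n)) * (pairing e y h - g \<bullet> h)"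
      by (simp only: noise_pairing_def mult.assoc)
    then show ?thesis by (simp add: algebra_simps)
  qed
  have sq: "(norm (h - g))\<^sup>2 = (norm h)\<^sup>2 - 2 * (g \<bullet> h) + (norm g)\<^sup>2" for g h :: 'h
    unfolding power2_norm_eq_inner by (simp add: inner_diff_left inner_diff_right inner_commute[of h g])
  show ?thesis
    unfolding likelihood_def llr_def exp_add[symmetric] sq
      *[of "fst x" f f0] *[of "snd x" "blinfun_apply (K \<theta>) f" "blinfun_apply (K \<theta>0) f0"]
    by (simp add: algebra_simps add_divide_distrib)
qed

text \<open>If the normalising constant is infinite, then \<^const>\<open>bayes\<close> gives the zero measure;
  the posterior is a probability measure as soon as some set has positive mass.\<close>

lemma posterior_density:
  assumes n: "n \<ge> 1" and pos: "measure (posterior e K (theta_prior \<Theta> p) \<pi>f n x) A > 0"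
  obtains c where "c > 0"
    "prob_space (density lprior (\<lambda>q. ennreal (c * p (fst q) * exp (llr n x (fst q) (snd q))) * indicator \<Theta> (fst q)))"
    "\<And>E. E \<in> sets (borel \<Otimes>\<^sub>M borel) \<Longrightarrow>
      measure (posterior e K (theta_prior \<Theta> p) \<pi>f n x) (E \<inter> \<Theta> \<times> UNIV)
      = measure (density lprior (\<lambda>q. ennreal (c * p (fst q) * exp (llr n x (fst q) (snd q))) * indicator \<Theta> (fst q))) E"
    "\<And>E. E \<in> sets (borel \<Otimes>\<^sub>M borel) \<Longrightarrow> E \<inter> \<Theta> \<times> UNIV \<in> sets (posterior e K (theta_prior \<Theta> p) \<pi>f n x)"
    "finite_measure (posterior e K (theta_prior \<Theta> p) \<pi>f n x)"
proof -
  define C where "C = exp (real n / 2 * ((norm f0)\<^sup>2 + (norm (blinfun_apply (K \<theta>0) f0))\<^sup>2))"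
  have C: "C > 0" by (simp add: C_def)
  define Lk where "Lk = (\<lambda>(\<theta>, f). likelihood e K n x \<theta> f)"
  have Lk: "Lk q = C * exp (llr n x (fst q) (snd q))" for q
    by (simp add: Lk_def C_def split_beta likelihood_eq[OF n])
  have Lk_pos: "Lk q > 0" for q using C by (simp add: Lk)
  obtain pl pu where pl: "0 < pl" "\<And>\<theta>. \<theta> \<in> \<Theta> \<Longrightarrow> pl \<le> p \<theta> \<and> p \<theta> \<le> pu" using prior_theta(3) by blast
  define g where "g q = ennreal (Lk q) * indicator \<Theta> (fst q)" for q
  have g_meas [measurable]: "g \<in> borel_measurable (borel \<Otimes>\<^sub>M borel)"
  proof -
    have eq: "g = (\<lambda>q. (ennreal (C * p (fst q) * exp (llr n x (fst q) (snd q))) * indicator \<Theta> (fst q)) * ennreal (1 / (indicator \<Theta> (fst q) * p (fst q))))"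
    proof
      fix q
      show "g q = (ennreal (C * p (fst q) * exp (llr n x (fst q) (snd q))) * indicator \<Theta> (fst q)) * ennreal (1 / (indicator \<Theta> (fst q) * p (fst q)))"
        using pl(1) pl(2)[of "fst q"] C by (cases "fst q \<in> \<Theta>") (auto simp: g_def Lk ennreal_mult[symmetric])
    qed
    show ?thesis unfolding eq using wt_measurable[of C n x] by measurable
  qed
  have prior_g: "ennreal (Lk q) = g q" if "q \<in> space prior" for q
    using that by (auto simp: g_def space_prior)
  have Lk_meas: "(\<lambda>q. ennreal (Lk q)) \<in> borel_measurable prior"
    by (subst measurable_cong[OF prior_g]) (auto intro: measurable_compose[OF prior_measurable g_meas])
  define Z where "Z = (\<integral>\<^sup>+q. ennreal (Lk q) \<partial>prior)"
  define post where "post = posterior e K (theta_prior \<Theta> p) \<pi>f n x"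
  have post: "post = density prior (\<lambda>q. ennreal (Lk q) / Z)"
    by (simp add: post_def posterior_def bayes_def Lk_def Z_def split_beta')
  have sets_post: "sets post = sets prior" by (simp add: post)
  have em: "emeasure post A = (\<integral>\<^sup>+q. ennreal (Lk q) / Z * indicator A q \<partial>prior)" if "A \<in> sets prior" for A
    unfolding post using that Lk_meas by (subst emeasure_density) auto
  have "Z \<noteq> \<infinity>"
  proof
    assume "Z = \<infinity>"
    then have "emeasure post A = 0" using em[of A]
      by (cases "A \<in> sets prior") (simp_all add: emeasure_notin_sets sets_post)
    then show False using pos by (simp add: post_def[symmetric] measure_def)
  qed
  moreover have "Z \<noteq> 0"
  proof
    assume "Z = 0"
    then have "AE q in prior. ennreal (Lk q) = 0" unfolding Z_def using Lk_meas by (subst (asm) nn_integral_0_iff_AE)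
    moreover have "ennreal (Lk q) \<noteq> 0" for q using Lk_pos[of q] by simp
    ultimately have "AE q in prior. False" by simp
    then show False using Q.AE_False by simp
  qed
  ultimately obtain z where z: "z > 0" "Z = ennreal z" by (cases Z) auto
  define c where "c = C / z"
  have c: "c > 0" using C z by (simp add: c_def)
  define wt where "wt q = ennreal (c * p (fst q) * exp (llr n x (fst q) (snd q))) * indicator \<Theta> (fst q)" for q
  have wt_meas [measurable]: "wt \<in> borel_measurable (borel \<Otimes>\<^sub>M borel)" unfolding wt_def[abs_def] by (rule wt_measurable)
  have in_prior: "E \<inter> \<Theta> \<times> UNIV \<in> sets prior" if "E \<in> sets (borel \<Otimes>\<^sub>M borel)" for E
    using measurable_sets[OF prior_measurable that] by (simp add: space_prior)
  have main: "emeasure post (E \<inter> \<Theta> \<times> UNIV) = emeasure (density lprior wt) E" if E [measurable]: "E \<in> sets (borel \<Otimes>\<^sub>M borel)" for E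
  proof -
    have "emeasure post (E \<inter> \<Theta> \<times> UNIV) = (\<integral>\<^sup>+q. ennreal (Lk q) / Z * indicator (E \<inter> \<Theta> \<times> UNIV) q \<partial>prior)"
      by (rule em[OF in_prior[OF E]])
    also have "\<dots> = (\<integral>\<^sup>+q. g q / Z * indicator E q \<partial>prior)"
      by (intro nn_integral_cong) (auto simp: g_def space_prior indicator_def)
    also have "\<dots> = (\<integral>\<^sup>+q. g q / Z * indicator E q * ennreal (indicator \<Theta> (fst q) * p (fst q)) \<partial>lprior)"
      by (rule nn_integral_prior) measurable
    also have "\<dots> = (\<integral>\<^sup>+q. wt q * indicator E q \<partial>lprior)"
    proof (intro nn_integral_cong)
      fix q
      show "g q / Z * indicator E q * ennreal (indicator \<Theta> (fst q) * p (fst q)) = wt q * indicator E q"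
      proof (cases "fst q \<in> \<Theta> \<and> q \<in> E")
        case True
        then have "g q / Z * indicator E q * ennreal (indicator \<Theta> (fst q) * p (fst q)) = ennreal (Lk q) / ennreal z * ennreal (p (fst q))"
          by (simp add: g_def z)
        also have "\<dots> = ennreal (Lk q / z * p (fst q))"
        proof -
          have "ennreal (Lk q) / ennreal z = ennreal (Lk q / z)"
            using Lk_pos[of q] z(1) by (intro divide_ennreal) auto
          moreover have "ennreal (Lk q / z) * ennreal (p (fst q)) = ennreal (Lk q / z * p (fst q))"
            using Lk_pos[of q] z(1) pl(1) pl(2)[of "fst q"] True by (intro ennreal_mult[symmetric]) auto
          ultimately show ?thesis by simp
        qed
        also have "Lk q / z * p (fst q) = c * p (fst q) * exp (llr n x (fst q) (snd q))" by (simp add: Lk c_def)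
        finally show ?thesis using True by (simp add: wt_def)
      qed (auto simp: wt_def g_def)
    qed
    also have "\<dots> = emeasure (density lprior wt) E"
      by (subst emeasure_density) (auto simp: sets_M)
    finally show ?thesis .
  qed
  have total: "emeasure post (UNIV \<inter> \<Theta> \<times> UNIV) = 1"
  proof -
    have "emeasure post (space prior) = (\<integral>\<^sup>+q. ennreal (Lk q) / Z \<partial>prior)"
      by (subst em) (auto intro!: nn_integral_cong)
    also have "\<dots> = Z / Z" unfolding Z_def[symmetric] by (subst nn_integral_divide[OF Lk_meas]) (simp add: Z_def)
    also have "\<dots> = 1" using z by (simp add: divide_ennreal)
    finally show ?thesis by (simp add: space_prior)
  qed
  have "prob_space (density lprior wt)"
  proof
    have "space (density lprior wt) = UNIV" by (simp add: space_pair_measure)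
    moreover have "UNIV \<in> sets (borel \<Otimes>\<^sub>M borel :: (real \<times> 'h) measure)"
      using sets.top[of "borel \<Otimes>\<^sub>M borel :: (real \<times> 'h) measure"] by (simp add: space_pair_measure)
    then have "emeasure (density lprior wt) UNIV = 1" using main[of UNIV] total by simp
    ultimately show "emeasure (density lprior wt) (space (density lprior wt)) = 1" by simp
  qed
  moreover have "finite_measure post"
  proof
    show "emeasure post (space post) \<noteq> \<infinity>" using total by (simp add: post space_prior)
  qed
  ultimately show thesis
    using that[of c] c main in_prior unfolding wt_def[abs_def] post_def[symmetric] measure_def sets_post by simp
qed

text \<open>
  The noise is bounded almost surely at each fixed direction only; by Fubini's theorem, almost every
  observation satisfies the bound at almost every \<open>(\<theta>, f)\<close>, which suffices for the posterior.
\<close>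

lemma AE_increments:
  assumes n: "n \<ge> 1" and \<Omega>: "\<Omega> \<in> sets (obs_law e K n \<theta>0 f0)"
    and bound: "\<And>h. h \<in> S \<Longrightarrow> nS h \<le> 1 \<Longrightarrow> AE x in obs_law e K n \<theta>0 f0. x \<in> \<Omega> \<longrightarrow> \<bar>noise2 n x h\<bar> \<le> m"
    and m: "0 \<le> m" and D: "m * \<bar>D1\<bar> \<le> D" "m * \<bar>D2\<bar> * norm f0 \<le> D" "m * \<bar>D1\<bar> * norm w \<le> D"
  shows "AE x in obs_law e K n \<theta>0 f0. AE q in lprior. x \<in> \<Omega> \<and> fst q \<in> \<Theta> \<longrightarrow>
    snd q \<in> pairing_domain e (fst x) \<and> blinfun_apply (K \<theta>0) (snd q) \<in> pairing_domain e (snd x) \<and>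
    blinfun_apply (K (fst q)) (snd q) \<in> pairing_domain e (snd x) \<and>
    \<bar>noise2 n x (blinfun_apply (K (fst q)) (snd q) - blinfun_apply (K \<theta>0) (snd q) - (fst q - \<theta>0) *\<^sub>R blinfun_apply (K' \<theta>0) f0)\<bar>
      \<le> D * \<bar>fst q - \<theta>0\<bar> * (norm (snd q - f0) + \<bar>fst q - \<theta>0\<bar>) \<and>
    blinfun_apply (K (fst q)) w \<in> pairing_domain e (snd x) \<and>
    \<bar>noise2 n x (blinfun_apply (K (fst q)) w - blinfun_apply (K \<theta>0) w)\<bar> \<le> D * \<bar>fst q - \<theta>0\<bar>"
    (is "AE x in ?P. AE q in lprior. ?A x q")
proof -
  interpret W1: white_noise ?P "\<lambda>x. pairing_domain e (fst x)" "noise1 n" by (rule white_noise_fst[OF basis n])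
  interpret W2: white_noise ?P "\<lambda>x. pairing_domain e (snd x)" "noise2 n" by (rule white_noise_snd[OF basis n])
  interpret PM: pair_sigma_finite ?P lprior
    by (intro pair_sigma_finite.intro W1.sigma_finite_measure_axioms sigma_finite_pair_measure lborel.sigma_finite_measure_axioms \<pi>f.sigma_finite_measure_axioms)
  \<comment> \<open>With \<kappa> in place of \<open>K\<close> the statement is jointly measurable
    in x and q, as Fubini's theorem requires. It is equivalent because it only concerns
    \<open>fst q \<in> \<Theta>\<close>.\<close>
  define B where "B x q \<longleftrightarrow> (x \<in> \<Omega> \<and> fst q \<in> \<Theta> \<longrightarrow>
    snd q \<in> pairing_domain e (fst x) \<and> blinfun_apply (K \<theta>0) (snd q) \<in> pairing_domain e (snd x) \<and>
    \<kappa> q \<in> pairing_domain e (snd x) \<and>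
    \<bar>noise2 n x (\<kappa> q - blinfun_apply (K \<theta>0) (snd q) - (fst q - \<theta>0) *\<^sub>R blinfun_apply (K' \<theta>0) f0)\<bar>
      \<le> D * \<bar>fst q - \<theta>0\<bar> * (norm (snd q - f0) + \<bar>fst q - \<theta>0\<bar>) \<and>
    \<kappa> (fst q, w) \<in> pairing_domain e (snd x) \<and>
    \<bar>noise2 n x (\<kappa> (fst q, w) - blinfun_apply (K \<theta>0) w)\<bar> \<le> D * \<bar>fst q - \<theta>0\<bar>)" for x q
  have AB: "?A x q = B x q" for x q by (auto simp: B_def \<kappa>_def)
  have setsP [measurable_cong]: "sets ?P = sets obs_space" by (simp add: obs_law_def)
  have [measurable]: "\<Omega> \<in> sets obs_space" using \<Omega> setsP by simp
  have x1 [measurable]: "(\<lambda>z. fst (fst z)) \<in> measurable (?P \<Otimes>\<^sub>M lprior) (\<Pi>\<^sub>M k\<in>UNIV. borel)"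
    and x2 [measurable]: "(\<lambda>z. snd (fst z)) \<in> measurable (?P \<Otimes>\<^sub>M lprior) (\<Pi>\<^sub>M k\<in>UNIV. borel)" by measurable
  have [measurable]: "(\<lambda>h. blinfun_apply A h) \<in> borel_measurable borel" for A :: "'h \<Rightarrow>\<^sub>L 'h"
    by (intro borel_measurable_continuous_onI continuous_intros)
  have dom1: "Measurable.pred (?P \<Otimes>\<^sub>M lprior) (\<lambda>z. h z \<in> pairing_domain e (fst (fst z)))" if "h \<in> borel_measurable (?P \<Otimes>\<^sub>M lprior)" for h
    unfolding pred_def by (rule measurable_pairing_domain[OF x1 that])
  have dom2: "Measurable.pred (?P \<Otimes>\<^sub>M lprior) (\<lambda>z. h z \<in> pairing_domain e (snd (fst z)))" if "h \<in> borel_measurable (?P \<Otimes>\<^sub>M lprior)" for h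
    unfolding pred_def by (rule measurable_pairing_domain[OF x2 that])
  have [measurable]: "Measurable.pred (?P \<Otimes>\<^sub>M lprior) (\<lambda>z. snd (snd z) \<in> pairing_domain e (fst (fst z)))"
    by (rule dom1) measurable
  have [measurable]: "Measurable.pred (?P \<Otimes>\<^sub>M lprior) (\<lambda>z. blinfun_apply (K \<theta>0) (snd (snd z)) \<in> pairing_domain e (snd (fst z)))"
    "Measurable.pred (?P \<Otimes>\<^sub>M lprior) (\<lambda>z. \<kappa> (snd z) \<in> pairing_domain e (snd (fst z)))"
    "Measurable.pred (?P \<Otimes>\<^sub>M lprior) (\<lambda>z. \<kappa> (fst (snd z), w) \<in> pairing_domain e (snd (fst z)))"
  proof -
    have "(\<lambda>z. \<kappa> (snd z)) \<in> borel_measurable (?P \<Otimes>\<^sub>M lprior)" "(\<lambda>z. \<kappa> (fst (snd z), w)) \<in> borel_measurable (?P \<Otimes>\<^sub>M lprior)"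
      "(\<lambda>z. blinfun_apply (K \<theta>0) (snd (snd z))) \<in> borel_measurable (?P \<Otimes>\<^sub>M lprior)"
      by measurable
    then show "Measurable.pred (?P \<Otimes>\<^sub>M lprior) (\<lambda>z. blinfun_apply (K \<theta>0) (snd (snd z)) \<in> pairing_domain e (snd (fst z)))"
      "Measurable.pred (?P \<Otimes>\<^sub>M lprior) (\<lambda>z. \<kappa> (snd z) \<in> pairing_domain e (snd (fst z)))"
      "Measurable.pred (?P \<Otimes>\<^sub>M lprior) (\<lambda>z. \<kappa> (fst (snd z), w) \<in> pairing_domain e (snd (fst z)))"
      by (auto intro!: dom2 simp del: measurable_pair_iff)
  qed
  have [measurable]: "(\<lambda>z. noise2 n (fst z) (h z)) \<in> borel_measurable (?P \<Otimes>\<^sub>M lprior)" if [measurable]: "h \<in> borel_measurable (?P \<Otimes>\<^sub>M lprior)" for h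
    unfolding noise_pairing_def by measurable
  have meas: "{z \<in> space (?P \<Otimes>\<^sub>M lprior). B (fst z) (snd z)} \<in> sets (?P \<Otimes>\<^sub>M lprior)"
    unfolding B_def by measurable
  have pointwise: "AE x in ?P. ?A x (\<theta>, f)" for \<theta> f
  proof (cases "\<theta> \<in> \<Theta>")
    case \<theta>: True
    define t where "t = \<theta> - \<theta>0"
    define h1 where "h1 = blinfun_apply (K \<theta>) f - blinfun_apply (K \<theta>0) f - t *\<^sub>R blinfun_apply (K' \<theta>0) f0"
    define h2 where "h2 = blinfun_apply (K \<theta>) w - blinfun_apply (K \<theta>0) w"
    have nn: "norm_on S nS" by (rule S_norm)
    have sub: "subspace S" and tri: "\<And>g h. g \<in> S \<Longrightarrow> h \<in> S \<Longrightarrow> nS (g + h) \<le> nS g + nS h" using nn by (auto simp: norm_on_def)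
    note lip = opnorm_intoD[OF nn lipschitz[OF \<theta>], unfolded blinfun.diff_left]
    note quad = opnorm_intoD[OF nn quadratic[OF \<theta>], unfolded blinfun.diff_left blinfun.scaleR_left]
    \<comment> \<open>This splitting puts both parts in S, with small norm there: one is of first
      order in \<open>\<theta> - \<theta>0\<close> times \<open>norm (f - f0)\<close>, the other of
      second order in \<open>\<theta> - \<theta>0\<close>.\<close>
    have h1: "h1 = (blinfun_apply (K \<theta>) (f - f0) - blinfun_apply (K \<theta>0) (f - f0))
        + (blinfun_apply (K \<theta>) f0 - blinfun_apply (K \<theta>0) f0 - (\<theta> - \<theta>0) *\<^sub>R blinfun_apply (K' \<theta>0) f0)"
      by (simp add: h1_def t_def blinfun.diff_right)
    have h1S: "h1 \<in> S" unfolding h1 by (intro subspace_add sub lip quad)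
    have "nS h1 \<le> D1 * \<bar>t\<bar> * norm (f - f0) + D2 * t\<^sup>2 * norm f0"
      unfolding h1 t_def by (rule order_trans[OF tri[OF lip(1) quad(1)] add_mono[OF lip(2) quad(2)]])
    also have "\<dots> \<le> \<bar>D1\<bar> * \<bar>t\<bar> * norm (f - f0) + \<bar>D2\<bar> * t\<^sup>2 * norm f0"
      by (intro add_mono mult_right_mono) auto
    finally have "m * nS h1 \<le> m * (\<bar>D1\<bar> * \<bar>t\<bar> * norm (f - f0) + \<bar>D2\<bar> * t\<^sup>2 * norm f0)" using m by (rule mult_left_mono)
    also have "\<dots> = (m * \<bar>D1\<bar>) * (\<bar>t\<bar> * norm (f - f0)) + (m * \<bar>D2\<bar> * norm f0) * (\<bar>t\<bar> * \<bar>t\<bar>)"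
      by (simp add: algebra_simps power2_eq_square)
    also have "\<dots> \<le> D * (\<bar>t\<bar> * norm (f - f0)) + D * (\<bar>t\<bar> * \<bar>t\<bar>)"
      using D by (intro add_mono mult_right_mono) auto
    finally have m1: "m * nS h1 \<le> D * \<bar>t\<bar> * (norm (f - f0) + \<bar>t\<bar>)" by (simp add: algebra_simps)
    have h2S: "h2 \<in> S" unfolding h2_def by (rule lip)
    have "nS h2 \<le> \<bar>D1\<bar> * \<bar>t\<bar> * norm w"
      unfolding h2_def t_def by (rule order_trans[OF lip(2)]) (intro mult_right_mono, auto)
    then have "m * nS h2 \<le> m * (\<bar>D1\<bar> * \<bar>t\<bar> * norm w)" using m by (rule mult_left_mono)
    also have "\<dots> = (m * \<bar>D1\<bar> * norm w) * \<bar>t\<bar>" by simp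
    also have "\<dots> \<le> D * \<bar>t\<bar>" using D by (intro mult_right_mono) auto
    finally have m2: "m * nS h2 \<le> D * \<bar>t\<bar>" .
    have "AE x in ?P. x \<in> \<Omega> \<longrightarrow> \<bar>noise2 n x h1\<bar> \<le> m * nS h1" by (rule W2.AE_bound_norm_on[OF nn h1S]) (rule bound)
    moreover have "AE x in ?P. x \<in> \<Omega> \<longrightarrow> \<bar>noise2 n x h2\<bar> \<le> m * nS h2" by (rule W2.AE_bound_norm_on[OF nn h2S]) (rule bound)
    ultimately show ?thesis
      using W1.AE_D[of f] W2.AE_D[of "blinfun_apply (K \<theta>0) f"] W2.AE_D[of "blinfun_apply (K \<theta>) f"] W2.AE_D[of "blinfun_apply (K \<theta>) w"]
    proof eventually_elim
      case (elim x)
      have "\<bar>noise2 n x h1\<bar> \<le> D * \<bar>t\<bar> * (norm (f - f0) + \<bar>t\<bar>)" "\<bar>noise2 n x h2\<bar> \<le> D * \<bar>t\<bar>" if "x \<in> \<Omega>"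
        using elim(1,2) that m1 m2 by auto
      then show ?case using elim(3-6) unfolding h1_def h2_def t_def fst_conv snd_conv by blast
    qed
  qed auto
  have "AE x in ?P. B x q" for q using pointwise[of "fst q" "snd q"] unfolding AB by simp
  then have "AE q in lprior. AE x in ?P. B x q" by (rule AE_I2)
  then have "AE x in ?P. AE q in lprior. B x q" by (subst PM.AE_commute[OF meas])
  then show ?thesis unfolding AB .
qed

end

section \<open>Bounds for exceptional events and the choice of constants\<close>

lemma rare_noise:
  assumes W: "\<And>n. n \<ge> 1 \<Longrightarrow> white_noise (P n) (V n) (W n)"
    and ev: "\<forall>\<^sub>F n in sequentially. norm (h n) \<le> s n \<and> 0 < s n \<and> 4 * (s n)\<^sup>2 / a\<^sup>2 \<le> \<eta>" and a: "0 < a"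
  shows "rare P \<eta> (\<lambda>n x. a < \<bar>W n x (h n)\<bar>)"
  unfolding rare_def using ev eventually_ge_at_top[of 1]
proof eventually_elim
  case (elim n)
  interpret W: white_noise "P n" "V n" "W n" by (rule W) fact
  have "emeasure (P n) {x \<in> space (P n). a < \<bar>W n x (h n)\<bar>} \<le> ennreal (4 * (s n)\<^sup>2 / a\<^sup>2)"
    by (rule W.chebyshev_tail) (use elim a in auto)
  also have "\<dots> \<le> ennreal \<eta>" using elim by (intro ennreal_leI) auto
  finally show ?case
    by (intro bexI[of _ "{x \<in> space (P n). a < \<bar>W n x (h n)\<bar>}"]) auto
qed

lemma rare_AE:
  assumes "\<forall>\<^sub>F n in sequentially. AE x in P n. \<not> A n x"
  shows "rare P 0 A"
  unfolding rare_def using assms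
proof eventually_elim
  case (elim n)
  then obtain N where "N \<in> sets (P n)" "emeasure (P n) N = 0" "{x \<in> space (P n). \<not> \<not> A n x} \<subseteq> N"
    by (auto elim: AE_E)
  then show ?case by (intro bexI[of _ N]) auto
qed

lemma tv_dist_le:
  assumes "\<And>B. B \<in> sets P \<Longrightarrow> \<bar>measure P B - measure Q B\<bar> \<le> d"
  shows "\<bar>tv_dist P Q\<bar> \<le> 2 * d"
proof -
  have "(SUP F\<in>sets P. \<bar>measure P F - measure Q F\<bar>) \<le> d"
    by (rule cSUP_least) (use assms in auto)
  moreover have "0 \<le> (SUP F\<in>sets P. \<bar>measure P F - measure Q F\<bar>)"
    by (rule cSUP_upper2[of _ _ "{}"]) (use assms in \<open>auto intro!: bdd_aboveI2\<close>)
  ultimately show ?thesis by (simp add: tv_dist_def)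
qed

lemma abs_log_leD:
  assumes "abs_log r \<le> ennreal b" "0 \<le> b"
  shows "ennreal (exp (- b)) \<le> r"
proof -
  have r: "r \<noteq> 0" "r \<noteq> \<infinity>" using assms(1) by (auto simp: abs_log_def top_unique split: if_splits)
  then obtain y where y: "r = ennreal y" "y > 0" by (cases r) auto
  have "\<bar>ln y\<bar> \<le> b" using assms r y by (auto simp: abs_log_def)
  then have "- b \<le> ln y" by linarith
  then have "exp (- b) \<le> y" using y(2) by (simp add: ln_ge_iff)
  then show ?thesis by (simp add: y(1) ennreal_leI)
qed

text \<open>Each condition holds for all large L; the Gaussian term reduces to an exponential one by
  \<open>L \<le> L^2\<close>.\<close>

lemma exists_cutoff:
  fixes I k2 D C \<epsilon> :: real
  assumes "I > 0" "k2 > 0" "\<epsilon> > 0"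
  shows "\<exists>L\<ge>1. 96 * D * k2 \<le> I\<^sup>2 * L \<and> 4 * exp (- ((L - 2 * D / I) * sqrt I)) \<le> \<epsilon> \<and>
    2 * exp (4 * D ^ 4 + 2 - I / 8 * L) \<le> \<epsilon> \<and> C * exp (- (I\<^sup>2 / (16 * k2) * L\<^sup>2)) \<le> \<epsilon>"
proof -
  have exp0: "((\<lambda>x. b * exp (a - c * x)) \<longlongrightarrow> 0) at_top" if "c > 0" for a b c :: real
  proof -
    have "filterlim (\<lambda>x. - a + c * x) at_top at_top"
      by (intro filterlim_tendsto_add_at_top[OF tendsto_const] filterlim_tendsto_pos_mult_at_top[OF tendsto_const that] filterlim_ident)
    then have "filterlim (\<lambda>x. - (- a + c * x)) at_bot at_top" by (simp only: filterlim_uminus_at_top)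
    then have "((\<lambda>x. exp (- (- a + c * x))) \<longlongrightarrow> 0) at_top" by (rule filterlim_compose[OF exp_at_bot])
    from tendsto_mult_left[OF this, of b] show ?thesis by simp
  qed
  have 1: "\<forall>\<^sub>F L in at_top. 4 * exp (2 * D / I * sqrt I - sqrt I * L) < \<epsilon>"
    by (rule order_tendstoD(2)[OF exp0]) (use assms in auto)
  have 2: "\<forall>\<^sub>F L in at_top. 2 * exp (4 * D ^ 4 + 2 - I / 8 * L) < \<epsilon>"
    by (rule order_tendstoD(2)[OF exp0]) (use assms in auto)
  have 3: "\<forall>\<^sub>F L in at_top. \<bar>C\<bar> * exp (0 - I\<^sup>2 / (16 * k2) * L) < \<epsilon>"
    by (rule order_tendstoD(2)[OF exp0]) (use assms in auto)
  have "\<forall>\<^sub>F L in at_top. L \<ge> 1 \<and> L \<ge> 96 * D * k2 / I\<^sup>2 \<and> 4 * exp (2 * D / I * sqrt I - sqrt I * L) < \<epsilon> \<and>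
     2 * exp (4 * D ^ 4 + 2 - I / 8 * L) < \<epsilon> \<and> \<bar>C\<bar> * exp (0 - I\<^sup>2 / (16 * k2) * L) < \<epsilon>"
    using 1 2 3 eventually_ge_at_top[of 1] eventually_ge_at_top[of "96 * D * k2 / I\<^sup>2"] by eventually_elim auto
  then obtain L where L: "L \<ge> 1" "L \<ge> 96 * D * k2 / I\<^sup>2" "4 * exp (2 * D / I * sqrt I - sqrt I * L) < \<epsilon>"
     "2 * exp (4 * D ^ 4 + 2 - I / 8 * L) < \<epsilon>" "\<bar>C\<bar> * exp (0 - I\<^sup>2 / (16 * k2) * L) < \<epsilon>"
    using eventually_happens[of _ "at_top :: real filter"] by auto
  have "C * exp (- (I\<^sup>2 / (16 * k2) * L\<^sup>2)) \<le> \<bar>C\<bar> * exp (0 - I\<^sup>2 / (16 * k2) * L)"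
  proof (rule mult_mono)
    have "L \<le> L\<^sup>2" using L(1) by (simp add: power2_eq_square)
    then have "I\<^sup>2 / (16 * k2) * L \<le> I\<^sup>2 / (16 * k2) * L\<^sup>2" using assms by (intro mult_left_mono) auto
    then show "exp (- (I\<^sup>2 / (16 * k2) * L\<^sup>2)) \<le> exp (0 - I\<^sup>2 / (16 * k2) * L)" by simp
  qed auto
  moreover have "- ((L - 2 * D / I) * sqrt I) = 2 * D / I * sqrt I - sqrt I * L" by (simp add: algebra_simps)
  moreover have "96 * D * k2 \<le> I\<^sup>2 * L" using L(2) assms by (simp add: pos_divide_le_eq mult.commute)
  ultimately show ?thesis using L by (intro exI[of _ L]) auto
qed

lemma exists_tolerance:
  fixes c \<epsilon> b I k2 D :: real
  assumes "\<epsilon> > 0" "b > 0" "I > 0"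
  shows "\<exists>\<tau>>0. \<tau> \<le> b \<and> \<tau> \<le> 1 \<and> 3 * D * \<tau> \<le> 1 \<and> 48 * D ^ 4 * \<tau> \<le> I \<and> 112 * k2 * D ^ 4 * \<tau> \<le> I\<^sup>2 \<and>
    (exp (\<tau> * c) - 1) + sqrt I * \<tau> + \<tau> \<le> \<epsilon>"
proof -
  have lin: "\<forall>\<^sub>F \<tau> in at_right 0. a * \<tau> < y" if "y > 0" for a y :: real
  proof (rule order_tendstoD(2))
    show "((\<lambda>\<tau>. a * \<tau>) \<longlongrightarrow> a * 0) (at_right 0)" by (intro tendsto_intros)
  qed (use that in simp)
  have ex: "\<forall>\<^sub>F \<tau> in at_right 0. (exp (\<tau> * c) - 1) + sqrt I * \<tau> + \<tau> < \<epsilon>"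
  proof (rule order_tendstoD(2))
    show "((\<lambda>\<tau>. (exp (\<tau> * c) - 1) + sqrt I * \<tau> + \<tau>) \<longlongrightarrow> (exp (0 * c) - 1) + sqrt I * 0 + 0) (at_right 0)"
      by (intro tendsto_intros)
  qed (use assms in simp)
  have "\<forall>\<^sub>F \<tau> in at_right 0. 0 < \<tau> \<and> 1 * \<tau> < b \<and> 1 * \<tau> < 1 \<and> 3 * D * \<tau> < 1 \<and> 48 * D ^ 4 * \<tau> < I \<and> 112 * k2 * D ^ 4 * \<tau> < I\<^sup>2 \<and>
    (exp (\<tau> * c) - 1) + sqrt I * \<tau> + \<tau> < \<epsilon>"
    using assms by (intro eventually_conj lin ex) (auto simp: eventually_at_right_less)
  then obtain \<tau> :: real where "0 < \<tau> \<and> 1 * \<tau> < b \<and> 1 * \<tau> < 1 \<and> 3 * D * \<tau> < 1 \<and> 48 * D ^ 4 * \<tau> < I \<and> 112 * k2 * D ^ 4 * \<tau> < I\<^sup>2 \<and>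
    (exp (\<tau> * c) - 1) + sqrt I * \<tau> + \<tau> < \<epsilon>"
    using eventually_happens[of _ "at_right 0 :: real filter"] by auto
  then show ?thesis by (intro exI[of _ \<tau>]) auto
qed

section \<open>The good event and its probability\<close>

context bvm_model
begin

abbreviation "g \<equiv> least_favorable K K' \<theta>0 f0"
abbreviation "P n \<equiv> obs_law e K n \<theta>0 f0"
abbreviation "pst n x \<equiv> posterior e K (theta_prior \<Theta> p) \<pi>f n x"

lemma least_favorable_eq:
  "(norm g)\<^sup>2 + (norm (blinfun_apply (K \<theta>0) g))\<^sup>2 = blinfun_apply (K \<theta>0) g \<bullet> blinfun_apply (K' \<theta>0) f0"
  using inner_info_op[OF basis, of g "K \<theta>0" g] inner_least_favorable[OF basis, of g K \<theta>0 K' f0]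
  by (simp add: power2_norm_eq_inner)

lemma efficient_info_eq:
  "efficient_info K K' \<theta>0 f0 = (norm (blinfun_apply (K' \<theta>0) f0))\<^sup>2 - blinfun_apply (K \<theta>0) g \<bullet> blinfun_apply (K' \<theta>0) f0"
proof -
  have "(norm (y - z))\<^sup>2 = (norm y)\<^sup>2 - 2 * (z \<bullet> y) + (norm z)\<^sup>2" for y z :: 'h
    unfolding power2_norm_eq_inner by (simp add: inner_diff_left inner_diff_right inner_commute[of y z])
  then show ?thesis using least_favorable_eq by (simp add: efficient_info_def)
qed

text \<open>If the information vanished, both squares would vanish: first the least favourable
  direction, hence its image under \<open>K \<theta>0\<close>, and then \<open>K' \<theta>0\<close>
  at \<open>f0\<close>.\<close>

lemma efficient_info_pos:
  assumes "blinfun_apply (K' \<theta>0) f0 \<noteq> 0"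
  shows "0 < efficient_info K K' \<theta>0 f0"
proof (rule ccontr)
  assume "\<not> 0 < efficient_info K K' \<theta>0 f0"
  then have "(norm g)\<^sup>2 + (norm (blinfun_apply (K' \<theta>0) f0 - blinfun_apply (K \<theta>0) g))\<^sup>2 \<le> 0"
    by (simp add: efficient_info_def)
  then have "(norm g)\<^sup>2 = 0" "(norm (blinfun_apply (K' \<theta>0) f0 - blinfun_apply (K \<theta>0) g))\<^sup>2 = 0"
    by (smt (verit) zero_le_power2)+
  then show False using assms by (simp add: blinfun.zero_right)
qed

text \<open>Identifies the bias condition as a comparison of the drift in \<theta> with the score in
  the direction w, the form in which the expansions use it.\<close>

lemma bias_eq:
  "(f - f0) \<bullet> info_op (K \<theta>0) (least_favorable K K' \<theta>0 f - w)
    = blinfun_apply (K \<theta>0) (f - f0) \<bullet> blinfun_apply (K' \<theta>0) f - ((f - f0) \<bullet> w + blinfun_apply (K \<theta>0) (f - f0) \<bullet> blinfun_apply (K \<theta>0) w)"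
  using inner_least_favorable[OF basis, of "f - f0" K \<theta>0 K' f]
  by (simp add: inner_info_op[OF basis] blinfun.diff_right inner_diff_right)

lemma prior_density_close:
  assumes \<tau>: "0 < \<tau>" and nb: "\<And>\<theta>. \<bar>\<theta> - \<theta>0\<bar> \<le> b \<Longrightarrow> \<theta> \<in> \<Theta>" "0 < b"
  shows "\<exists>d>0. \<forall>\<theta> \<theta>'. \<bar>\<theta> - \<theta>0\<bar> \<le> d \<longrightarrow> \<bar>\<theta>' - \<theta>0\<bar> \<le> d \<longrightarrow> exp (- \<tau>) * p \<theta> \<le> p \<theta>'"
proof -
  have p0: "p \<theta>0 > 0" using prior_theta(3) Theta(2) by force
  \<comment> \<open>Half of the gap between \<open>p \<theta>0\<close> and
    \<open>exp (- \<tau>) * p \<theta>0\<close>, so that an error of \<eta> on either side still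
    preserves the order.\<close>
  define \<eta> where "\<eta> = p \<theta>0 * (1 - exp (- \<tau>)) / 2"
  have \<eta>: "\<eta> > 0" using p0 \<tau> by (simp add: \<eta>_def)
  obtain d where d: "d > 0" "\<And>\<theta>. \<theta> \<in> \<Theta> \<Longrightarrow> dist \<theta> \<theta>0 < d \<Longrightarrow> dist (p \<theta>) (p \<theta>0) < \<eta>"
    using prior_theta(2) Theta(2) \<eta> unfolding continuous_on_iff by meson
  have close: "\<bar>p \<theta> - p \<theta>0\<bar> < \<eta>" if "\<bar>\<theta> - \<theta>0\<bar> \<le> min (d / 2) b" for \<theta>
    using d that nb by (auto simp: dist_real_def)
  have "exp (- \<tau>) * p \<theta> \<le> p \<theta>'" if "\<bar>\<theta> - \<theta>0\<bar> \<le> min (d / 2) b" "\<bar>\<theta>' - \<theta>0\<bar> \<le> min (d / 2) b" for \<theta> \<theta>'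
  proof -
    have "exp (- \<tau>) * p \<theta> \<le> exp (- \<tau>) * (p \<theta>0 + \<eta>)" using close[OF that(1)] by (intro mult_left_mono) auto
    also have "\<dots> \<le> exp (- \<tau>) * p \<theta>0 + \<eta>" using \<eta> \<tau> by (simp add: distrib_left mult_left_le_one_le)
    also have "\<dots> = p \<theta>0 - \<eta>" by (simp add: \<eta>_def field_simps)
    also have "\<dots> \<le> p \<theta>'" using close[OF that(2)] by linarith
    finally show ?thesis .
  qed
  then show ?thesis using d(1) nb(2) by (intro exI[of _ "min (d / 2) b"]) auto
qed

text \<open>The deterministic core: for one sample size and one observation meeting finitely many
  conditions, the two settings are instantiated and the error \<open>err\<close> is read off.
  Probability enters only in showing that the conditions rarely fail.\<close>

lemma tv_le_on_good_event:
  fixes w :: 'h and Hn :: "'h set" and T :: "real set" and r :: "real \<Rightarrow> 'h \<Rightarrow> ennreal"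
  defines "J \<equiv> efficient_info K K' \<theta>0 f0" and "kk \<equiv> (norm (blinfun_apply (K' \<theta>0) f0))\<^sup>2"
  assumes n1: "n \<ge> 1" and info: "0 < J"
    and tol: "0 < \<tau>" "\<tau> \<le> 1" "3 * D * \<tau> \<le> 1" "48 * D ^ 4 * \<tau> \<le> J" "112 * kk * D ^ 4 * \<tau> \<le> J\<^sup>2"
    and cutoff: "1 \<le> L" "L / sqrt (real n) \<le> \<tau>" "96 * D * kk \<le> J\<^sup>2 * L"
    and nb: "\<And>\<theta>. \<bar>\<theta> - \<theta>0\<bar> \<le> \<tau> \<Longrightarrow> \<theta> \<in> \<Theta>"
    and const: "1 \<le> D" "D0 \<le> D" "norm f0 \<le> D" "norm g + 1 \<le> D" "2 * a \<le> D"
    and C0: "\<And>h. h \<in> S \<Longrightarrow> norm h \<le> C0 * nS h" "0 \<le> C0" "C0 * \<bar>D1\<bar> \<le> D" "C0 * \<bar>D2\<bar> \<le> D"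
    and pl: "0 < pl" "\<And>\<theta>. \<theta> \<in> \<Theta> \<Longrightarrow> pl \<le> p \<theta> \<and> p \<theta> \<le> pu"
    and p_close: "\<And>\<theta> \<theta>'. \<bar>\<theta> - \<theta>0\<bar> \<le> L / sqrt (real n) \<Longrightarrow> \<bar>\<theta>' - \<theta>0\<bar> \<le> L / sqrt (real n) \<Longrightarrow> exp (- \<tau>) * p \<theta> \<le> p \<theta>'"
    and near: "norm (w - g) \<le> \<tau>"
    and Hn: "Hn \<in> sets borel" and T: "T \<in> sets borel" "T \<subseteq> \<Theta>"
    and T_unit: "\<theta>0 + 1 / sqrt (real n) \<in> T" "\<theta>0 - 1 / sqrt (real n) \<in> T"
    and T_large: "emeasure lborel {s. \<bar>s\<bar> \<le> 2 * L \<and> \<theta>0 + s / sqrt (real n) \<notin> T} \<le> ennreal \<tau>"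
    and bias: "\<And>f. f \<in> Hn \<Longrightarrow> sqrt (real n) * \<bar>(f - f0) \<bullet> info_op (K \<theta>0) (least_favorable K K' \<theta>0 f - w)\<bar> \<le> \<tau>"
    and shift: "\<And>\<theta>. \<theta> \<in> T \<Longrightarrow> shift_density \<pi>f ((\<theta> - \<theta>0) *\<^sub>R w) (r \<theta>)"
    and r_ge: "\<And>\<theta> f. \<theta> \<in> T \<Longrightarrow> f \<in> Hn \<Longrightarrow> ennreal (exp (- (\<tau> * (1 + real n * (\<theta> - \<theta>0)\<^sup>2)))) \<le> r \<theta> f"
    and noise: "\<bar>noise2 n x (blinfun_apply (K' \<theta>0) f0)\<bar> \<le> a" "\<bar>noise1 n x g\<bar> \<le> a" "\<bar>noise2 n x (blinfun_apply (K \<theta>0) g)\<bar> \<le> a"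
      "\<bar>noise1 n x (w - g)\<bar> \<le> \<tau> / 2" "\<bar>noise2 n x (blinfun_apply (K \<theta>0) (w - g))\<bar> \<le> \<tau> / 2"
    and domain: "g \<in> pairing_domain e (fst x)" "w \<in> pairing_domain e (fst x)" "blinfun_apply (K \<theta>0) g \<in> pairing_domain e (snd x)"
      "blinfun_apply (K \<theta>0) w \<in> pairing_domain e (snd x)" "blinfun_apply (K' \<theta>0) f0 \<in> pairing_domain e (snd x)"
    and AE_good: "AE q in lprior. fst q \<in> \<Theta> \<longrightarrow>
      snd q \<in> pairing_domain e (fst x) \<and> blinfun_apply (K \<theta>0) (snd q) \<in> pairing_domain e (snd x) \<and>
      blinfun_apply (K (fst q)) (snd q) \<in> pairing_domain e (snd x) \<and>
      \<bar>noise2 n x (blinfun_apply (K (fst q)) (snd q) - blinfun_apply (K \<theta>0) (snd q) - (fst q - \<theta>0) *\<^sub>R blinfun_apply (K' \<theta>0) f0)\<bar>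
        \<le> D * \<bar>fst q - \<theta>0\<bar> * (norm (snd q - f0) + \<bar>fst q - \<theta>0\<bar>) \<and>
      blinfun_apply (K (fst q)) w \<in> pairing_domain e (snd x) \<and>
      \<bar>noise2 n x (blinfun_apply (K (fst q)) w - blinfun_apply (K \<theta>0) w)\<bar> \<le> D * \<bar>fst q - \<theta>0\<bar>"
    and \<delta>: "\<delta> \<le> \<tau>"
    and mass1: "\<bar>measure (pst n x) {(\<theta>, f). \<theta> \<in> space (theta_prior \<Theta> p) \<and> \<bar>\<theta> - \<theta>0\<bar> < \<delta> \<and> norm (f - f0) < \<delta>} - 1\<bar> \<le> \<tau> / 4"
    and mass2: "\<bar>measure (pst n x) (T \<times> Hn) - 1\<bar> \<le> \<tau> / 4"
  shows "\<bar>tv_dist (distr (pst n x) borel fst)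
       (normal_law (\<theta>0 + 1 / sqrt (real n) * efficient_Delta e K K' n \<theta>0 f0 x)
                   (1 / real n * inverse J))\<bar>
    \<le> 2 * ((exp (\<tau> * (2 + 4 * L\<^sup>2 + 60 * D ^ 5 * L\<^sup>2)) - 1) + sqrt J * \<tau> + \<tau> + 4 * exp (- ((L - 2 * D / J) * sqrt J))
      + 2 * exp (4 * D ^ 4 + 2 - J / 8 * L) + 2 * pu / pl * exp (- (J\<^sup>2 / (16 * kk) * L\<^sup>2)))"
proof -
  define V1 where "V1 = pairing_domain e (fst x)"
  define V2 where "V2 = pairing_domain e (snd x)"
  have add: "noise_pairing e n h y (h1 + h2) = noise_pairing e n h y h1 + noise_pairing e n h y h2"
    if "h1 \<in> pairing_domain e y" "h2 \<in> pairing_domain e y" for h y h1 h2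
    using that by (simp add: noise_pairing_def pairing_add inner_add_right algebra_simps)
  have scale: "noise_pairing e n h y (b *\<^sub>R h1) = b * noise_pairing e n h y h1"
    if "h1 \<in> pairing_domain e y" for h y b h1
    using that by (simp add: noise_pairing_def pairing_scale algebra_simps)
  have sub: "noise_pairing e n h y (h1 - h2) = noise_pairing e n h y h1 - noise_pairing e n h y h2"
    if "h1 \<in> pairing_domain e y" "h2 \<in> pairing_domain e y" for h y h1 h2
    using add[of h1 y "- h2" h] scale[of h2 y h "-1"] that subspace_neg[OF subspace_pairing_domain, of h2 e y] by simp
  \<comment> \<open>The norm of S dominates that of H, so the bounds into S also supply the bounds
    in H that the expansions use.\<close>
  have Sop: "norm (blinfun_apply A h) \<le> D * b * norm h"
    if A: "opnorm_into S nS A \<le> ereal (d * b)" and d: "C0 * \<bar>d\<bar> \<le> D" and b: "0 \<le> b" for A d b h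
  proof -
    note A' = opnorm_intoD[OF S_norm(1) A, of h]
    have "norm (blinfun_apply A h) \<le> C0 * nS (blinfun_apply A h)" by (rule C0(1)[OF A'(1)])
    also have "\<dots> \<le> C0 * (d * b * norm h)" using A'(2) C0(2) by (rule mult_left_mono)
    also have "\<dots> = (C0 * d) * (b * norm h)" by simp
    also have "\<dots> \<le> D * (b * norm h)"
    proof (rule mult_right_mono)
      have "C0 * d \<le> C0 * \<bar>d\<bar>" using C0(2) by (intro mult_left_mono) auto
      then show "C0 * d \<le> D" using d by simp
    qed (use b in simp)
    finally show ?thesis by simp
  qed
  have lip: "norm (blinfun_apply (K \<theta>) h - blinfun_apply (K \<theta>0) h) \<le> D * \<bar>\<theta> - \<theta>0\<bar> * norm h" if "\<theta> \<in> \<Theta>" for \<theta> h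
    using Sop[OF lipschitz[OF that] C0(3), of h] by (simp add: blinfun.diff_left)
  have quad: "norm (blinfun_apply (K \<theta>) h - blinfun_apply (K \<theta>0) h - (\<theta> - \<theta>0) *\<^sub>R blinfun_apply (K' \<theta>0) h) \<le> D * (\<theta> - \<theta>0)\<^sup>2 * norm h"
    if "\<theta> \<in> \<Theta>" for \<theta> h
    using Sop[OF quadratic[OF that] C0(4), of h] by (simp add: blinfun.diff_left blinfun.scaleR_left)
  have K_le: "norm (K \<theta>) \<le> D" if "\<theta> \<in> \<Theta>" for \<theta> using bounded[OF that] const(2) by linarith
  have K'_le: "norm (K' \<theta>0) \<le> D" using bounded[OF Theta(2)] const(2) by linarith
  have w_le: "norm w \<le> D" using norm_triangle_ineq[of "w - g" g] near tol(2) const(4) by simp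
  have W_w: "\<bar>(noise1 n x w + noise2 n x (blinfun_apply (K \<theta>0) w)) - (noise1 n x g + noise2 n x (blinfun_apply (K \<theta>0) g))\<bar> \<le> \<tau>"
  proof -
    have "noise1 n x (w - g) = noise1 n x w - noise1 n x g" using domain by (intro sub)
    moreover have "noise2 n x (blinfun_apply (K \<theta>0) (w - g)) = noise2 n x (blinfun_apply (K \<theta>0) w) - noise2 n x (blinfun_apply (K \<theta>0) g)"
      unfolding blinfun.diff_right using domain by (intro sub)
    ultimately show ?thesis using noise(4,5) by linarith
  qed
  have a: "\<bar>noise1 n x g + noise2 n x (blinfun_apply (K \<theta>0) g)\<bar> \<le> D" "\<bar>noise2 n x (blinfun_apply (K' \<theta>0) f0)\<bar> \<le> D" "norm g \<le> D"
    using noise(1,2,3) const by linarith+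
  interpret llr_setting n K "K' \<theta>0" \<Theta> \<theta>0 f0 g w V1 V2 "noise1 n x" "noise2 n x" D \<tau>
    using n1 const(1,3) tol(1) Theta(2) near domain add scale lip quad K_le K'_le w_le W_w a least_favorable_eq
    by unfold_locales (simp_all add: V1_def V2_def subspace_pairing_domain)
  have ell_eq: "ell = llr n x" by (intro ext) (simp add: ell_def llr_def)
  have k2_eq: "k2 = kk" by (simp add: k2_def kk_def)
  have I_eq: "k2 - c1 = J"
    by (simp add: J_def efficient_info_eq c1_def k2_def)
  have wt_meas: "(\<lambda>q. ennreal (c * p (fst q) * exp (ell (fst q) (snd q))) * indicator \<Theta> (fst q)) \<in> borel_measurable (borel \<Otimes>\<^sub>M borel)" for c
    unfolding ell_eq by (rule wt_measurable)
  have good: "AE q in lprior. fst q \<in> \<Theta> \<longrightarrow> good (fst q) (snd q) \<and> good_dir (fst q)"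
    using AE_good unfolding good_def good_dir_def V1_def[symmetric] V2_def[symmetric] by eventually_elim blast
  have bias': "\<bar>sqrt (real n) * (blinfun_apply (K \<theta>0) (f - f0) \<bullet> blinfun_apply (K' \<theta>0) f) - \<D> f\<bar> \<le> \<tau>" if "f \<in> Hn" for f
  proof -
    have "sqrt (real n) * (blinfun_apply (K \<theta>0) (f - f0) \<bullet> blinfun_apply (K' \<theta>0) f) - \<D> f
       = sqrt (real n) * ((f - f0) \<bullet> info_op (K \<theta>0) (least_favorable K K' \<theta>0 f - w))"
      unfolding bias_eq \<D>_def by (simp only: right_diff_distrib)
    then show ?thesis using bias[OF that] by (simp add: abs_mult)
  qed
  have r_ge': "ennreal (exp (- \<tau> * (1 + (\<U> \<theta>)\<^sup>2))) \<le> r \<theta> f" if "\<theta> \<in> T" "f \<in> Hn" for \<theta> f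
  proof -
    have "(\<U> \<theta>)\<^sup>2 = real n * (\<theta> - \<theta>0)\<^sup>2" by (simp add: \<U>_def power_mult_distrib)
    then show ?thesis using r_ge[OF that] by simp
  qed
  \<comment> \<open>The Borel set whose intersection with \<open>\<Theta> \<times> UNIV\<close> is
    the set in the definition of consistency.\<close>
  define E1 where "E1 = {q :: real \<times> 'h. \<bar>fst q - \<theta>0\<bar> < \<delta> \<and> norm (snd q - f0) < \<delta>}"
  have E1m: "E1 \<in> sets (borel \<Otimes>\<^sub>M borel)"
  proof -
    have "{q \<in> space (borel \<Otimes>\<^sub>M borel :: (real \<times> 'h) measure). \<bar>fst q - \<theta>0\<bar> < \<delta> \<and> norm (snd q - f0) < \<delta>} \<in> sets (borel \<Otimes>\<^sub>M borel)"
      by measurable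
    then show ?thesis by (simp add: E1_def space_pair_measure)
  qed
  have E2m: "T \<times> Hn \<in> sets (borel \<Otimes>\<^sub>M borel)" using T(1) Hn by measurable
  have E1_eq: "{(\<theta>, f). \<theta> \<in> space (theta_prior \<Theta> p) \<and> \<bar>\<theta> - \<theta>0\<bar> < \<delta> \<and> norm (f - f0) < \<delta>} = E1 \<inter> \<Theta> \<times> UNIV"
    by (auto simp: E1_def)
  have E2_eq: "T \<times> Hn = (T \<times> Hn) \<inter> \<Theta> \<times> UNIV" using T(2) by auto
  have "measure (pst n x) (T \<times> Hn) > 0" using mass2 tol(2) by linarith
  then obtain c where c: "c > 0"
    "prob_space (density lprior (\<lambda>q. ennreal (c * p (fst q) * exp (llr n x (fst q) (snd q))) * indicator \<Theta> (fst q)))"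
    and meas: "\<And>E. E \<in> sets (borel \<Otimes>\<^sub>M borel) \<Longrightarrow> measure (pst n x) (E \<inter> \<Theta> \<times> UNIV)
      = measure (density lprior (\<lambda>q. ennreal (c * p (fst q) * exp (llr n x (fst q) (snd q))) * indicator \<Theta> (fst q))) E"
    by (rule posterior_density[OF n1]) (rule that)
  have info': "k2 - c1 > 0" and tol': "48 * D ^ 4 * \<tau> \<le> k2 - c1" "112 * k2 * D ^ 4 * \<tau> \<le> (k2 - c1)\<^sup>2"
    using info tol unfolding I_eq by (simp_all add: k2_eq)
  have prob: "prob_space (density lprior (\<lambda>q. ennreal (c * p (fst q) * exp (ell (fst q) (snd q))) * indicator \<Theta> (fst q)))"
    using c(2) unfolding ell_eq .
  interpret bvm_setting n K "K' \<theta>0" \<Theta> \<theta>0 f0 g w V1 V2 "noise1 n x" "noise2 n x" D \<tau> p c pl pu \<pi>f Hn T r L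
    by (intro bvm_setting.intro llr_setting_axioms bvm_setting_axioms.intro)
      (fact prior_f info' pl p_close c(1) nb wt_meas prob good Hn bias' T(1) shift r_ge' T_unit cutoff(1,2) T_large tol(3) tol')+
  interpret post: prob_space post by (rule prob_post)
  have post_eq: "post = density lprior (\<lambda>q. ennreal (c * p (fst q) * exp (llr n x (fst q) (snd q))) * indicator \<Theta> (fst q))"
    by (simp add: post_def wt_def[abs_def] ell_eq)
  \<comment> \<open>Two sets of mass at least \<open>1 - \<tau> / 4\<close> meet in mass at least
    \<open>1 - \<tau> / 2\<close>, and this intersection lies in G.\<close>
  have "measure post G \<ge> 1 - \<tau>"
  proof -
    have m1: "measure post E1 \<ge> 1 - \<tau> / 4" using mass1 unfolding E1_eq meas[OF E1m] post_eq by linarith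
    have m2: "measure post (T \<times> Hn) \<ge> 1 - \<tau> / 4" using mass2 meas[OF E2m] E2_eq unfolding post_eq by (smt (verit))
    have sets: "E1 \<in> sets post" "T \<times> Hn \<in> sets post" using E1m E2m by (simp_all add: sets_post)
    have "measure post (E1 \<union> T \<times> Hn) = measure post E1 + measure post (T \<times> Hn) - measure post (E1 \<inter> T \<times> Hn)"
      using sets by (simp add: measure_Un3 post.fmeasurable_eq_sets)
    moreover have "measure post (E1 \<union> T \<times> Hn) \<le> 1" by (rule post.prob_le_1)
    moreover have "measure post (E1 \<inter> T \<times> Hn) \<le> measure post G"
    proof (rule post.finite_measure_mono)
      show "E1 \<inter> T \<times> Hn \<subseteq> G" using \<delta> by (auto simp: E1_def G_def)
      show "G \<in> sets post" using G_measurable by (simp add: sets_post)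
    qed
    ultimately show ?thesis using m1 m2 tol(1) by linarith
  qed
  note close = posterior_close_to_normal[OF _ _ this]
  have I_J: "I = J" unfolding I_def by (rule I_eq)
  have N_eq: "N = normal_law (\<theta>0 + 1 / sqrt (real n) * efficient_Delta e K K' n \<theta>0 f0 x) (1 / real n * inverse J)"
  proof -
    have "efficient_Delta e K K' n \<theta>0 f0 x = (\<zeta> - \<xi>) / J"
      by (simp add: efficient_Delta_def Let_def \<zeta>_def \<xi>_def J_def diff_divide_distrib add_divide_distrib)
    then show ?thesis by (simp add: N_def I_J)
  qed
  have err_eq: "err = (exp (\<tau> * (2 + 4 * L\<^sup>2 + 60 * D ^ 5 * L\<^sup>2)) - 1) + sqrt J * \<tau> + \<tau> + 4 * exp (- ((L - 2 * D / J) * sqrt J))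
      + 2 * exp (4 * D ^ 4 + 2 - J / 8 * L) + 2 * pu / pl * exp (- (J\<^sup>2 / (16 * kk) * L\<^sup>2))"
    by (simp add: err_def \<eta>_def I_J k2_eq)
  show ?thesis
    unfolding err_eq[symmetric] N_eq[symmetric]
  proof (rule tv_dist_le)
    fix B assume "B \<in> sets (distr (pst n x) borel fst)"
    then have B: "B \<in> sets borel" by simp
    then have BU: "B \<times> UNIV \<in> sets (borel \<Otimes>\<^sub>M borel :: (real \<times> 'h) measure)" by measurable
    have sp: "sets (pst n x) = sets prior" by (simp add: posterior_def bayes_def)
    then have "fst \<in> measurable (pst n x) borel" using fst_prior_measurable by (simp cong: measurable_cong_sets)
    then have "measure (distr (pst n x) borel fst) B = measure (pst n x) (fst -` B \<inter> space (pst n x))"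
      using B by (rule measure_distr)
    also have "fst -` B \<inter> space (pst n x) = (B \<times> UNIV) \<inter> \<Theta> \<times> UNIV"
      using sets_eq_imp_space_eq[OF sp] by (auto simp: space_prior)
    also have "measure (pst n x) \<dots> = measure post (B \<times> UNIV)" unfolding post_eq by (rule meas[OF BU])
    finally show "\<bar>measure (distr (pst n x) borel fst) B - measure N B\<bar> \<le> err"
      using close[OF B] cutoff(3) by (simp add: I_J k2_eq)
  qed
qed

text \<open>The constants are chosen in the order \<eta>, D, L, \<tau>, n. D collects the noise
  bounds m and a, which depend on \<eta>; the cutoff L depends on D and \<epsilon>; the tolerance
  \<tau> depends on all of these; finally n is taken large.\<close>

lemma rare_total_variation:
  fixes \<gamma>n :: "nat \<Rightarrow> 'h" and \<Theta>n :: "nat \<Rightarrow> real set" and Hn :: "nat \<Rightarrow> 'h set"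
    and r :: "nat \<Rightarrow> real \<Rightarrow> 'h \<Rightarrow> ennreal"
  assumes consistent: "posterior_consistent e K (theta_prior \<Theta> p) \<pi>f \<theta>0 f0"
    and nonzero: "blinfun_apply (K' \<theta>0) f0 \<noteq> 0"
    and gamma_n: "\<gamma>n \<longlonglongrightarrow> g"
    and Theta_n: "\<And>n. \<Theta>n n \<subseteq> \<Theta>" "\<And>n. \<Theta>n n \<in> sets borel"
    and H_n: "\<And>n. Hn n \<in> sets borel"
    and Theta_n_mono: "\<And>n. n \<ge> 1 \<Longrightarrow>
      (\<lambda>\<theta>. sqrt (real n) * (\<theta> - \<theta>0)) ` \<Theta>n n \<subseteq> (\<lambda>\<theta>. sqrt (real (Suc n)) * (\<theta> - \<theta>0)) ` \<Theta>n (Suc n)"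
    and Theta_n_exhaust: "(\<Union>n\<in>{1..}. (\<lambda>\<theta>. sqrt (real n) * (\<theta> - \<theta>0)) ` \<Theta>n n) = UNIV"
    and sieve_mass: "tendsto_in_prob P (\<lambda>n x. measure (pst n x) (\<Theta>n n \<times> Hn n)) 1"
    and bias: "(\<lambda>n. ennreal (sqrt (real n)) *
      (SUP f\<in>Hn n. ennreal \<bar>(f - f0) \<bullet> info_op (K \<theta>0) (least_favorable K K' \<theta>0 f - \<gamma>n n)\<bar>)) \<longlonglongrightarrow> 0"
    and shift_version: "\<And>n \<theta>. n \<ge> 1 \<Longrightarrow> \<theta> \<in> \<Theta>n n \<Longrightarrow> shift_density \<pi>f ((\<theta> - \<theta>0) *\<^sub>R \<gamma>n n) (r n \<theta>)"
    and shift_small: "(\<lambda>n. SUP \<theta>\<in>\<Theta>n n. SUP f\<in>Hn n.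
      abs_log (r n \<theta> f) / ennreal (1 + real n * (\<theta> - \<theta>0)\<^sup>2)) \<longlonglongrightarrow> 0"
    and \<epsilon>: "0 < \<epsilon>" and \<eta>: "0 < \<eta>"
  shows "rare P \<eta> (\<lambda>n x. \<epsilon> < \<bar>tv_dist (distr (pst n x) borel fst)
       (normal_law (\<theta>0 + 1 / sqrt (real n) * efficient_Delta e K K' n \<theta>0 f0 x)
                   (1 / real n * inverse (efficient_info K K' \<theta>0 f0))) - 0\<bar>)"
proof -
  define J where "J = efficient_info K K' \<theta>0 f0"
  have J: "0 < J" unfolding J_def by (rule efficient_info_pos[OF nonzero])
  define kk where "kk = (norm (blinfun_apply (K' \<theta>0) f0))\<^sup>2"
  have kk: "0 < kk" using nonzero by (simp add: kk_def)
  \<comment> \<open>Eight exceptional events of probability at most \<eta>' each, and one null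
    event, are united below.\<close>
  define \<eta>' where "\<eta>' = \<eta> / 10"
  have \<eta>': "0 < \<eta>'" using \<eta> by (simp add: \<eta>'_def)
  note inc = eventually_exhaust[of \<theta>0 \<Theta>n, OF Theta_n_mono Theta_n_exhaust]
  have ex: "\<exists>N\<ge>1. \<forall>n\<ge>N. \<theta>0 + u / sqrt (real n) \<in> \<Theta>n n" for u
  proof -
    obtain k where k: "u \<in> {s. \<theta>0 + s / sqrt (real (Suc k)) \<in> \<Theta>n (Suc k)}" using inc(2) by blast
    have "\<theta>0 + u / sqrt (real n) \<in> \<Theta>n n" if "n \<ge> Suc k" for n
    proof -
      obtain j where j: "n = Suc j" "k \<le> j" using \<open>n \<ge> Suc k\<close> by (cases n) auto
      have "u \<in> {s. \<theta>0 + s / sqrt (real (Suc j)) \<in> \<Theta>n (Suc j)}"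
        using k incseqD[OF inc(1) j(2)] by blast
      then show ?thesis by (simp add: j(1))
    qed
    then show ?thesis by (intro exI[of _ "Suc k"]) auto
  qed
  have "\<exists>N\<ge>1. \<forall>n\<ge>N. \<theta>0 + u / sqrt (real n) \<in> \<Theta>" for u using ex[of u] Theta_n(1) by blast
  then obtain b where b: "b > 0" "\<And>\<theta>. \<bar>\<theta> - \<theta>0\<bar> \<le> b \<Longrightarrow> \<theta> \<in> \<Theta>"
    using neighbourhood_of_exhaustion[OF compact_imp_closed[OF Theta(1)], of \<theta>0] by auto
  obtain pl pu where pl: "0 < pl" "\<And>\<theta>. \<theta> \<in> \<Theta> \<Longrightarrow> pl \<le> p \<theta> \<and> p \<theta> \<le> pu" using prior_theta(3) by blast
  obtain C where C: "\<And>h. h \<in> S \<Longrightarrow> norm h \<le> C * nS h" using S_norm(2) by blast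
  define C0 where "C0 = \<bar>C\<bar>"
  have C0: "norm h \<le> C0 * nS h" if "h \<in> S" for h
  proof -
    have "nS h \<ge> 0" using S_norm(1) that by (simp add: norm_on_def)
    then have "C * nS h \<le> C0 * nS h" by (intro mult_right_mono) (simp_all add: C0_def)
    then show ?thesis using C[OF that] by linarith
  qed
  define B where "B = {h\<in>S. nS h \<le> 1}"
  have B0: "B \<noteq> {}"
  proof -
    have "0 \<in> S" "nS 0 = 0" using S_norm(1) by (auto simp: norm_on_def subspace_0)
    then show ?thesis unfolding B_def by force
  qed
  \<comment> \<open>A single m serves all sample sizes, so that D can be fixed before n.\<close>
  obtain m where m: "m \<ge> 0" "\<And>(Q :: obs measure) V W. white_noise Q V W \<Longrightarrow>
    \<exists>\<Omega>\<in>sets Q. emeasure Q (space Q - \<Omega>) \<le> ennreal \<eta>' \<and> (\<forall>h\<in>B. AE x in Q. x \<in> \<Omega> \<longrightarrow> \<bar>W x h\<bar> \<le> m)"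
    using dudley_bounded[OF B0 \<eta>' entropy[folded B_def], where 'x=obs] by blast
  have "\<exists>\<Omega>. n \<ge> 1 \<longrightarrow> \<Omega> \<in> sets (P n) \<and> emeasure (P n) (space (P n) - \<Omega>) \<le> ennreal \<eta>' \<and>
      (\<forall>h\<in>B. AE x in P n. x \<in> \<Omega> \<longrightarrow> \<bar>noise2 n x h\<bar> \<le> m)" for n
    using m(2)[OF white_noise_snd[OF basis, of n K \<theta>0 f0]] by (cases "n \<ge> 1") auto
  from choice[OF allI[OF this]] obtain \<Omega> where \<Omega>_all: "\<forall>n. n \<ge> 1 \<longrightarrow> \<Omega> n \<in> sets (P n) \<and>
      emeasure (P n) (space (P n) - \<Omega> n) \<le> ennreal \<eta>' \<and> (\<forall>h\<in>B. AE x in P n. x \<in> \<Omega> n \<longrightarrow> \<bar>noise2 n x h\<bar> \<le> m)" ..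
  have \<Omega>: "\<Omega> n \<in> sets (P n)" "emeasure (P n) (space (P n) - \<Omega> n) \<le> ennreal \<eta>'"
    "\<And>h. h \<in> B \<Longrightarrow> AE x in P n. x \<in> \<Omega> n \<longrightarrow> \<bar>noise2 n x h\<bar> \<le> m" if "n \<ge> 1" for n
    using \<Omega>_all[rule_format, OF that] by simp_all
  define s0 where "s0 = norm (blinfun_apply (K' \<theta>0) f0) + norm g + norm (blinfun_apply (K \<theta>0) g) + 1"
  have s0: "s0 > 0" by (simp add: s0_def add_nonneg_pos)
  \<comment> \<open>Makes the bound \<open>4 s0^2 / a^2\<close> of \<open>chebyshev_tail\<close>
    equal to \<eta>'.\<close>
  define a where "a = 2 * s0 / sqrt \<eta>'"
  have a: "a > 0" "4 * s0\<^sup>2 / a\<^sup>2 \<le> \<eta>'" using s0 \<eta>' by (simp_all add: a_def power_divide power_mult_distrib)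
  \<comment> \<open>The sum of all quantities to be dominated, each of them nonnegative;
    \<open>norm g + 1\<close> stands for a bound on \<open>norm (\<gamma>n n)\<close> for large
    n.\<close>
  define D where "D = 1 + \<bar>D0\<bar> + C0 * \<bar>D1\<bar> + C0 * \<bar>D2\<bar> + norm f0 + (norm g + 1) + 2 * a
    + m * \<bar>D1\<bar> + m * \<bar>D2\<bar> * norm f0 + m * \<bar>D1\<bar> * (norm g + 1)"
  have nn: "0 \<le> \<bar>D0\<bar>" "0 \<le> C0 * \<bar>D1\<bar>" "0 \<le> C0 * \<bar>D2\<bar>" "0 \<le> norm f0" "0 \<le> norm g + 1" "0 \<le> 2 * a"
    "0 \<le> m * \<bar>D1\<bar>" "0 \<le> m * \<bar>D2\<bar> * norm f0" "0 \<le> m * \<bar>D1\<bar> * (norm g + 1)"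
    using m(1) a(1) by (auto simp: C0_def)
  have D: "1 \<le> D" "D0 \<le> D" "norm f0 \<le> D" "norm g + 1 \<le> D" "2 * a \<le> D" "C0 * \<bar>D1\<bar> \<le> D" "C0 * \<bar>D2\<bar> \<le> D"
    "m * \<bar>D1\<bar> \<le> D" "m * \<bar>D2\<bar> * norm f0 \<le> D" "m * \<bar>D1\<bar> * (norm g + 1) \<le> D"
    unfolding D_def using nn by linarith+
  have eps: "0 < \<epsilon> / 8" using \<epsilon> by simp
  obtain L where L: "1 \<le> L" "96 * D * kk \<le> J\<^sup>2 * L" "4 * exp (- ((L - 2 * D / J) * sqrt J)) \<le> \<epsilon> / 8"
    "2 * exp (4 * D ^ 4 + 2 - J / 8 * L) \<le> \<epsilon> / 8" "2 * pu / pl * exp (- (J\<^sup>2 / (16 * kk) * L\<^sup>2)) \<le> \<epsilon> / 8"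
    using exists_cutoff[OF J kk eps, of D "2 * pu / pl"] by blast
  obtain \<tau> where \<tau>: "0 < \<tau>" "\<tau> \<le> b" "\<tau> \<le> 1" "3 * D * \<tau> \<le> 1" "48 * D ^ 4 * \<tau> \<le> J" "112 * kk * D ^ 4 * \<tau> \<le> J\<^sup>2"
    "(exp (\<tau> * (2 + 4 * L\<^sup>2 + 60 * D ^ 5 * L\<^sup>2)) - 1) + sqrt J * \<tau> + \<tau> \<le> \<epsilon> / 8"
    using exists_tolerance[OF eps b(1) J, of D kk "2 + 4 * L\<^sup>2 + 60 * D ^ 5 * L\<^sup>2"] by blast
  obtain d where d: "d > 0" "\<And>\<theta> \<theta>'. \<bar>\<theta> - \<theta>0\<bar> \<le> d \<Longrightarrow> \<bar>\<theta>' - \<theta>0\<bar> \<le> d \<Longrightarrow> exp (- \<tau>) * p \<theta> \<le> p \<theta>'"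
    using prior_density_close[OF \<tau>(1) b(2) b(1)] by blast
  obtain \<epsilon>c where \<epsilon>c: "\<epsilon>c \<longlonglongrightarrow> 0" "tendsto_in_prob P (\<lambda>n x. measure (pst n x)
      {(\<theta>, f). \<theta> \<in> space (theta_prior \<Theta> p) \<and> \<bar>\<theta> - \<theta>0\<bar> < \<epsilon>c n \<and> norm (f - f0) < \<epsilon>c n}) 1"
    using consistent unfolding posterior_consistent_def by blast

  have inv_sqrt: "(\<lambda>n. L / sqrt (real n)) \<longlonglongrightarrow> 0"
  proof (rule real_tendsto_divide_at_top[OF tendsto_const])
    show "filterlim (\<lambda>n. sqrt (real n)) at_top sequentially"
      by (intro filterlim_compose[OF sqrt_at_top] filterlim_real_sequentially)
  qed
  have ev_cut: "\<forall>\<^sub>F n in sequentially. L / sqrt (real n) < min \<tau> d"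
    by (rule order_tendstoD(2)[OF inv_sqrt]) (use \<tau> d in simp)
  have dist0: "(\<lambda>n. norm (\<gamma>n n - g)) \<longlonglongrightarrow> 0"
    using gamma_n by (simp add: LIM_zero_iff tendsto_norm_zero_iff)
  have ev_near: "\<forall>\<^sub>F n in sequentially. norm (\<gamma>n n - g) < \<tau>"
    by (rule order_tendstoD(2)[OF dist0 \<tau>(1)])
  have ev_cons: "\<forall>\<^sub>F n in sequentially. \<epsilon>c n < \<tau>"
    by (rule order_tendstoD(2)[OF \<epsilon>c(1) \<tau>(1)])
  have ev_bias: "\<forall>\<^sub>F n in sequentially. \<forall>f\<in>Hn n.
      sqrt (real n) * \<bar>(f - f0) \<bullet> info_op (K \<theta>0) (least_favorable K K' \<theta>0 f - \<gamma>n n)\<bar> \<le> \<tau>"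
  proof -
    have "\<forall>\<^sub>F n in sequentially. ennreal (sqrt (real n)) *
      (SUP f\<in>Hn n. ennreal \<bar>(f - f0) \<bullet> info_op (K \<theta>0) (least_favorable K K' \<theta>0 f - \<gamma>n n)\<bar>) < ennreal \<tau>"
      by (rule order_tendstoD(2)[OF bias]) (use \<tau> in simp)
    then show ?thesis
    proof eventually_elim
      case (elim n)
      show ?case
      proof
        fix f assume f: "f \<in> Hn n"
        let ?y = "\<bar>(f - f0) \<bullet> info_op (K \<theta>0) (least_favorable K K' \<theta>0 f - \<gamma>n n)\<bar>"
        have "ennreal (sqrt (real n) * ?y) = ennreal (sqrt (real n)) * ennreal ?y" by (rule ennreal_mult) auto
        also have "\<dots> \<le> ennreal (sqrt (real n)) *
          (SUP f\<in>Hn n. ennreal \<bar>(f - f0) \<bullet> info_op (K \<theta>0) (least_favorable K K' \<theta>0 f - \<gamma>n n)\<bar>)"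
          using f by (intro mult_left_mono SUP_upper) auto
        also have "\<dots> \<le> ennreal \<tau>" using elim by simp
        finally show "sqrt (real n) * ?y \<le> \<tau>" using \<tau>(1) by (simp add: ennreal_le_iff)
      qed
    qed
  qed
  have ev_r: "\<forall>\<^sub>F n in sequentially. \<forall>\<theta>\<in>\<Theta>n n. \<forall>f\<in>Hn n. ennreal (exp (- (\<tau> * (1 + real n * (\<theta> - \<theta>0)\<^sup>2)))) \<le> r n \<theta> f"
  proof -
    have "\<forall>\<^sub>F n in sequentially. (SUP \<theta>\<in>\<Theta>n n. SUP f\<in>Hn n.
      abs_log (r n \<theta> f) / ennreal (1 + real n * (\<theta> - \<theta>0)\<^sup>2)) < ennreal \<tau>"
      by (rule order_tendstoD(2)[OF shift_small]) (use \<tau> in simp)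
    then show ?thesis
    proof eventually_elim
      case (elim n)
      show ?case
      proof (intro ballI)
        fix \<theta> f assume \<theta>: "\<theta> \<in> \<Theta>n n" and f: "f \<in> Hn n"
        define q where "q = 1 + real n * (\<theta> - \<theta>0)\<^sup>2"
        have q: "q > 0" by (simp add: q_def add_pos_nonneg)
        have "abs_log (r n \<theta> f) / ennreal q \<le> (SUP f\<in>Hn n. abs_log (r n \<theta> f) / ennreal q)"
          by (rule SUP_upper[OF f])
        also have "\<dots> \<le> (SUP \<theta>\<in>\<Theta>n n. SUP f\<in>Hn n. abs_log (r n \<theta> f) / ennreal (1 + real n * (\<theta> - \<theta>0)\<^sup>2))"
          unfolding q_def by (rule SUP_upper[OF \<theta>])
        also have "\<dots> \<le> ennreal \<tau>" using elim by simp
        finally have "abs_log (r n \<theta> f) / ennreal q * ennreal q \<le> ennreal \<tau> * ennreal q" by (rule mult_right_mono) simp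
        moreover have "abs_log (r n \<theta> f) / ennreal q * ennreal q = abs_log (r n \<theta> f)"
          using q by (simp add: ennreal_divide_times ennreal_divide_self mult_divide_eq_ennreal flip: ennreal_times_divide)
        ultimately have "abs_log (r n \<theta> f) \<le> ennreal (\<tau> * q)" using \<tau>(1) q by (simp add: ennreal_mult)
        then show "ennreal (exp (- (\<tau> * (1 + real n * (\<theta> - \<theta>0)\<^sup>2)))) \<le> r n \<theta> f"
          unfolding q_def[symmetric] using \<tau>(1) q by (intro abs_log_leD) auto
      qed
    qed
  qed
  have ev_ex: "\<forall>\<^sub>F n in sequentially. \<theta>0 + u / sqrt (real n) \<in> \<Theta>n n" for u
    using ex[of u] unfolding eventually_sequentially by blast
  have ev_large: "\<forall>\<^sub>F n in sequentially. emeasure lborel {s. \<bar>s\<bar> \<le> 2 * L \<and> \<theta>0 + s / sqrt (real n) \<notin> \<Theta>n n} \<le> ennreal \<tau>"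
    by (rule exhaust_measure[OF Theta_n(2) inc \<tau>(1)])

  have fixed: "rare P \<eta>' (\<lambda>n x. a < \<bar>noise2 n x (blinfun_apply (K' \<theta>0) f0)\<bar>)"
    "rare P \<eta>' (\<lambda>n x. a < \<bar>noise1 n x g\<bar>)" "rare P \<eta>' (\<lambda>n x. a < \<bar>noise2 n x (blinfun_apply (K \<theta>0) g)\<bar>)"
    by (rule rare_noise[OF white_noise_snd[OF basis] _ a(1), where s="\<lambda>_. s0"]
        rare_noise[OF white_noise_fst[OF basis] _ a(1), where s="\<lambda>_. s0"], assumption,
        use a(2) s0 in \<open>auto simp: s0_def\<close>)+
  \<comment> \<open>A common bound for the norms of \<open>\<gamma>n n - g\<close> and of its image
    under \<open>K \<theta>0\<close>; the term \<open>1 / Suc n\<close> keeps it positive when the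
    difference vanishes.\<close>
  define s where "s n = (1 + \<bar>D0\<bar>) * norm (\<gamma>n n - g) + 1 / real (Suc n)" for n
  have s_pos: "0 < s n" for n unfolding s_def by (intro add_nonneg_pos) auto
  have "s \<longlonglongrightarrow> (1 + \<bar>D0\<bar>) * 0 + 0"
    unfolding s_def by (intro tendsto_intros dist0 lim_1_over_n[THEN LIMSEQ_Suc])
  then have "(\<lambda>n. 4 * (s n)\<^sup>2 / (\<tau> / 2)\<^sup>2) \<longlonglongrightarrow> 4 * ((1 + \<bar>D0\<bar>) * 0 + 0)\<^sup>2 / (\<tau> / 2)\<^sup>2"
    by (intro tendsto_intros) (use \<tau> in auto)
  then have ev_s: "\<forall>\<^sub>F n in sequentially. 4 * (s n)\<^sup>2 / (\<tau> / 2)\<^sup>2 < \<eta>'"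
    by (rule order_tendstoD(2)) (use \<eta>' in simp)
  have s_ge: "norm (\<gamma>n n - g) \<le> s n" "norm (blinfun_apply (K \<theta>0) (\<gamma>n n - g)) \<le> s n" for n
  proof -
    have "norm (blinfun_apply (K \<theta>0) (\<gamma>n n - g)) \<le> norm (K \<theta>0) * norm (\<gamma>n n - g)" by (rule norm_blinfun)
    also have "\<dots> \<le> (1 + \<bar>D0\<bar>) * norm (\<gamma>n n - g)"
      using bounded[OF Theta(2)] by (intro mult_right_mono) auto
    also have "\<dots> \<le> s n" by (simp add: s_def)
    finally show "norm (blinfun_apply (K \<theta>0) (\<gamma>n n - g)) \<le> s n" .
    have "1 * norm (\<gamma>n n - g) \<le> (1 + \<bar>D0\<bar>) * norm (\<gamma>n n - g)" by (intro mult_right_mono) auto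
    also have "\<dots> \<le> s n" by (simp add: s_def)
    finally show "norm (\<gamma>n n - g) \<le> s n" by simp
  qed
  have moving: "rare P \<eta>' (\<lambda>n x. \<tau> / 2 < \<bar>noise1 n x (\<gamma>n n - g)\<bar>)"
    "rare P \<eta>' (\<lambda>n x. \<tau> / 2 < \<bar>noise2 n x (blinfun_apply (K \<theta>0) (\<gamma>n n - g))\<bar>)"
  proof -
    have \<tau>2: "0 < \<tau> / 2" using \<tau> by simp
    have ev: "\<forall>\<^sub>F n in sequentially. norm (\<gamma>n n - g) \<le> s n \<and> 0 < s n \<and> 4 * (s n)\<^sup>2 / (\<tau> / 2)\<^sup>2 \<le> \<eta>'"
      "\<forall>\<^sub>F n in sequentially. norm (blinfun_apply (K \<theta>0) (\<gamma>n n - g)) \<le> s n \<and> 0 < s n \<and> 4 * (s n)\<^sup>2 / (\<tau> / 2)\<^sup>2 \<le> \<eta>'"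
      by (rule eventually_mono[OF ev_s], use s_ge s_pos in \<open>simp add: less_imp_le\<close>)+
    show "rare P \<eta>' (\<lambda>n x. \<tau> / 2 < \<bar>noise1 n x (\<gamma>n n - g)\<bar>)"
      by (rule rare_noise[where h="\<lambda>n. \<gamma>n n - g" and s=s, OF white_noise_fst[OF basis] ev(1) \<tau>2])
    show "rare P \<eta>' (\<lambda>n x. \<tau> / 2 < \<bar>noise2 n x (blinfun_apply (K \<theta>0) (\<gamma>n n - g))\<bar>)"
      by (rule rare_noise[where h="\<lambda>n. blinfun_apply (K \<theta>0) (\<gamma>n n - g)" and s=s, OF white_noise_snd[OF basis] ev(2) \<tau>2])
  qed
  have rare_\<Omega>: "rare P \<eta>' (\<lambda>n x. x \<notin> \<Omega> n)"
    unfolding rare_def using eventually_ge_at_top[of 1]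
  proof eventually_elim
    case (elim n)
    then show ?case using \<Omega>(1,2)[of n] by (intro bexI[of _ "space (P n) - \<Omega> n"]) auto
  qed
  have \<tau>4: "0 < \<tau> / 4" using \<tau> by simp
  note mass = tendsto_in_prob_imp_rare[OF \<epsilon>c(2) \<tau>4 \<eta>'] tendsto_in_prob_imp_rare[OF sieve_mass \<tau>4 \<eta>']
  define ok where "ok n x \<longleftrightarrow> (AE q in lprior. x \<in> \<Omega> n \<and> fst q \<in> \<Theta> \<longrightarrow>
    snd q \<in> pairing_domain e (fst x) \<and> blinfun_apply (K \<theta>0) (snd q) \<in> pairing_domain e (snd x) \<and>
    blinfun_apply (K (fst q)) (snd q) \<in> pairing_domain e (snd x) \<and>
    \<bar>noise2 n x (blinfun_apply (K (fst q)) (snd q) - blinfun_apply (K \<theta>0) (snd q) - (fst q - \<theta>0) *\<^sub>R blinfun_apply (K' \<theta>0) f0)\<bar>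
      \<le> D * \<bar>fst q - \<theta>0\<bar> * (norm (snd q - f0) + \<bar>fst q - \<theta>0\<bar>) \<and>
    blinfun_apply (K (fst q)) (\<gamma>n n) \<in> pairing_domain e (snd x) \<and>
    \<bar>noise2 n x (blinfun_apply (K (fst q)) (\<gamma>n n) - blinfun_apply (K \<theta>0) (\<gamma>n n))\<bar> \<le> D * \<bar>fst q - \<theta>0\<bar>)" for n x
  define dom where "dom n x \<longleftrightarrow> g \<in> pairing_domain e (fst x) \<and> \<gamma>n n \<in> pairing_domain e (fst x) \<and>
    blinfun_apply (K \<theta>0) g \<in> pairing_domain e (snd x) \<and> blinfun_apply (K \<theta>0) (\<gamma>n n) \<in> pairing_domain e (snd x) \<and>
    blinfun_apply (K' \<theta>0) f0 \<in> pairing_domain e (snd x)" for n and x :: obs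
  have null: "rare P 0 (\<lambda>n x. \<not> (ok n x \<and> dom n x))"
  proof (rule rare_AE)
    show "\<forall>\<^sub>F n in sequentially. AE x in P n. \<not> \<not> (ok n x \<and> dom n x)"
      using eventually_ge_at_top[of 1] ev_near
    proof eventually_elim
      case (elim n)
      interpret W1: white_noise "P n" "\<lambda>x. pairing_domain e (fst x)" "noise1 n" by (rule white_noise_fst[OF basis elim(1)])
      interpret W2: white_noise "P n" "\<lambda>x. pairing_domain e (snd x)" "noise2 n" by (rule white_noise_snd[OF basis elim(1)])
      have "norm (\<gamma>n n) \<le> norm g + 1" using norm_triangle_ineq[of "\<gamma>n n - g" g] elim(2) \<tau>(3) by simp
      then have "m * \<bar>D1\<bar> * norm (\<gamma>n n) \<le> m * \<bar>D1\<bar> * (norm g + 1)" using m(1) by (intro mult_left_mono) auto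
      then have Dw: "m * \<bar>D1\<bar> * norm (\<gamma>n n) \<le> D" using D(10) by linarith
      have "AE x in P n. ok n x"
        unfolding ok_def
        by (rule AE_increments[OF elim(1) \<Omega>(1)[OF elim(1)] _ m(1) D(8,9) Dw]) (rule \<Omega>(3)[OF elim(1)], simp add: B_def)
      moreover have "AE x in P n. dom n x"
        unfolding dom_def by (intro AE_conjI W1.AE_D W2.AE_D)
      ultimately show ?case by eventually_elim simp
    qed
  qed
  have 0: "0 \<le> \<eta>'" "0 \<le> \<eta>' + \<eta>'" "0 \<le> \<eta>' + \<eta>' + \<eta>'" "0 \<le> \<eta>' + \<eta>' + \<eta>' + \<eta>'" "0 \<le> \<eta>' + \<eta>' + \<eta>' + \<eta>' + \<eta>'"
    "0 \<le> \<eta>' + \<eta>' + \<eta>' + \<eta>' + \<eta>' + \<eta>'" "0 \<le> \<eta>' + \<eta>' + \<eta>' + \<eta>' + \<eta>' + \<eta>' + \<eta>'"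
    "0 \<le> \<eta>' + \<eta>' + \<eta>' + \<eta>' + \<eta>' + \<eta>' + \<eta>' + \<eta>'" using \<eta>' by auto
  note all = rare_disj[OF rare_disj[OF rare_disj[OF rare_disj[OF rare_disj[OF rare_disj[OF rare_disj[OF rare_disj[OF
    fixed(1) fixed(2) 0(1) 0(1)] fixed(3) 0(2) 0(1)] moving(1) 0(3) 0(1)] moving(2) 0(4) 0(1)] rare_\<Omega> 0(5) 0(1)] mass(1) 0(6) 0(1)] mass(2) 0(7) 0(1)] null 0(8) order_refl]
  have le: "rare P \<eta> A" if "rare P (\<eta>' + \<eta>' + \<eta>' + \<eta>' + \<eta>' + \<eta>' + \<eta>' + \<eta>' + 0) A" for A
    using that unfolding rare_def
  proof eventually_elim
    case (elim n)
    have "ennreal (\<eta>' + \<eta>' + \<eta>' + \<eta>' + \<eta>' + \<eta>' + \<eta>' + \<eta>' + 0) \<le> ennreal \<eta>"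
      using \<eta> by (intro ennreal_leI) (simp add: \<eta>'_def)
    then show ?case using elim by (meson order_trans)
  qed
  show ?thesis
  proof (rule rare_mono[OF le[OF all]], use eventually_ge_at_top[of 1] ev_cut ev_near ev_cons ev_bias ev_r ev_ex[of 1] ev_ex[of "-1"] ev_large in eventually_elim,
      intro ballI impI)
    fix n x
    assume n: "1 \<le> n" and cut: "L / sqrt (real n) < min \<tau> d" and near: "norm (\<gamma>n n - g) < \<tau>" and cons: "\<epsilon>c n < \<tau>"
      and bias': "\<forall>f\<in>Hn n. sqrt (real n) * \<bar>(f - f0) \<bullet> info_op (K \<theta>0) (least_favorable K K' \<theta>0 f - \<gamma>n n)\<bar> \<le> \<tau>"
      and r': "\<forall>\<theta>\<in>\<Theta>n n. \<forall>f\<in>Hn n. ennreal (exp (- (\<tau> * (1 + real n * (\<theta> - \<theta>0)\<^sup>2)))) \<le> r n \<theta> f"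
      and unit: "\<theta>0 + 1 / sqrt (real n) \<in> \<Theta>n n" "\<theta>0 + - 1 / sqrt (real n) \<in> \<Theta>n n"
      and large: "emeasure lborel {s. \<bar>s\<bar> \<le> 2 * L \<and> \<theta>0 + s / sqrt (real n) \<notin> \<Theta>n n} \<le> ennreal \<tau>"
      and big: "\<epsilon> < \<bar>tv_dist (distr (pst n x) borel fst)
       (normal_law (\<theta>0 + 1 / sqrt (real n) * efficient_Delta e K K' n \<theta>0 f0 x)
                   (1 / real n * inverse (efficient_info K K' \<theta>0 f0))) - 0\<bar>"
    show "(((((((a < \<bar>noise2 n x (blinfun_apply (K' \<theta>0) f0)\<bar> \<or> a < \<bar>noise1 n x g\<bar>) \<or> a < \<bar>noise2 n x (blinfun_apply (K \<theta>0) g)\<bar>) \<or>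
        \<tau> / 2 < \<bar>noise1 n x (\<gamma>n n - g)\<bar>) \<or> \<tau> / 2 < \<bar>noise2 n x (blinfun_apply (K \<theta>0) (\<gamma>n n - g))\<bar>) \<or> x \<notin> \<Omega> n) \<or>
        \<tau> / 4 < \<bar>measure (pst n x) {(\<theta>, f). \<theta> \<in> space (theta_prior \<Theta> p) \<and> \<bar>\<theta> - \<theta>0\<bar> < \<epsilon>c n \<and> norm (f - f0) < \<epsilon>c n} - 1\<bar>) \<or>
        \<tau> / 4 < \<bar>measure (pst n x) (\<Theta>n n \<times> Hn n) - 1\<bar>) \<or> \<not> (ok n x \<and> dom n x)"
    proof (rule ccontr)
      assume neg: "\<not> ?thesis"
      then have x: "x \<in> \<Omega> n" and okx: "ok n x" and domx: "dom n x" by blast+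
      from neg have noise: "\<bar>noise2 n x (blinfun_apply (K' \<theta>0) f0)\<bar> \<le> a" "\<bar>noise1 n x g\<bar> \<le> a" "\<bar>noise2 n x (blinfun_apply (K \<theta>0) g)\<bar> \<le> a"
        "\<bar>noise1 n x (\<gamma>n n - g)\<bar> \<le> \<tau> / 2" "\<bar>noise2 n x (blinfun_apply (K \<theta>0) (\<gamma>n n - g))\<bar> \<le> \<tau> / 2"
        and mass: "\<bar>measure (pst n x) {(\<theta>, f). \<theta> \<in> space (theta_prior \<Theta> p) \<and> \<bar>\<theta> - \<theta>0\<bar> < \<epsilon>c n \<and> norm (f - f0) < \<epsilon>c n} - 1\<bar> \<le> \<tau> / 4"
        "\<bar>measure (pst n x) (\<Theta>n n \<times> Hn n) - 1\<bar> \<le> \<tau> / 4"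
        unfolding de_Morgan_disj not_less by blast+
      have "\<bar>tv_dist (distr (pst n x) borel fst)
       (normal_law (\<theta>0 + 1 / sqrt (real n) * efficient_Delta e K K' n \<theta>0 f0 x)
                   (1 / real n * inverse (efficient_info K K' \<theta>0 f0)))\<bar>
      \<le> 2 * ((exp (\<tau> * (2 + 4 * L\<^sup>2 + 60 * D ^ 5 * L\<^sup>2)) - 1) + sqrt J * \<tau> + \<tau> + 4 * exp (- ((L - 2 * D / J) * sqrt J))
        + 2 * exp (4 * D ^ 4 + 2 - J / 8 * L) + 2 * pu / pl * exp (- (J\<^sup>2 / (16 * kk) * L\<^sup>2)))"
        unfolding J_def kk_def
      proof (rule tv_le_on_good_event[where a=a and w="\<gamma>n n" and Hn="Hn n" and T="\<Theta>n n" and r="r n" and \<delta>="\<epsilon>c n" and ?C0.0=C0])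
        show "AE q in lprior. fst q \<in> \<Theta> \<longrightarrow>
          snd q \<in> pairing_domain e (fst x) \<and> blinfun_apply (K \<theta>0) (snd q) \<in> pairing_domain e (snd x) \<and>
          blinfun_apply (K (fst q)) (snd q) \<in> pairing_domain e (snd x) \<and>
          \<bar>noise2 n x (blinfun_apply (K (fst q)) (snd q) - blinfun_apply (K \<theta>0) (snd q) - (fst q - \<theta>0) *\<^sub>R blinfun_apply (K' \<theta>0) f0)\<bar>
            \<le> D * \<bar>fst q - \<theta>0\<bar> * (norm (snd q - f0) + \<bar>fst q - \<theta>0\<bar>) \<and>
          blinfun_apply (K (fst q)) (\<gamma>n n) \<in> pairing_domain e (snd x) \<and>
          \<bar>noise2 n x (blinfun_apply (K (fst q)) (\<gamma>n n) - blinfun_apply (K \<theta>0) (\<gamma>n n))\<bar> \<le> D * \<bar>fst q - \<theta>0\<bar>"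
          using okx x unfolding ok_def by simp
        show "\<theta> \<in> \<Theta>" if "\<bar>\<theta> - \<theta>0\<bar> \<le> \<tau>" for \<theta> using b(2) that \<tau>(2) by simp
        show "exp (- \<tau>) * p \<theta> \<le> p \<theta>'" if "\<bar>\<theta> - \<theta>0\<bar> \<le> L / sqrt (real n)" "\<bar>\<theta>' - \<theta>0\<bar> \<le> L / sqrt (real n)" for \<theta> \<theta>'
          using d(2)[of \<theta> \<theta>'] that cut by simp
        show "0 \<le> C0" by (simp add: C0_def)
        show "shift_density \<pi>f ((\<theta> - \<theta>0) *\<^sub>R \<gamma>n n) (r n \<theta>)" if "\<theta> \<in> \<Theta>n n" for \<theta> by (rule shift_version[OF n that])
        show "L / sqrt (real n) \<le> \<tau>" using cut by simp
        show "norm (\<gamma>n n - g) \<le> \<tau>" using near by simp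
        show "\<theta>0 - 1 / sqrt (real n) \<in> \<Theta>n n" using unit(2) by simp
        show "\<epsilon>c n \<le> \<tau>" using cons by simp
        show "sqrt (real n) * \<bar>(f - f0) \<bullet> info_op (K \<theta>0) (least_favorable K K' \<theta>0 f - \<gamma>n n)\<bar> \<le> \<tau>" if "f \<in> Hn n" for f
          using bias' that by blast
        show "ennreal (exp (- (\<tau> * (1 + real n * (\<theta> - \<theta>0)\<^sup>2)))) \<le> r n \<theta> f" if "\<theta> \<in> \<Theta>n n" "f \<in> Hn n" for \<theta> f
          using r' that by blast
      qed (fact n J[unfolded J_def] \<tau>(1,3,4) \<tau>(5,6)[unfolded J_def kk_def] L(1) L(2)[unfolded J_def kk_def] D(1-7) C0 pl
          H_n Theta_n unit(1) large noise mass domx[unfolded dom_def, THEN conjunct1] domx[unfolded dom_def, THEN conjunct2, THEN conjunct1]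
          domx[unfolded dom_def, THEN conjunct2, THEN conjunct2, THEN conjunct1]
          domx[unfolded dom_def, THEN conjunct2, THEN conjunct2, THEN conjunct2, THEN conjunct1]
          domx[unfolded dom_def, THEN conjunct2, THEN conjunct2, THEN conjunct2, THEN conjunct2])+
      \<comment> \<open>One \<epsilon>/8 covers the three terms controlled by \<tau>, the other
        three cover the tails beyond L; the leading 2 is the factor in the total variation
        distance.\<close>
      also have "\<dots> \<le> 2 * (\<epsilon> / 8 + \<epsilon> / 8 + \<epsilon> / 8 + \<epsilon> / 8)"
        using \<tau>(7) L(3-5) by (intro mult_left_mono add_mono) auto
      also have "\<dots> = \<epsilon>" by simp
      finally show False using big by simp
    qed
  qed
qed

end

theorem theorem2p3:
  fixes \<Theta> :: "real set" and \<theta>0 :: real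
    and e :: "nat \<Rightarrow> 'h :: {real_inner, polish_space}" and f0 :: 'h
    and K K' :: "real \<Rightarrow> 'h \<Rightarrow>\<^sub>L 'h"
    and p :: "real \<Rightarrow> real" and \<pi>f :: "'h measure"
    and S :: "'h set" and nS :: "'h \<Rightarrow> real" and D0 D1 D2 :: real
    and \<gamma>n :: "nat \<Rightarrow> 'h" and \<Theta>n :: "nat \<Rightarrow> real set" and Hn :: "nat \<Rightarrow> 'h set"
    and r :: "nat \<Rightarrow> real \<Rightarrow> 'h \<Rightarrow> ennreal"
  defines "\<pi>\<theta> \<equiv> theta_prior \<Theta> p"
    and "P \<equiv> \<lambda>n. obs_law e K n \<theta>0 f0"
    and "\<gamma> \<equiv> least_favorable K K' \<theta>0"
  \<comment> \<open>model and prior\<close>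
  assumes Theta: "compact \<Theta>" "\<theta>0 \<in> \<Theta>"
    and basis: "orthonormal_basis e"
    and prior_theta: "prob_space \<pi>\<theta>" "continuous_on \<Theta> p"
      "\<exists>c C. 0 < c \<and> (\<forall>\<theta>\<in>\<Theta>. c \<le> p \<theta> \<and> p \<theta> \<le> C)"
    and prior_f: "prob_space \<pi>f" "sets \<pi>f = sets borel"
  \<comment> \<open>(a) smoothing and entropy\<close>
    and S_norm: "norm_on S nS" "\<exists>C. \<forall>h\<in>S. norm h \<le> C * nS h"
    and smoothing: "\<And>\<theta>. \<theta> \<in> \<Theta> \<Longrightarrow> range (blinfun_apply (K \<theta>)) \<subseteq> S"
    and entropy: "(\<integral>\<^sup>+\<epsilon>\<in>{0<..1}. sqrt_log (covering_number \<epsilon> {h\<in>S. nS h \<le> 1}) \<partial>lborel) < \<infinity>"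
  \<comment> \<open>(b) regularity\<close>
    and derivative: "\<And>\<theta> f. \<theta> \<in> \<Theta> \<Longrightarrow>
      ((\<lambda>s. (blinfun_apply (K (\<theta> + s)) f - blinfun_apply (K \<theta>) f) /\<^sub>R s)
        \<longlongrightarrow> blinfun_apply (K' \<theta>) f) (at 0 within {s. \<theta> + s \<in> \<Theta>})"
    and bounded: "\<And>\<theta>. \<theta> \<in> \<Theta> \<Longrightarrow> norm (K \<theta>) \<le> D0 \<and> norm (K' \<theta>) \<le> D0"
    and lipschitz: "\<And>\<theta>. \<theta> \<in> \<Theta> \<Longrightarrow>
      opnorm_into S nS (K \<theta> - K \<theta>0) \<le> ereal (D1 * \<bar>\<theta> - \<theta>0\<bar>)"
    and quadratic: "\<And>\<theta>. \<theta> \<in> \<Theta> \<Longrightarrow>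
      opnorm_into S nS (K \<theta> - K \<theta>0 - (\<theta> - \<theta>0) *\<^sub>R K' \<theta>0) \<le> ereal (D2 * (\<theta> - \<theta>0)\<^sup>2)"
  \<comment> \<open>(c) consistency\<close>
    and consistent: "posterior_consistent e K \<pi>\<theta> \<pi>f \<theta>0 f0"
    and nonzero: "blinfun_apply (K' \<theta>0) f0 \<noteq> 0"
  \<comment> \<open>(d) approximately least favorable directions and sieves\<close>
    and gamma_n: "\<gamma>n \<longlonglongrightarrow> \<gamma> f0"
    and Theta_n: "\<And>n. \<Theta>n n \<subseteq> \<Theta>" "\<And>n. \<Theta>n n \<in> sets borel"
    and H_n: "\<And>n. Hn n \<in> sets borel"
    and Theta_n_mono: "\<And>n. n \<ge> 1 \<Longrightarrow>
      (\<lambda>\<theta>. sqrt (real n) * (\<theta> - \<theta>0)) ` \<Theta>n n \<subseteq> (\<lambda>\<theta>. sqrt (real (Suc n)) * (\<theta> - \<theta>0)) ` \<Theta>n (Suc n)"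
    and Theta_n_exhaust: "(\<Union>n\<in>{1..}. (\<lambda>\<theta>. sqrt (real n) * (\<theta> - \<theta>0)) ` \<Theta>n n) = UNIV"
    and sieve_mass: "tendsto_in_prob P (\<lambda>n x. measure (posterior e K \<pi>\<theta> \<pi>f n x) (\<Theta>n n \<times> Hn n)) 1"
    and shifted_sieve_mass: "tendsto_in_prob P
      (\<lambda>n x. INF \<theta>\<in>\<Theta>n n. measure (posterior_known e K \<theta>0 \<pi>f n x)
         ((\<lambda>f. f + (\<theta> - \<theta>0) *\<^sub>R \<gamma>n n) ` Hn n)) 1"
    and bias: "(\<lambda>n. ennreal (sqrt (real n)) *
      (SUP f\<in>Hn n. ennreal \<bar>(f - f0) \<bullet> info_op (K \<theta>0) (\<gamma> f - \<gamma>n n)\<bar>)) \<longlonglongrightarrow> 0"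
    and shift_version: "\<And>n \<theta>. n \<ge> 1 \<Longrightarrow> \<theta> \<in> \<Theta>n n \<Longrightarrow>
      shift_density \<pi>f ((\<theta> - \<theta>0) *\<^sub>R \<gamma>n n) (r n \<theta>)"
    and shift_small: "(\<lambda>n. SUP \<theta>\<in>\<Theta>n n. SUP f\<in>Hn n.
      abs_log (r n \<theta> f) / ennreal (1 + real n * (\<theta> - \<theta>0)\<^sup>2)) \<longlonglongrightarrow> 0"
  shows "tendsto_in_prob P
    (\<lambda>n x. tv_dist (distr (posterior e K \<pi>\<theta> \<pi>f n x) borel fst)
       (normal_law (\<theta>0 + 1 / sqrt (real n) * efficient_Delta e K K' n \<theta>0 f0 x)
                   (1 / real n * inverse (efficient_info K K' \<theta>0 f0)))) 0"
proof -
  interpret bvm_model \<Theta> \<theta>0 e f0 K K' p \<pi>f S nS D0 D1 D2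
    by (intro bvm_model.intro)
      (fact Theta basis prior_theta[unfolded \<pi>\<theta>_def] prior_f S_norm entropy derivative bounded lipschitz quadratic)+
  show ?thesis
    unfolding P_def \<pi>\<theta>_def
  proof (rule rare_imp_tendsto_in_prob)
    fix \<epsilon> \<eta> :: real assume "0 < \<epsilon>" "0 < \<eta>"
    then show "rare (\<lambda>n. obs_law e K n \<theta>0 f0) \<eta> (\<lambda>n x. \<epsilon> < \<bar>tv_dist (distr (posterior e K (theta_prior \<Theta> p) \<pi>f n x) borel fst)
       (normal_law (\<theta>0 + 1 / sqrt (real n) * efficient_Delta e K K' n \<theta>0 f0 x)
                   (1 / real n * inverse (efficient_info K K' \<theta>0 f0))) - 0\<bar>)"
      by (intro rare_total_variation[OF consistent[unfolded \<pi>\<theta>_def] nonzero gamma_n[unfolded \<gamma>_def] Theta_n H_n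
          Theta_n_mono Theta_n_exhaust sieve_mass[unfolded P_def \<pi>\<theta>_def] bias[unfolded \<gamma>_def] shift_version shift_small])
  qed
qed

end
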